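(* Let $T:E\to\mathcal{A}$ be a relative Rota--Baxter operator on a LieRep pair $(\mathcal{A};\rho)$. Then the map $\Phi:\mathcal{C}^k(E,\mathcal{A})\to\mathrm{Der}^k(E)$, $k\ge0$, given by $\Phi(P)(u_1,\dots,u_k,u_{k+1})=\rho(P(u_1,\dots,u_k))u_{k+1}$, is a homomorphism of cochain complexes from $(\mathcal{C}^*(E,\mathcal{A}),\mathrm{d}_T)$ to $(\mathrm{Der}^*(E),\mathrm{d}_{\mathrm{def}})$, that is, $\mathrm{d}_{\mathrm{def}}\circ\Phi=\Phi\circ\mathrm{d}_T$. Consequently, $\Phi$ induces a homomorphism $\Phi_*:\mathcal{H}^k_T(E,\mathcal{A})\to\mathrm{H}^k_{\mathrm{def}}(E)$ from the cohomology groups of the relative Rota--Baxter operator $T$ to the deformation cohomology groups of the induced left-symmetric algebroid $(E,\ast_T,a_T)$.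
   Context: Vector bundles are smooth real vector bundles over a smooth manifold $M$; bundle maps cover the identity. A Lie algebroid $(\mathcal{A},[\cdot,\cdot]_{\mathcal{A}},a_{\mathcal{A}})$ is a vector bundle $\mathcal{A}\to M$ with a Lie bracket on $\Gamma(\mathcal{A})$ and a bundle map $a_{\mathcal{A}}:\mathcal{A}\to TM$ with $[x,fy]_{\mathcal{A}}=f[x,y]_{\mathcal{A}}+a_{\mathcal{A}}(x)(f)y$. A representation of $\mathcal{A}$ on $E$ is a $C^\infty(M)$-linear map $x\mapsto\rho(x)$ from $\Gamma(\mathcal{A})$ to $\mathbb{R}$-linear operators on $\Gamma(E)$ with $\rho(x)(fu)=f\rho(x)u+a_{\mathcal{A}}(x)(f)u$ and $\rho([x,y]_{\mathcal{A}})=\rho(x)\rho(y)-\rho(y)\rho(x)$. A LieRep pair $(\mathcal{A};\rho)$ is a Lie algebroid with a representation $\rho$ on a vector bundle $E$. A relative Rota--Baxter operator is a bundle map $T:E\to\mathcal{A}$ with $[T(u),T(v)]_{\mathcal{A}}=T(\rho(T(u))(v)-\rho(T(v))(u))$ for all $u,v\in\Gamma(E)$. $\mathbb{S}_{(i_1,\dots,i_k)}$ is the set of unshuffles (permutations increasing on consecutive blocks of lengths $i_1,\dots,i_k$), $(-1)^\sigma$ is the sign, and a sum involving a block of length $-1$ is zero. $\mathcal{C}^k(E,\mathcal{A})=\Gamma(\mathrm{Hom}(\wedge^kE,\mathcal{A}))$, $\mathcal{C}^*(E,\mathcal{A})=\oplus_{k\ge0}\mathcal{C}^k(E,\mathcal{A})$,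 with graded Lie bracket, for $P\in \mathcal{C}^n(E,\mathcal{A})$, $Q\in \mathcal{C}^m(E,\mathcal{A})$, $$\begin{aligned} [\![P,Q]\!](u_1,\dots,u_{m+n})={}&\sum_{\sigma\in\mathbb{S}_{(m,1,n-1)}} (-1)^\sigma P(\rho(Q(u_{\sigma(1)},\dots,u_{\sigma(m)}))u_{\sigma(m+1)},u_{\sigma(m+2)},\dots,u_{\sigma(m+n)})\\ &-(-1)^{mn}\sum_{\sigma\in\mathbb{S}_{(n,1,m-1)}} (-1)^\sigma Q(\rho(P(u_{\sigma(1)},\dots,u_{\sigma(n)}))u_{\sigma(n+1)},u_{\sigma(n+2)},\dots,u_{\sigma(m+n)})\\ &+(-1)^{mn}\sum_{\sigma\in\mathbb{S}_{(n,m)}} (-1)^\sigma [P(u_{\sigma(1)},\dots,u_{\sigma(n)}),Q(u_{\sigma(n+1)},\dots,u_{\sigma(m+n)})]_{\mathcal{A}}. \end{aligned}$$ Put $\mathrm{d}_TP=(-1)^k[\![T,P]\!]$ for $P\in\mathcal{C}^k(E,\mathcal{A})$; then $\mathrm{d}_T^2=0$ and $\mathcal{H}^k_T(E,\mathcal{A})$ is the $k$-th cohomology group. $\mathrm{Der}^n(E)$, $n\ge0$, is the space of $\mathbb{R}$-multilinear maps $D\in\mathrm{Hom}(\wedge^n\Gamma(E)\otimes\Gamma(E),\Gamma(E))$ that are $C^\infty(M)$-linear in each of the first $n$ arguments and satisfy $D(u_1,\dots,u_n,fu_{n+1})=fD(u_1,\dots,u_{n+1})+\sigma_D(u_1,\dots,u_n)(f)u_{n+1}$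 for some $\sigma_D\in\Gamma(\mathrm{Hom}(\wedge^nE,TM))$. $\mathrm{Der}^*(E)=\oplus_{n\ge0}\mathrm{Der}^n(E)$ has the graded Lie bracket, for $D_1\in\mathrm{Der}^n(E)$, $D_2\in\mathrm{Der}^m(E)$, $[D_1,D_2]_{\mathrm{MN}}=D_1\circ D_2-(-1)^{mn}D_2\circ D_1$ with $$\begin{aligned} (D_1\circ D_2)(u_1,\dots,u_{m+n+1})={}&\sum_{\sigma\in\mathbb{S}_{(m,1,n-1)}}(-1)^\sigma D_1(D_2(u_{\sigma(1)},\dots,u_{\sigma(m+1)}),u_{\sigma(m+2)},\dots,u_{\sigma(m+n)},u_{m+n+1})\\ &+(-1)^{mn}\sum_{\sigma\in\mathbb{S}_{(n,m)}}(-1)^\sigma D_1(u_{\sigma(1)},\dots,u_{\sigma(n)},D_2(u_{\sigma(n+1)},\dots,u_{\sigma(m+n)},u_{m+n+1})). \end{aligned}$$ A left-symmetric algebroid is a vector bundle with an $\mathbb{R}$-bilinear product $\ast$ on sections satisfying $x\ast(y\ast z)-(x\ast y)\ast z=y\ast(x\ast z)-(y\ast x)\ast z$ and an anchor $a$ (a bundle map to $TM$) with $x\ast(fy)=f(x\ast y)+a(x)(f)y$, $(fx)\ast y=f(x\ast y)$. For a left-symmetric algebroid structure on $E$ with product $\pi\in\mathrm{Der}^1(E)$ one has $[\pi,\pi]_{\mathrm{MN}}=0$, and $\mathrm{d}_{\mathrm{def}}:\mathrm{Der}^{n-1}(E)\to\mathrm{Der}^n(E)$ is $\mathrm{d}_{\mathrm{def}}(D)=(-1)^{n-1}[\pi,D]_{\mathrm{MN}}$;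 its $k$-th cohomology group $\mathrm{H}^k_{\mathrm{def}}(E)$ is the $k$-th deformation cohomology group. Here the left-symmetric algebroid on $E$ induced by $T$ is $(E,\ast_T,a_T=a_{\mathcal{A}}\circ T)$, $u\ast_Tv=\rho(Tu)(v)$. *)

theory Defs
  imports
    "HOL-Analysis.Analysis"
    "HOL-Library.Function_Algebras"
    "HOL-Combinatorics.Permutations"
    "HOL-Algebra.Coset"
begin

section \<open>Linear algebra\<close>

text \<open>Functions into a real vector space form a real vector space pointwise. Sections, cochains and
  derivations at a point are added and scaled in this sense.\<close>

instantiation "fun" :: (type, real_vector) real_vector
begin

definition scaleR_fun :: "real \<Rightarrow> ('a \<Rightarrow> 'b) \<Rightarrow> 'a \<Rightarrow> 'b"
  where "scaleR_fun c f = (\<lambda>x. c *\<^sub>R f x)"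

instance
  by standard (simp_all add: scaleR_fun_def plus_fun_def fun_eq_iff scaleR_add_right scaleR_add_left)

end

text \<open>Finite-dimensional model spaces, for charts and for fibres. The class \<open>euclidean_space\<close> alone
  would exclude dimension zero (points as manifolds, zero bundles), because its bases are nonempty.\<close>

class fin_dim_normed = real_normed_vector +
  assumes finite_spanning_set: "\<exists>B. finite B \<and> (\<forall>x. \<exists>c. x = (\<Sum>b\<in>B. c b *\<^sub>R b))"

instance euclidean_space \<subseteq> fin_dim_normed
  by standard (use finite_Basis euclidean_representation[symmetric] in blast)

definition real_linear_on :: "'a::real_vector set \<Rightarrow> ('a \<Rightarrow> 'b::real_vector) \<Rightarrow> bool"
  where "real_linear_on S h \<longleftrightarrow>
    (\<forall>x\<in>S. \<forall>y\<in>S. h (x + y) = h x + h y) \<and> (\<forall>c. \<forall>x\<in>S. h (c *\<^sub>R x) = c *\<^sub>R h x)"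

text \<open>The arguments of a map in \<open>k\<close> variables are collected in a list of length \<open>k\<close>, indexed from 0.\<close>

definition tuples :: "'a set \<Rightarrow> nat \<Rightarrow> 'a list set"
  where "tuples S k = {us. length us = k \<and> set us \<subseteq> S}"

definition multilinear_on :: "'a::real_vector set \<Rightarrow> nat \<Rightarrow> ('a list \<Rightarrow> 'b::real_vector) \<Rightarrow> bool"
  where "multilinear_on S k p \<longleftrightarrow>
    (\<forall>us\<in>tuples S k. \<forall>i<k. real_linear_on S (\<lambda>v. p (us[i := v])))"

text \<open>Alternating in the first \<open>n\<close> of \<open>k\<close> arguments.\<close>

definition alternating_on :: "'a set \<Rightarrow> nat \<Rightarrow> nat \<Rightarrow> ('a list \<Rightarrow> 'b::zero) \<Rightarrow> bool"
  where "alternating_on S n k p \<longleftrightarrow>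
    (\<forall>us\<in>tuples S k. \<forall>i j. i < j \<and> j < n \<and> us ! i = us ! j \<longrightarrow> p us = 0)"


section \<open>Smooth manifolds\<close>

text \<open>\<open>C\<^sup>k\<close> maps on an open subset of a finite-dimensional space; there, continuity of all iterated
  directional derivatives amounts to continuity of the iterated Frechet derivatives.\<close>

primrec Ck_on :: "nat \<Rightarrow> 'a::real_normed_vector set \<Rightarrow> ('a \<Rightarrow> 'b::real_normed_vector) \<Rightarrow> bool"
  where
    "Ck_on 0 S f \<longleftrightarrow> continuous_on S f"
  | "Ck_on (Suc k) S f \<longleftrightarrow>
      (\<forall>x\<in>S. f differentiable (at x)) \<and> (\<forall>v. Ck_on k S (\<lambda>x. frechet_derivative f (at x) v))"

definition Cinf_on :: "'a::real_normed_vector set \<Rightarrow> ('a \<Rightarrow> 'b::real_normed_vector) \<Rightarrow> bool"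
  where "Cinf_on S f \<longleftrightarrow> (\<forall>k. Ck_on k S f)"

text \<open>The manifold is the whole type \<open>'m\<close>, whose sort makes it Hausdorff and second countable; the
  smooth structure is an atlas of pairs of a chart domain and a chart, not necessarily maximal.\<close>

type_synonym ('m, 'c) atlas = "('m set \<times> ('m \<Rightarrow> 'c)) set"

definition smooth_manifold ::
    "('m::{t2_space,second_countable_topology}, 'c::fin_dim_normed) atlas \<Rightarrow> bool"
  where "smooth_manifold M \<longleftrightarrow>
    \<Union> (fst ` M) = UNIV \<and>
    (\<forall>(U, \<phi>)\<in>M. open U \<and> open (\<phi> ` U) \<and> homeomorphism U (\<phi> ` U) \<phi> (inv_into U \<phi>)) \<and>
    (\<forall>(U, \<phi>)\<in>M. \<forall>(V, \<psi>)\<in>M. Cinf_on (\<phi> ` (U \<inter> V)) (\<psi> \<circ> inv_into U \<phi>))"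

definition smooth_on :: "('m::{t2_space,second_countable_topology}, 'c::fin_dim_normed) atlas \<Rightarrow>
    'm set \<Rightarrow> ('m \<Rightarrow> 'b::real_normed_vector) \<Rightarrow> bool"
  where "smooth_on M W f \<longleftrightarrow> (\<forall>(U, \<phi>)\<in>M. Cinf_on (\<phi> ` (U \<inter> W)) (f \<circ> inv_into U \<phi>))"

definition smooth_functions ::
    "('m::{t2_space,second_countable_topology}, 'c::fin_dim_normed) atlas \<Rightarrow> ('m \<Rightarrow> real) set"
  where "smooth_functions M = {f. smooth_on M UNIV f}"


section \<open>Vector bundles\<close>

text \<open>The fibres are linear subspaces of an ambient vector space \<open>'v\<close>, which carries no topology and
  only serves to make the fibrewise operations available; every family of vector spaces embeds in
  its direct sum. The topology and the smooth structure come from the bundle atlas. Its elements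
  \<open>(U, \<tau>)\<close> are inverses of local trivialisations: \<open>\<tau> x\<close> is an isomorphism from the typical fibre \<open>'f\<close>
  onto the fibre over \<open>x\<close>, for \<open>x \<in> U\<close>.\<close>

record ('m, 'v, 'f) vbundle =
  fibre :: "'m \<Rightarrow> 'v set"
  triv :: "('m set \<times> ('m \<Rightarrow> 'f \<Rightarrow> 'v)) set"

definition vector_bundle :: "('m::{t2_space,second_countable_topology}, 'c::fin_dim_normed) atlas \<Rightarrow>
    ('m, 'v::real_vector, 'f::fin_dim_normed) vbundle \<Rightarrow> bool"
  where "vector_bundle M E \<longleftrightarrow>
    \<Union> (fst ` triv E) = UNIV \<and>
    (\<forall>(U, \<tau>)\<in>triv E. open U \<and> (\<forall>x\<in>U. linear (\<tau> x) \<and> bij_betw (\<tau> x) UNIV (fibre E x))) \<and>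
    (\<forall>(U, \<tau>)\<in>triv E. \<forall>(V, \<tau>')\<in>triv E. \<forall>w. smooth_on M (U \<inter> V) (\<lambda>x. inv_into UNIV (\<tau>' x) (\<tau> x w)))"

definition local_sections ::
    "('m::{t2_space,second_countable_topology}, 'c::fin_dim_normed) atlas \<Rightarrow>
    ('m, 'v::real_vector, 'f::fin_dim_normed) vbundle \<Rightarrow> 'm set \<Rightarrow> ('m \<Rightarrow> 'v) set"
  where "local_sections M E U =
    {s. (\<forall>x\<in>U. s x \<in> fibre E x) \<and>
        (\<forall>(V, \<tau>)\<in>triv E. smooth_on M (U \<inter> V) (\<lambda>x. inv_into UNIV (\<tau> x) (s x)))}"

abbreviation sections ("\<Gamma>")
  where "\<Gamma> M E \<equiv> local_sections M E UNIV"

definition fun_mult :: "('m \<Rightarrow> real) \<Rightarrow> ('m \<Rightarrow> 'v::real_vector) \<Rightarrow> 'm \<Rightarrow> 'v" (infixr "\<odot>" 75)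
  where "f \<odot> s = (\<lambda>x. f x *\<^sub>R s x)"

text \<open>Bundle maps over the identity. Smoothness is tested on smooth local sections, in particular on
  local frames, for which it says that the matrix entries are smooth.\<close>

definition bundle_map :: "('m::{t2_space,second_countable_topology}, 'c::fin_dim_normed) atlas \<Rightarrow>
    ('m, 'v::real_vector, 'f::fin_dim_normed) vbundle \<Rightarrow>
    ('m, 'w::real_vector, 'g::fin_dim_normed) vbundle \<Rightarrow> ('m \<Rightarrow> 'v \<Rightarrow> 'w) \<Rightarrow> bool"
  where "bundle_map M E F T \<longleftrightarrow>
    (\<forall>x. T x ` fibre E x \<subseteq> fibre F x \<and> real_linear_on (fibre E x) (T x)) \<and>
    (\<forall>U s. open U \<and> s \<in> local_sections M E U \<longrightarrow> (\<lambda>x. T x (s x)) \<in> local_sections M F U)"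

definition push :: "('m \<Rightarrow> 'v \<Rightarrow> 'w) \<Rightarrow> ('m \<Rightarrow> 'v) \<Rightarrow> 'm \<Rightarrow> 'w"
  where "push T u = (\<lambda>x. T x (u x))"

text \<open>Tangent vectors at \<open>x\<close> are the derivations at \<open>x\<close> of the algebra of smooth functions,
  extended by 0 to all functions. A chart \<open>\<phi>\<close> trivialises the tangent bundle by directional
  derivatives in the chart.\<close>

definition tangent_space :: "('m::{t2_space,second_countable_topology}, 'c::fin_dim_normed) atlas \<Rightarrow>
    'm \<Rightarrow> (('m \<Rightarrow> real) \<Rightarrow> real) set"
  where "tangent_space M x =
    {D. (\<forall>f. f \<notin> smooth_functions M \<longrightarrow> D f = 0) \<and>
        real_linear_on (smooth_functions M) D \<and>
        (\<forall>f\<in>smooth_functions M. \<forall>g\<in>smooth_functions M. D (f * g) = f x * D g + g x * D f)}"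

definition tangent_bundle ::
    "('m::{t2_space,second_countable_topology}, 'c::fin_dim_normed) atlas \<Rightarrow>
    ('m, ('m \<Rightarrow> real) \<Rightarrow> real, 'c) vbundle"
  where "tangent_bundle M =
    \<lparr> fibre = tangent_space M,
      triv = (\<lambda>(U, \<phi>). (U, \<lambda>x w f. if f \<in> smooth_functions M
                then frechet_derivative (f \<circ> inv_into U \<phi>) (at (\<phi> x)) w else 0)) ` M \<rparr>"

text \<open>The derivative of a function along a vector field.\<close>

definition vf_apply :: "('m \<Rightarrow> ('m \<Rightarrow> real) \<Rightarrow> real) \<Rightarrow> ('m \<Rightarrow> real) \<Rightarrow> 'm \<Rightarrow> real"
  where "vf_apply X f = (\<lambda>x. X x f)"

text \<open>Smooth sections \<open>p\<close> of \<open>Hom(\<Lambda>\<^sup>kE, F)\<close>: fields of alternating \<open>k\<close>-linear maps between the fibres.\<close>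

definition hom_wedge_section ::
    "('m::{t2_space,second_countable_topology}, 'c::fin_dim_normed) atlas \<Rightarrow>
    ('m, 'v::real_vector, 'f::fin_dim_normed) vbundle \<Rightarrow>
    ('m, 'w::real_vector, 'g::fin_dim_normed) vbundle \<Rightarrow> nat \<Rightarrow> ('m \<Rightarrow> 'v list \<Rightarrow> 'w) \<Rightarrow> bool"
  where "hom_wedge_section M E F k p \<longleftrightarrow>
    (\<forall>x. (\<forall>vs\<in>tuples (fibre E x) k. p x vs \<in> fibre F x) \<and>
         multilinear_on (fibre E x) k (p x) \<and> alternating_on (fibre E x) k k (p x)) \<and>
    (\<forall>U us. open U \<and> us \<in> tuples (local_sections M E U) k \<longrightarrow>
         (\<lambda>x. p x (map (\<lambda>u. u x) us)) \<in> local_sections M F U)"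

text \<open>Sections of \<open>Hom(\<Lambda>\<^sup>kE, F)\<close> enter the brackets through their action on \<open>k\<close>-tuples of sections of
  \<open>E\<close>, and are identified with it. Here and below, maps on tuples of sections take the value 0
  outside their domain, so that equality of maps is equality on the domain.\<close>

definition act_on_sections ::
    "('m::{t2_space,second_countable_topology}, 'c::fin_dim_normed) atlas \<Rightarrow>
    ('m, 'v::real_vector, 'f::fin_dim_normed) vbundle \<Rightarrow> nat \<Rightarrow> ('m \<Rightarrow> 'v list \<Rightarrow> 'w::real_vector) \<Rightarrow>
    ('m \<Rightarrow> 'v) list \<Rightarrow> 'm \<Rightarrow> 'w"
  where "act_on_sections M E k p us =
    (if us \<in> tuples (\<Gamma> M E) k then (\<lambda>x. p x (map (\<lambda>u. u x) us)) else 0)"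

definition hom_cochains ::
    "('m::{t2_space,second_countable_topology}, 'c::fin_dim_normed) atlas \<Rightarrow>
    ('m, 'v::real_vector, 'f::fin_dim_normed) vbundle \<Rightarrow>
    ('m, 'w::real_vector, 'g::fin_dim_normed) vbundle \<Rightarrow> nat \<Rightarrow>
    (('m \<Rightarrow> 'v) list \<Rightarrow> 'm \<Rightarrow> 'w) set"
  where "hom_cochains M E F k = act_on_sections M E k ` {p. hom_wedge_section M E F k p}"


section \<open>Lie algebroids, LieRep pairs and relative Rota--Baxter operators\<close>

definition lie_algebroid :: "('m::{t2_space,second_countable_topology}, 'c::fin_dim_normed) atlas \<Rightarrow>
    ('m, 'a::real_vector, 'g::fin_dim_normed) vbundle \<Rightarrow>
    (('m \<Rightarrow> 'a) \<Rightarrow> ('m \<Rightarrow> 'a) \<Rightarrow> 'm \<Rightarrow> 'a) \<Rightarrow> ('m \<Rightarrow> 'a \<Rightarrow> ('m \<Rightarrow> real) \<Rightarrow> real) \<Rightarrow> bool"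
  where "lie_algebroid M A br a \<longleftrightarrow>
    vector_bundle M A \<and>
    bundle_map M A (tangent_bundle M) a \<and>
    (\<forall>x\<in>\<Gamma> M A. \<forall>y\<in>\<Gamma> M A. br x y \<in> \<Gamma> M A) \<and>
    (\<forall>x\<in>\<Gamma> M A. real_linear_on (\<Gamma> M A) (br x) \<and> real_linear_on (\<Gamma> M A) (\<lambda>y. br y x)) \<and>
    (\<forall>x\<in>\<Gamma> M A. br x x = 0) \<and>
    (\<forall>x\<in>\<Gamma> M A. \<forall>y\<in>\<Gamma> M A. \<forall>z\<in>\<Gamma> M A. br x (br y z) + br y (br z x) + br z (br x y) = 0) \<and>
    (\<forall>x\<in>\<Gamma> M A. \<forall>y\<in>\<Gamma> M A. \<forall>f\<in>smooth_functions M.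
        br x (f \<odot> y) = f \<odot> br x y + vf_apply (push a x) f \<odot> y)"

definition lie_algebroid_rep ::
    "('m::{t2_space,second_countable_topology}, 'c::fin_dim_normed) atlas \<Rightarrow>
    ('m, 'a::real_vector, 'g::fin_dim_normed) vbundle \<Rightarrow>
    (('m \<Rightarrow> 'a) \<Rightarrow> ('m \<Rightarrow> 'a) \<Rightarrow> 'm \<Rightarrow> 'a) \<Rightarrow> ('m \<Rightarrow> 'a \<Rightarrow> ('m \<Rightarrow> real) \<Rightarrow> real) \<Rightarrow>
    ('m, 'v::real_vector, 'f::fin_dim_normed) vbundle \<Rightarrow>
    (('m \<Rightarrow> 'a) \<Rightarrow> ('m \<Rightarrow> 'v) \<Rightarrow> 'm \<Rightarrow> 'v) \<Rightarrow> bool"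
  where "lie_algebroid_rep M A br a E \<rho> \<longleftrightarrow>
    (\<forall>x\<in>\<Gamma> M A. \<forall>u\<in>\<Gamma> M E. \<rho> x u \<in> \<Gamma> M E) \<and>
    (\<forall>x\<in>\<Gamma> M A. real_linear_on (\<Gamma> M E) (\<rho> x)) \<and>
    (\<forall>u\<in>\<Gamma> M E. \<forall>x\<in>\<Gamma> M A. \<forall>y\<in>\<Gamma> M A. \<rho> (x + y) u = \<rho> x u + \<rho> y u) \<and>
    (\<forall>u\<in>\<Gamma> M E. \<forall>x\<in>\<Gamma> M A. \<forall>f\<in>smooth_functions M. \<rho> (f \<odot> x) u = f \<odot> \<rho> x u) \<and>
    (\<forall>x\<in>\<Gamma> M A. \<forall>u\<in>\<Gamma> M E. \<forall>f\<in>smooth_functions M.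
        \<rho> x (f \<odot> u) = f \<odot> \<rho> x u + vf_apply (push a x) f \<odot> u) \<and>
    (\<forall>x\<in>\<Gamma> M A. \<forall>y\<in>\<Gamma> M A. \<forall>u\<in>\<Gamma> M E. \<rho> (br x y) u = \<rho> x (\<rho> y u) - \<rho> y (\<rho> x u))"

definition lie_rep_pair :: "('m::{t2_space,second_countable_topology}, 'c::fin_dim_normed) atlas \<Rightarrow>
    ('m, 'a::real_vector, 'g::fin_dim_normed) vbundle \<Rightarrow>
    (('m \<Rightarrow> 'a) \<Rightarrow> ('m \<Rightarrow> 'a) \<Rightarrow> 'm \<Rightarrow> 'a) \<Rightarrow> ('m \<Rightarrow> 'a \<Rightarrow> ('m \<Rightarrow> real) \<Rightarrow> real) \<Rightarrow>
    ('m, 'v::real_vector, 'f::fin_dim_normed) vbundle \<Rightarrow>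
    (('m \<Rightarrow> 'a) \<Rightarrow> ('m \<Rightarrow> 'v) \<Rightarrow> 'm \<Rightarrow> 'v) \<Rightarrow> bool"
  where "lie_rep_pair M A br a E \<rho> \<longleftrightarrow>
    lie_algebroid M A br a \<and> vector_bundle M E \<and> lie_algebroid_rep M A br a E \<rho>"

definition relative_rota_baxter ::
    "('m::{t2_space,second_countable_topology}, 'c::fin_dim_normed) atlas \<Rightarrow>
    ('m, 'a::real_vector, 'g::fin_dim_normed) vbundle \<Rightarrow>
    (('m \<Rightarrow> 'a) \<Rightarrow> ('m \<Rightarrow> 'a) \<Rightarrow> 'm \<Rightarrow> 'a) \<Rightarrow>
    ('m, 'v::real_vector, 'f::fin_dim_normed) vbundle \<Rightarrow>
    (('m \<Rightarrow> 'a) \<Rightarrow> ('m \<Rightarrow> 'v) \<Rightarrow> 'm \<Rightarrow> 'v) \<Rightarrow> ('m \<Rightarrow> 'v \<Rightarrow> 'a) \<Rightarrow> bool"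
  where "relative_rota_baxter M A br E \<rho> T \<longleftrightarrow>
    bundle_map M E A T \<and>
    (\<forall>u\<in>\<Gamma> M E. \<forall>v\<in>\<Gamma> M E.
        br (push T u) (push T v) = push T (\<rho> (push T u) v - \<rho> (push T v) u))"

definition left_symmetric_algebroid ::
    "('m::{t2_space,second_countable_topology}, 'c::fin_dim_normed) atlas \<Rightarrow>
    ('m, 'v::real_vector, 'f::fin_dim_normed) vbundle \<Rightarrow>
    (('m \<Rightarrow> 'v) \<Rightarrow> ('m \<Rightarrow> 'v) \<Rightarrow> 'm \<Rightarrow> 'v) \<Rightarrow> ('m \<Rightarrow> 'v \<Rightarrow> ('m \<Rightarrow> real) \<Rightarrow> real) \<Rightarrow> bool"
  where "left_symmetric_algebroid M E star a \<longleftrightarrow>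
    vector_bundle M E \<and>
    bundle_map M E (tangent_bundle M) a \<and>
    (\<forall>x\<in>\<Gamma> M E. \<forall>y\<in>\<Gamma> M E. star x y \<in> \<Gamma> M E) \<and>
    (\<forall>x\<in>\<Gamma> M E. real_linear_on (\<Gamma> M E) (star x) \<and> real_linear_on (\<Gamma> M E) (\<lambda>y. star y x)) \<and>
    (\<forall>x\<in>\<Gamma> M E. \<forall>y\<in>\<Gamma> M E. \<forall>z\<in>\<Gamma> M E.
        star x (star y z) - star (star x y) z = star y (star x z) - star (star y x) z) \<and>
    (\<forall>x\<in>\<Gamma> M E. \<forall>y\<in>\<Gamma> M E. \<forall>f\<in>smooth_functions M.
        star x (f \<odot> y) = f \<odot> star x y + vf_apply (push a x) f \<odot> y \<and>
        star (f \<odot> x) y = f \<odot> star x y)"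


section \<open>The two graded Lie brackets\<close>

text \<open>The permutations of \<open>{..<i\<^sub>1 + \<dots> + i\<^sub>k}\<close> that are increasing on consecutive blocks of lengths
  \<open>i\<^sub>1, \<dots>, i\<^sub>k\<close>.\<close>

definition unshuffles :: "nat list \<Rightarrow> (nat \<Rightarrow> nat) set"
  where "unshuffles is =
    {\<sigma>. \<sigma> permutes {..<sum_list is} \<and>
        (\<forall>j<length is. strict_mono_on {sum_list (take j is)..<sum_list (take (Suc j) is)} \<sigma>)}"

definition select :: "'a list \<Rightarrow> (nat \<Rightarrow> nat) \<Rightarrow> nat \<Rightarrow> nat \<Rightarrow> 'a list"
  where "select us \<sigma> i j = map (\<lambda>l. us ! \<sigma> l) [i..<j]"

text \<open>The sum over \<open>(m,1,n-1)\<close>-unshuffles occurring in the bracket of cochains of degrees \<open>n\<close> and \<open>m\<close>;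
  it is 0 for \<open>n = 0\<close>, where the last block would have length \<open>-1\<close>.\<close>

definition rb_insert :: "(('m \<Rightarrow> 'a::real_vector) \<Rightarrow> ('m \<Rightarrow> 'v) \<Rightarrow> 'm \<Rightarrow> 'v) \<Rightarrow>
    nat \<Rightarrow> (('m \<Rightarrow> 'v) list \<Rightarrow> 'm \<Rightarrow> 'a) \<Rightarrow> nat \<Rightarrow> (('m \<Rightarrow> 'v) list \<Rightarrow> 'm \<Rightarrow> 'a) \<Rightarrow>
    ('m \<Rightarrow> 'v) list \<Rightarrow> 'm \<Rightarrow> 'a"
  where "rb_insert \<rho> n P m Q us =
    (if n = 0 then 0 else
      \<Sum>\<sigma>\<in>unshuffles [m, 1, n - 1]. real_of_int (sign \<sigma>) *\<^sub>R
        P (\<rho> (Q (select us \<sigma> 0 m)) (us ! \<sigma> m) # select us \<sigma> (m + 1) (m + n)))"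

definition rb_bracket :: "('m::{t2_space,second_countable_topology}, 'c::fin_dim_normed) atlas \<Rightarrow>
    (('m \<Rightarrow> 'a::real_vector) \<Rightarrow> ('m \<Rightarrow> 'a) \<Rightarrow> 'm \<Rightarrow> 'a) \<Rightarrow>
    ('m, 'v::real_vector, 'f::fin_dim_normed) vbundle \<Rightarrow>
    (('m \<Rightarrow> 'a) \<Rightarrow> ('m \<Rightarrow> 'v) \<Rightarrow> 'm \<Rightarrow> 'v) \<Rightarrow>
    nat \<Rightarrow> (('m \<Rightarrow> 'v) list \<Rightarrow> 'm \<Rightarrow> 'a) \<Rightarrow> nat \<Rightarrow> (('m \<Rightarrow> 'v) list \<Rightarrow> 'm \<Rightarrow> 'a) \<Rightarrow>
    ('m \<Rightarrow> 'v) list \<Rightarrow> 'm \<Rightarrow> 'a"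
  where "rb_bracket M br E \<rho> n P m Q us =
    (if us \<in> tuples (\<Gamma> M E) (m + n) then
       rb_insert \<rho> n P m Q us
       - (-1) ^ (m * n) *\<^sub>R rb_insert \<rho> m Q n P us
       + (-1) ^ (m * n) *\<^sub>R (\<Sum>\<sigma>\<in>unshuffles [n, m]. real_of_int (sign \<sigma>) *\<^sub>R
           br (P (select us \<sigma> 0 n)) (Q (select us \<sigma> n (m + n))))
     else 0)"

definition d_T :: "('m::{t2_space,second_countable_topology}, 'c::fin_dim_normed) atlas \<Rightarrow>
    (('m \<Rightarrow> 'a::real_vector) \<Rightarrow> ('m \<Rightarrow> 'a) \<Rightarrow> 'm \<Rightarrow> 'a) \<Rightarrow>
    ('m, 'v::real_vector, 'f::fin_dim_normed) vbundle \<Rightarrow>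
    (('m \<Rightarrow> 'a) \<Rightarrow> ('m \<Rightarrow> 'v) \<Rightarrow> 'm \<Rightarrow> 'v) \<Rightarrow> ('m \<Rightarrow> 'v \<Rightarrow> 'a) \<Rightarrow>
    nat \<Rightarrow> (('m \<Rightarrow> 'v) list \<Rightarrow> 'm \<Rightarrow> 'a) \<Rightarrow> ('m \<Rightarrow> 'v) list \<Rightarrow> 'm \<Rightarrow> 'a"
  where "d_T M br E \<rho> T k P =
    (-1) ^ k *\<^sub>R rb_bracket M br E \<rho> 1 (act_on_sections M E 1 (\<lambda>x vs. T x (hd vs))) k P"

text \<open>The space \<open>Der\<^sup>n(E)\<close>; in \<open>us @ [u]\<close> the last argument is \<open>u\<^sub>n\<^sub>+\<^sub>1\<close>.\<close>

definition Der :: "('m::{t2_space,second_countable_topology}, 'c::fin_dim_normed) atlas \<Rightarrow>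
    ('m, 'v::real_vector, 'f::fin_dim_normed) vbundle \<Rightarrow> nat \<Rightarrow>
    (('m \<Rightarrow> 'v) list \<Rightarrow> 'm \<Rightarrow> 'v) set"
  where "Der M E n =
    {D. (\<forall>us. us \<notin> tuples (\<Gamma> M E) (Suc n) \<longrightarrow> D us = 0) \<and>
        (\<forall>us\<in>tuples (\<Gamma> M E) (Suc n). D us \<in> \<Gamma> M E) \<and>
        multilinear_on (\<Gamma> M E) (Suc n) D \<and>
        alternating_on (\<Gamma> M E) n (Suc n) D \<and>
        (\<forall>us\<in>tuples (\<Gamma> M E) (Suc n). \<forall>i<n. \<forall>f\<in>smooth_functions M.
            D (us[i := f \<odot> (us ! i)]) = f \<odot> D us) \<and>
        (\<exists>\<sigma>\<in>hom_cochains M E (tangent_bundle M) n.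
          \<forall>us\<in>tuples (\<Gamma> M E) n. \<forall>u\<in>\<Gamma> M E. \<forall>f\<in>smooth_functions M.
            D (us @ [f \<odot> u]) = f \<odot> D (us @ [u]) + vf_apply (\<sigma> us) f \<odot> u)}"

definition mn_comp ::
    "nat \<Rightarrow> (('m \<Rightarrow> 'v::real_vector) list \<Rightarrow> 'm \<Rightarrow> 'v) \<Rightarrow> nat \<Rightarrow> (('m \<Rightarrow> 'v) list \<Rightarrow> 'm \<Rightarrow> 'v) \<Rightarrow>
    ('m \<Rightarrow> 'v) list \<Rightarrow> 'm \<Rightarrow> 'v"
  where "mn_comp n D1 m D2 us =
    (if n = 0 then 0 else
      \<Sum>\<sigma>\<in>unshuffles [m, 1, n - 1]. real_of_int (sign \<sigma>) *\<^sub>R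
        D1 (D2 (select us \<sigma> 0 (m + 1)) # select us \<sigma> (m + 1) (m + n) @ [us ! (m + n)]))
    + (-1) ^ (m * n) *\<^sub>R (\<Sum>\<sigma>\<in>unshuffles [n, m]. real_of_int (sign \<sigma>) *\<^sub>R
        D1 (select us \<sigma> 0 n @ [D2 (select us \<sigma> n (m + n) @ [us ! (m + n)])]))"

definition mn_bracket :: "('m::{t2_space,second_countable_topology}, 'c::fin_dim_normed) atlas \<Rightarrow>
    ('m, 'v::real_vector, 'f::fin_dim_normed) vbundle \<Rightarrow>
    nat \<Rightarrow> (('m \<Rightarrow> 'v) list \<Rightarrow> 'm \<Rightarrow> 'v) \<Rightarrow> nat \<Rightarrow> (('m \<Rightarrow> 'v) list \<Rightarrow> 'm \<Rightarrow> 'v) \<Rightarrow>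
    ('m \<Rightarrow> 'v) list \<Rightarrow> 'm \<Rightarrow> 'v"
  where "mn_bracket M E n D1 m D2 us =
    (if us \<in> tuples (\<Gamma> M E) (m + n + 1) then
       mn_comp n D1 m D2 us - (-1) ^ (m * n) *\<^sub>R mn_comp m D2 n D1 us
     else 0)"

text \<open>The product of a left-symmetric algebroid as an element of \<open>Der\<^sup>1(E)\<close>.\<close>

definition product_cochain :: "('m::{t2_space,second_countable_topology}, 'c::fin_dim_normed) atlas \<Rightarrow>
    ('m, 'v::real_vector, 'f::fin_dim_normed) vbundle \<Rightarrow>
    (('m \<Rightarrow> 'v) \<Rightarrow> ('m \<Rightarrow> 'v) \<Rightarrow> 'm \<Rightarrow> 'v) \<Rightarrow> ('m \<Rightarrow> 'v) list \<Rightarrow> 'm \<Rightarrow> 'v"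
  where "product_cochain M E star us =
    (if us \<in> tuples (\<Gamma> M E) 2 then star (us ! 0) (us ! 1) else 0)"

definition d_def :: "('m::{t2_space,second_countable_topology}, 'c::fin_dim_normed) atlas \<Rightarrow>
    ('m, 'v::real_vector, 'f::fin_dim_normed) vbundle \<Rightarrow>
    (('m \<Rightarrow> 'v) \<Rightarrow> ('m \<Rightarrow> 'v) \<Rightarrow> 'm \<Rightarrow> 'v) \<Rightarrow>
    nat \<Rightarrow> (('m \<Rightarrow> 'v) list \<Rightarrow> 'm \<Rightarrow> 'v) \<Rightarrow> ('m \<Rightarrow> 'v) list \<Rightarrow> 'm \<Rightarrow> 'v"
  where "d_def M E star k D = (-1) ^ k *\<^sub>R mn_bracket M E 1 (product_cochain M E star) k D"

definition Phi :: "('m::{t2_space,second_countable_topology}, 'c::fin_dim_normed) atlas \<Rightarrow>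
    ('m, 'v::real_vector, 'f::fin_dim_normed) vbundle \<Rightarrow>
    (('m \<Rightarrow> 'a) \<Rightarrow> ('m \<Rightarrow> 'v) \<Rightarrow> 'm \<Rightarrow> 'v) \<Rightarrow>
    nat \<Rightarrow> (('m \<Rightarrow> 'v) list \<Rightarrow> 'm \<Rightarrow> 'a) \<Rightarrow> ('m \<Rightarrow> 'v) list \<Rightarrow> 'm \<Rightarrow> 'v"
  where "Phi M E \<rho> k P us =
    (if us \<in> tuples (\<Gamma> M E) (Suc k) then \<rho> (P (butlast us)) (last us) else 0)"

definition induced_product :: "(('m \<Rightarrow> 'a) \<Rightarrow> ('m \<Rightarrow> 'v) \<Rightarrow> 'm \<Rightarrow> 'v) \<Rightarrow> ('m \<Rightarrow> 'v \<Rightarrow> 'a) \<Rightarrow>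
    ('m \<Rightarrow> 'v) \<Rightarrow> ('m \<Rightarrow> 'v) \<Rightarrow> 'm \<Rightarrow> 'v"
  where "induced_product \<rho> T u v = \<rho> (push T u) v"

definition induced_anchor :: "('m \<Rightarrow> 'a \<Rightarrow> ('m \<Rightarrow> real) \<Rightarrow> real) \<Rightarrow> ('m \<Rightarrow> 'v \<Rightarrow> 'a) \<Rightarrow>
    'm \<Rightarrow> 'v \<Rightarrow> ('m \<Rightarrow> real) \<Rightarrow> real"
  where "induced_anchor a T x = a x \<circ> T x"


section \<open>Cohomology\<close>

text \<open>For a cochain complex with spaces \<open>C k\<close> and differentials \<open>d k\<close> from degree \<open>k\<close> to degree
  \<open>k + 1\<close>, zero in negative degrees.\<close>

definition cocycles :: "(nat \<Rightarrow> 'x::ab_group_add set) \<Rightarrow> (nat \<Rightarrow> 'x \<Rightarrow> 'x) \<Rightarrow> nat \<Rightarrow> 'x monoid"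
  where "cocycles C d k = \<lparr>carrier = {x \<in> C k. d k x = 0}, mult = (+), one = 0\<rparr>"

definition coboundaries :: "(nat \<Rightarrow> 'x::ab_group_add set) \<Rightarrow> (nat \<Rightarrow> 'x \<Rightarrow> 'x) \<Rightarrow> nat \<Rightarrow> 'x set"
  where "coboundaries C d k = (case k of 0 \<Rightarrow> {0} | Suc j \<Rightarrow> d j ` C j)"

definition cohomology :: "(nat \<Rightarrow> 'x::ab_group_add set) \<Rightarrow> (nat \<Rightarrow> 'x \<Rightarrow> 'x) \<Rightarrow> nat \<Rightarrow> 'x set monoid"
  where "cohomology C d k = cocycles C d k Mod coboundaries C d k"

definition cohomology_class ::
    "(nat \<Rightarrow> 'x::ab_group_add set) \<Rightarrow> (nat \<Rightarrow> 'x \<Rightarrow> 'x) \<Rightarrow> nat \<Rightarrow> 'x \<Rightarrow> 'x set"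
  where "cohomology_class C d k x = coboundaries C d k #>\<^bsub>cocycles C d k\<^esub> x"

definition cochain_map :: "(nat \<Rightarrow> 'x::real_vector set) \<Rightarrow> (nat \<Rightarrow> 'x \<Rightarrow> 'x) \<Rightarrow>
    (nat \<Rightarrow> 'y::real_vector set) \<Rightarrow> (nat \<Rightarrow> 'y \<Rightarrow> 'y) \<Rightarrow> (nat \<Rightarrow> 'x \<Rightarrow> 'y) \<Rightarrow> bool"
  where "cochain_map C d C' d' h \<longleftrightarrow>
    (\<forall>k. h k ` C k \<subseteq> C' k \<and> real_linear_on (C k) (h k) \<and>
         (\<forall>x\<in>C k. d' k (h k x) = h (Suc k) (d k x)))"

end

theory Submission
  imports Defs
begin

text \<open>Applying \<open>\<rho>(_)u\<^sub>k\<^sub>+\<^sub>2\<close> to the three sums of \<open>\<lbrakk>T, P\<rbrakk>\<close> and expanding \<open>\<rho>[x, y]\<close> as a commutator gives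
  the four sums of \<open>[\<pi>, \<Phi>(P)]\<close> term by term; only the half of the commutator in which \<open>\<rho>(P(\<dots>))\<close> acts
  last needs a reindexing, from \<open>(1,k)\<close>- to \<open>(k,1)\<close>-unshuffles by the cyclic shift, whose sign is
  \<open>(-1)\<^sup>k\<close>. The symbol of \<open>\<Phi>(P)\<close> is the anchor composed with \<open>P\<close>.

  The induced map on cohomology is well defined because coboundaries form subspaces; for \<open>Der\<^sup>*(E)\<close>
  this requires sums of symbols to be smooth sections of \<open>Hom(\<Lambda>\<^sup>nE, TM)\<close>. As tangent vectors are
  derivations of the algebra of global smooth functions, it rests on the classical fact that
  a chart identifies the derivations at a point with directional derivatives, proved with bump
  functions and Hadamard's lemma.\<close>

text \<open>Smoothness of a section is read through \<open>inv_into UNIV (\<tau> x)\<close>, which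
  is additive only on the range of \<open>\<tau> x\<close>. This is why all derivations at a point
  must be directional derivatives: otherwise the local representative of a sum of symbols need not
  be the sum of their representatives. Tangent vectors act on global functions, so chart coordinates
  and Hadamard's factors have to be cut off and extended by zero. The model spaces carry an
  arbitrary norm and may have dimension zero. In place of an inner product, a fixed basis with
  continuous coordinates supplies compact boxes, a smooth quadratic form for the bump functions, and
  the expansion in fixed directions behind the chain rule. In the cochain identity the operators are
  linear on sections only, and maps on tuples are zero outside their domain; much of the bookkeeping
  checks that permuted arguments remain sections. The Rota--Baxter identity enters in the left
  symmetry of the induced product, where it expresses the commutator of two operators
  \<open>\<rho> (push T x)\<close> by a single one.\<close>

section \<open>Finite-dimensional model spaces\<close>

text \<open>By induction the span of \<open>B\<close> is complete, hence closed, so a further independent vector has positive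
  distance from it.\<close>

lemma independent_coefficients_bound:
  fixes B :: "'a::real_normed_vector set"
  assumes "finite B" "independent B"
  shows "\<exists>K\<ge>0. \<forall>c. \<forall>b\<in>B. \<bar>c b\<bar> \<le> K * norm (\<Sum>b\<in>B. c b *\<^sub>R b)"
  using assms
proof (induction B rule: finite_induct)
  case empty
  show ?case by auto
next
  case (insert b B)
  have indB: "independent B" and bB: "b \<notin> span B"
    using insert.prems insert.hyps by (auto simp: independent_insert)
  obtain K where K0: "K \<ge> 0" and K: "\<And>c b. b \<in> B \<Longrightarrow> \<bar>c b\<bar> \<le> K * norm (\<Sum>b\<in>B. c b *\<^sub>R b)"
    using insert.IH[OF indB] by blast
  have "complete (span B)"
  proof (rule completeI)
    fix X assume X: "\<forall>n::nat. X n \<in> span B" and cX: "Cauchy X"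
    have "\<exists>c. \<forall>n. X n = (\<Sum>b\<in>B. c n b *\<^sub>R b)"
      using X unfolding span_finite[OF insert.hyps(1)] by (intro choice) blast
    then obtain c where c: "\<And>n. X n = (\<Sum>b\<in>B. c n b *\<^sub>R b)" by blast
    have "convergent (\<lambda>n. c n b)" if b: "b \<in> B" for b
    proof (rule Cauchy_convergent, rule metric_CauchyI)
      fix e :: real assume e: "e > 0"
      \<comment> \<open>The divisor is \<open>K + 1\<close> because \<open>K\<close> may be
        zero.\<close>
      obtain N where N: "\<And>m n. m \<ge> N \<Longrightarrow> n \<ge> N \<Longrightarrow> dist (X m) (X n) < e / (K + 1)"
        using metric_CauchyD[OF cX, of "e / (K + 1)"] e K0 by auto
      have "dist (c m b) (c n b) < e" if "m \<ge> N" "n \<ge> N" for m n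
      proof -
        have "dist (c m b) (c n b) \<le> K * dist (X m) (X n)"
          using K[OF b, of "\<lambda>b. c m b - c n b"]
          by (simp add: c dist_norm scaleR_diff_left sum_subtractf)
        also have "\<dots> \<le> (K + 1) * dist (X m) (X n)"
          by (simp add: mult_right_mono)
        also have "\<dots> < e"
          using N[OF that] K0 by (simp add: field_simps)
        finally show ?thesis .
      qed
      then show "\<exists>N. \<forall>m\<ge>N. \<forall>n\<ge>N. dist (c m b) (c n b) < e" by blast
    qed
    then have "\<forall>b\<in>B. (\<lambda>n. c n b) \<longlonglongrightarrow> lim (\<lambda>n. c n b)"
      by (simp add: convergent_LIMSEQ_iff)
    then have "X \<longlonglongrightarrow> (\<Sum>b\<in>B. lim (\<lambda>n. c n b) *\<^sub>R b)"
      unfolding c by (intro tendsto_intros) auto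
    moreover have "(\<Sum>b\<in>B. lim (\<lambda>n. c n b) *\<^sub>R b) \<in> span B"
      by (intro span_sum span_scale span_base)
    ultimately show "\<exists>l\<in>span B. X \<longlonglongrightarrow> l" by blast
  qed
  then have cl: "closed (span B)" by (rule complete_imp_closed)
  define d where "d = infdist b (span B)"
  have d: "d > 0"
    unfolding d_def using cl bB infdist_pos_not_in_closed[OF cl] span_zero by blast
  \<comment> \<open>The first summand is the bound \<open>yb\<close> for the new coefficient. The
    second bounds the old coefficients: it is \<open>K\<close> times the factor by which
    \<open>norm s\<close> can exceed \<open>norm y\<close>. Both are nonnegative, so the sum serves
    for all coefficients.\<close>
  define K' where "K' = 1 / d + K * (1 + norm b / d)"
  have "\<bar>c x\<bar> \<le> K' * norm (\<Sum>b\<in>insert b B. c b *\<^sub>R b)" if x: "x \<in> insert b B" for c x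
  proof -
    define s where "s = (\<Sum>b\<in>B. c b *\<^sub>R b)"
    define y where "y = c b *\<^sub>R b + s"
    have s: "s \<in> span B" unfolding s_def by (intro span_sum span_scale span_base)
    have yb: "\<bar>c b\<bar> \<le> norm y / d"
    proof (cases "c b = 0")
      case False
      \<comment> \<open>Dividing \<open>y\<close> by \<open>c b\<close> leaves \<open>b\<close>
        minus a vector of the span, hence a vector of norm at least \<open>d\<close>.\<close>
      have "d \<le> dist b (- (1 / c b) *\<^sub>R s)"
        unfolding d_def by (intro infdist_le span_scale s)
      also have "\<dots> = norm ((1 / c b) *\<^sub>R y)"
        using False by (simp add: dist_norm y_def scaleR_add_right)
      finally show ?thesis using False d by (simp add: field_simps)
    qed (use d in simp)
    have ns: "norm s \<le> (1 + norm b / d) * norm y"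
    proof -
      have "norm s = norm (y - c b *\<^sub>R b)" by (simp add: y_def)
      also have "\<dots> \<le> norm y + \<bar>c b\<bar> * norm b" by (metis norm_scaleR norm_triangle_ineq4)
      also have "\<dots> \<le> norm y + norm y / d * norm b"
        by (intro add_left_mono mult_right_mono yb) auto
      finally show ?thesis by (simp add: field_simps)
    qed
    have nonneg: "0 \<le> K * (1 + norm b / d) * norm y" "0 \<le> norm y / d" using K0 d by auto
    have "\<bar>c x\<bar> \<le> K' * norm y"
    proof (cases "x = b")
      case True
      then show ?thesis using yb nonneg unfolding K'_def by (simp add: field_simps)
    next
      case False
      then have "\<bar>c x\<bar> \<le> K * norm s" using x K[of x c] by (simp add: s_def)
      also have "\<dots> \<le> K * ((1 + norm b / d) * norm y)" by (intro mult_left_mono ns K0)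
      finally show ?thesis using nonneg unfolding K'_def by (simp add: distrib_right mult.assoc)
    qed
    then show ?thesis using insert.hyps by (simp add: y_def s_def)
  qed
  moreover have "K' \<ge> 0" using K0 d by (simp add: K'_def)
  ultimately show ?case by blast
qed

text \<open>The class grants a finite spanning set only, so a basis is chosen once and for all. It
  is empty in dimension zero.\<close>

definition model_basis :: "'c::fin_dim_normed set"
  where "model_basis = (SOME B. finite B \<and> independent B \<and> span B = UNIV)"

definition coord :: "'c::fin_dim_normed \<Rightarrow> 'c \<Rightarrow> real"
  where "coord b x = representation model_basis x b"

lemma model_basis:
  "finite (model_basis :: 'c::fin_dim_normed set)"
  "independent (model_basis :: 'c set)" "span (model_basis :: 'c set) = UNIV"
proof -
  obtain B :: "'c set" where B: "finite B" "\<And>x. \<exists>c. x = (\<Sum>b\<in>B. c b *\<^sub>R b)"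
    using finite_spanning_set by blast
  have "x \<in> span B" for x
    using B(2)[of x] by (auto intro: span_sum span_scale span_base)
  moreover obtain B' where "B' \<subseteq> B" "independent B'" "B \<subseteq> span B'"
    using maximal_independent_subset by blast
  ultimately have "finite B' \<and> independent B' \<and> span B' = UNIV"
    using B(1) by (metis UNIV_eq_I finite_subset span_mono span_span subsetD)
  then have "\<exists>B::'c set. finite B \<and> independent B \<and> span B = UNIV" by blast
  then have "finite (model_basis :: 'c set) \<and> independent (model_basis :: 'c set)
      \<and> span (model_basis :: 'c set) = UNIV"
    unfolding model_basis_def by (rule someI_ex)
  then show "finite (model_basis :: 'c set)" "independent (model_basis :: 'c set)"
    "span (model_basis :: 'c set) = UNIV" by auto
qed

lemma sum_coord: "(\<Sum>b\<in>model_basis. coord b x *\<^sub>R b) = x"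
  unfolding coord_def
  by (rule sum_representation_eq) (use model_basis in \<open>auto\<close>)

lemma coord_sum:
  assumes "b \<in> model_basis"
  shows "coord b (\<Sum>b\<in>model_basis. c b *\<^sub>R b) = c b"
proof -
  let ?f = "\<lambda>b. if b \<in> model_basis then c b else 0"
  have sub: "{b. ?f b \<noteq> 0} \<subseteq> model_basis" by auto
  have "representation model_basis (\<Sum>b\<in>model_basis. c b *\<^sub>R b) = ?f"
  proof (rule representation_eqI[OF model_basis(2)])
    show "(\<Sum>b\<in>model_basis. c b *\<^sub>R b) \<in> span model_basis"
      by (simp add: model_basis)
    show "finite {b. ?f b \<noteq> 0}"
      using finite_subset[OF sub model_basis(1)] .
    have "(\<Sum>b | ?f b \<noteq> 0. ?f b *\<^sub>R b) = (\<Sum>b\<in>model_basis. ?f b *\<^sub>R b)"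
      by (rule sum.mono_neutral_left[OF model_basis(1) sub]) auto
    then show "(\<Sum>b | ?f b \<noteq> 0. ?f b *\<^sub>R b) = (\<Sum>b\<in>model_basis. c b *\<^sub>R b)"
      by simp
  qed (use sub in auto)
  with assms show ?thesis by (simp add: coord_def)
qed

text \<open>Continuity is the coefficient bound applied to the expansion of \<open>x\<close>
  itself.\<close>

lemma bounded_linear_coord:
  assumes "b \<in> model_basis"
  shows "bounded_linear (coord b)"
proof -
  obtain K where K: "\<And>c b. b \<in> (model_basis :: 'a set) \<Longrightarrow> \<bar>c b\<bar> \<le> K * norm (\<Sum>b\<in>model_basis. c b *\<^sub>R b)"
    using independent_coefficients_bound[OF model_basis(1,2)] by blast
  have "norm (coord b x) \<le> norm x * K" for x
    using K[OF assms, of "\<lambda>b. coord b x"] by (simp add: sum_coord mult.commute)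
  then show ?thesis
    by (intro bounded_linear_intro)
      (auto simp: coord_def representation_add representation_scale model_basis)
qed

text \<open>The coordinates of a Cauchy sequence converge, and their limits assemble to a limit.
  Completeness makes differentiation under the integral sign available for integrals that depend on
  a point of the model space.\<close>

instance fin_dim_normed \<subseteq> banach
proof
  fix X :: "nat \<Rightarrow> 'a" assume X: "Cauchy X"
  have "convergent (\<lambda>n. coord b (X n))" if "b \<in> model_basis" for b
    using bounded_linear.Cauchy[OF bounded_linear_coord[OF that] X] by (rule Cauchy_convergent)
  then have "\<forall>b\<in>model_basis. (\<lambda>n. coord b (X n)) \<longlonglongrightarrow> lim (\<lambda>n. coord b (X n))"
    by (simp add: convergent_LIMSEQ_iff)
  then have "(\<lambda>n. \<Sum>b\<in>model_basis. coord b (X n) *\<^sub>R b)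
      \<longlonglongrightarrow> (\<Sum>b\<in>model_basis. lim (\<lambda>n. coord b (X n)) *\<^sub>R b)"
    by (intro tendsto_intros) auto
  then show "convergent X"
    by (auto simp: sum_coord convergent_def)
qed

text \<open>One more vector \<open>b\<close> gives the Minkowski sum of a segment along
  \<open>b\<close> and the previous set, and sums of compact sets are compact.\<close>

lemma compact_bounded_combinations:
  fixes B :: "'a::real_normed_vector set"
  assumes "finite B"
  shows "compact {\<Sum>b\<in>B. c b *\<^sub>R b |c. \<forall>b\<in>B. \<bar>c b\<bar> \<le> e}"
  using assms
proof (induction B rule: finite_induct)
  case empty
  show ?case by simp
next
  case (insert b B)
  have "{\<Sum>b\<in>insert b B. c b *\<^sub>R b |c. \<forall>b\<in>insert b B. \<bar>c b\<bar> \<le> e}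
      = {x + y |x y. x \<in> (\<lambda>t. t *\<^sub>R b) ` {-e..e} \<and> y \<in> {\<Sum>b\<in>B. c b *\<^sub>R b |c. \<forall>b\<in>B. \<bar>c b\<bar> \<le> e}}"
    (is "?L = ?R")
  proof
    show "?L \<subseteq> ?R"
    proof clarify
      fix c assume c: "\<forall>b\<in>insert b B. \<bar>c b\<bar> \<le> e"
      then have "c b *\<^sub>R b \<in> (\<lambda>t. t *\<^sub>R b) ` {-e..e}"
        by (intro imageI) (auto simp: abs_le_iff)
      moreover have "(\<Sum>b\<in>B. c b *\<^sub>R b) \<in> {\<Sum>b\<in>B. c b *\<^sub>R b |c. \<forall>b\<in>B. \<bar>c b\<bar> \<le> e}"
        using c by blast
      ultimately show "\<exists>x y. (\<Sum>b\<in>insert b B. c b *\<^sub>R b) = x + y \<and> x \<in> (\<lambda>t. t *\<^sub>R b) ` {-e..e}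
          \<and> y \<in> {\<Sum>b\<in>B. c b *\<^sub>R b |c. \<forall>b\<in>B. \<bar>c b\<bar> \<le> e}"
        unfolding sum.insert[OF insert.hyps] by blast
    qed
    show "?R \<subseteq> ?L"
    proof clarify
      fix t c assume t: "t \<in> {-e..e}" and c: "\<forall>b\<in>B. \<bar>c b\<bar> \<le> e"
      have "(\<Sum>b'\<in>B. (c(b := t)) b' *\<^sub>R b') = (\<Sum>b\<in>B. c b *\<^sub>R b)"
        using insert.hyps by (intro sum.cong) auto
      then have "t *\<^sub>R b + (\<Sum>b\<in>B. c b *\<^sub>R b) = (\<Sum>b'\<in>insert b B. (c(b := t)) b' *\<^sub>R b')"
        by (simp only: sum.insert[OF insert.hyps] fun_upd_same)
      moreover have "\<forall>b'\<in>insert b B. \<bar>(c(b := t)) b'\<bar> \<le> e"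
        using t c by (simp add: abs_le_iff)
      ultimately show "\<exists>c'. t *\<^sub>R b + (\<Sum>b\<in>B. c b *\<^sub>R b) = (\<Sum>b\<in>insert b B. c' b *\<^sub>R b)
          \<and> (\<forall>b\<in>insert b B. \<bar>c' b\<bar> \<le> e)"
        by blast
    qed
  qed
  moreover have "compact ((\<lambda>t. t *\<^sub>R b) ` {-e..e})"
    by (intro compact_continuous_image continuous_intros) auto
  ultimately show ?case by (simp only: compact_sums[OF _ insert.IH])
qed

text \<open>Coordinate boxes take the place of closed balls as compact sets around \<open>p\<close>:
  each is a translate of the set of combinations with bounded coefficients.\<close>

lemma compact_coord_box: "compact {y. \<forall>b\<in>model_basis. \<bar>coord b (y - p)\<bar> \<le> e}" (is "compact ?K")
proof -
  let ?C = "{\<Sum>b\<in>model_basis. c b *\<^sub>R b |c. \<forall>b\<in>model_basis. \<bar>c b\<bar> \<le> e}"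
  have "?K = (+) p ` ?C"
  proof (intro subset_antisym subsetI)
    fix y assume "y \<in> ?K"
    then have "(\<Sum>b\<in>model_basis. coord b (y - p) *\<^sub>R b) \<in> ?C"
      unfolding mem_Collect_eq by (intro exI[of _ "\<lambda>b. coord b (y - p)"]) simp
    moreover have "y = p + (\<Sum>b\<in>model_basis. coord b (y - p) *\<^sub>R b)" by (simp add: sum_coord)
    ultimately show "y \<in> (+) p ` ?C" by (rule rev_image_eqI)
  next
    fix y assume "y \<in> (+) p ` ?C"
    then show "y \<in> ?K" by (auto simp: coord_sum)
  qed
  then show ?thesis
    using compact_translation[OF compact_bounded_combinations[OF model_basis(1)]] by simp
qed

section \<open>Calculus of smooth maps\<close>

text \<open>Openness is essential: derivatives are taken at points of \<open>S\<close>, not within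
  \<open>S\<close>, and see the values on a neighbourhood.\<close>

lemma Ck_on_cong:
  assumes "open S" "\<And>x. x \<in> S \<Longrightarrow> f x = g x"
  shows "Ck_on k S f \<longleftrightarrow> Ck_on k S g"
  using assms(2)
proof (induction k arbitrary: f g)
  case 0
  then show ?case by (auto cong: continuous_on_cong)
next
  case (Suc k)
  have D: "(f has_derivative F) (at x) \<longleftrightarrow> (g has_derivative F) (at x)" if "x \<in> S" for x F
    using has_derivative_transform_within_open[OF _ assms(1) that, of f F UNIV g]
      has_derivative_transform_within_open[OF _ assms(1) that, of g F UNIV f] Suc.prems by auto
  then have "frechet_derivative f (at x) = frechet_derivative g (at x)" if "x \<in> S" for x
    using that by (simp add: frechet_derivative_def)
  then have "Ck_on k S (\<lambda>x. frechet_derivative f (at x) v)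
      \<longleftrightarrow> Ck_on k S (\<lambda>x. frechet_derivative g (at x) v)" for v
    by (intro Suc.IH) simp
  then show ?case using D by (auto simp: differentiable_def)
qed

text \<open>Allows an explicit formula for the derivative where the definition has
  \<open>frechet_derivative\<close>; uniqueness of derivatives exchanges the two on
  \<open>S\<close>.\<close>

lemma Ck_on_SucI:
  assumes "open S" "\<And>x. x \<in> S \<Longrightarrow> (f has_derivative f' x) (at x)"
    and "\<And>v. Ck_on k S (\<lambda>x. f' x v)"
  shows "Ck_on (Suc k) S f"
proof -
  have "Ck_on k S (\<lambda>x. frechet_derivative f (at x) v)" for v
    using assms(3)[of v] Ck_on_cong[OF assms(1), of "\<lambda>x. f' x v" "\<lambda>x. frechet_derivative f (at x) v"]
      frechet_derivative_at[OF assms(2)] by simp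
  then show ?thesis using assms(2) by (auto simp: differentiable_def)
qed

lemma Ck_on_SucD: "Ck_on (Suc k) S f \<Longrightarrow> Ck_on k S f"
proof (induction k arbitrary: f)
  case 0
  then show ?case
    by (auto intro!: continuous_at_imp_continuous_on differentiable_imp_continuous_within)
next
  case (Suc k)
  then show ?case by (metis Ck_on.simps(2))
qed

lemma Ck_on_has_derivative:
  "Ck_on (Suc k) S f \<Longrightarrow> x \<in> S \<Longrightarrow> (f has_derivative frechet_derivative f (at x)) (at x)"
  by (simp add: frechet_derivative_works)

lemma Ck_on_subset: "Ck_on k S f \<Longrightarrow> S' \<subseteq> S \<Longrightarrow> Ck_on k S' f"
  by (induction k arbitrary: f) (auto intro: continuous_on_subset)

lemma Ck_on_Un:
  "open S \<Longrightarrow> open S' \<Longrightarrow> Ck_on k S f \<Longrightarrow> Ck_on k S' f \<Longrightarrow> Ck_on k (S \<union> S') f"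
  by (induction k arbitrary: f) (auto intro: continuous_on_open_Un)

lemma Ck_on_const: "open S \<Longrightarrow> Ck_on k S (\<lambda>x. c)"
proof (induction k arbitrary: c)
  case (Suc k)
  then show ?case by (intro Ck_on_SucI[where f' = "\<lambda>x v. 0"]) auto
qed simp

lemma Ck_on_add:
  assumes "open S"
  shows "Ck_on k S f \<Longrightarrow> Ck_on k S g \<Longrightarrow> Ck_on k S (\<lambda>x. f x + g x)"
proof (induction k arbitrary: f g)
  case 0
  then show ?case by (auto intro: continuous_on_add)
next
  case (Suc k)
  then show ?case
    by (intro Ck_on_SucI[OF assms, where f' = "\<lambda>x v. frechet_derivative f (at x) v + frechet_derivative g (at x) v"])
      (auto intro!: has_derivative_add simp: frechet_derivative_works)
qed

lemma Ck_on_scaleR: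
  fixes f :: "'a::real_normed_vector \<Rightarrow> real"
  assumes "open S"
  shows "Ck_on k S f \<Longrightarrow> Ck_on k S g \<Longrightarrow> Ck_on k S (\<lambda>x. f x *\<^sub>R g x)"
proof (induction k arbitrary: f g)
  case 0
  then show ?case by (auto intro: continuous_on_scaleR)
next
  case (Suc k)
  have "((\<lambda>x. f x *\<^sub>R g x) has_derivative
      (\<lambda>v. f x *\<^sub>R frechet_derivative g (at x) v + frechet_derivative f (at x) v *\<^sub>R g x)) (at x)"
    if "x \<in> S" for x
    using that Suc.prems by (intro has_derivative_scaleR Ck_on_has_derivative)
  moreover have "Ck_on k S (\<lambda>x. f x *\<^sub>R frechet_derivative g (at x) v + frechet_derivative f (at x) v *\<^sub>R g x)" for v
    using Suc.prems Suc.prems[THEN Ck_on_SucD] by (intro Ck_on_add[OF assms] Suc.IH) auto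
  ultimately show ?case by (intro Ck_on_SucI[OF assms])
qed

lemma Ck_on_bounded_linear:
  assumes "open S" "bounded_linear h"
  shows "Ck_on k S h"
proof (cases k)
  case 0
  then show ?thesis using assms by (simp add: linear_continuous_on)
next
  case (Suc l)
  show ?thesis
    unfolding Suc
    by (rule Ck_on_SucI[where f' = "\<lambda>_. h"])
      (use assms in \<open>auto intro: Ck_on_const bounded_linear_imp_has_derivative\<close>)
qed

lemma Ck_on_bounded_linear_compose:
  assumes "open S" "bounded_linear l"
  shows "Ck_on k S h \<Longrightarrow> Ck_on k S (\<lambda>x. l (h x))"
proof (induction k arbitrary: h)
  case 0
  then show ?case using assms(2) by (auto intro: bounded_linear.continuous_on)
next
  case (Suc k)
  then show ?case
    by (intro Ck_on_SucI[OF assms(1), where f' = "\<lambda>x v. l (frechet_derivative h (at x) v)"])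
      (auto intro!: bounded_linear.has_derivative[OF assms(2)] simp: frechet_derivative_works)
qed

lemma Ck_on_sum:
  assumes "open S" "\<And>i. i \<in> I \<Longrightarrow> Ck_on k S (f i)"
  shows "Ck_on k S (\<lambda>x. \<Sum>i\<in>I. f i x)"
  using assms(2) by (induction I rule: infinite_finite_induct) (auto intro: Ck_on_const Ck_on_add assms(1))

text \<open>\<open>Ck_on\<close> speaks of derivatives in fixed directions. This expansion makes a
  derivative in a direction that varies with the point a combination of such derivatives.\<close>

lemma linear_frechet_derivative_coord:
  fixes f :: "'c::fin_dim_normed \<Rightarrow> 'b::real_normed_vector"
  assumes "f differentiable (at x)"
  shows "frechet_derivative f (at x) v = (\<Sum>b\<in>model_basis. coord b v *\<^sub>R frechet_derivative f (at x) b)"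
proof -
  interpret linear "frechet_derivative f (at x)" by (rule linear_frechet_derivative[OF assms])
  have "frechet_derivative f (at x) (\<Sum>b\<in>model_basis. coord b v *\<^sub>R b)
      = (\<Sum>b\<in>model_basis. coord b v *\<^sub>R frechet_derivative f (at x) b)"
    by (simp only: sum scale)
  then show ?thesis by (simp only: sum_coord)
qed

text \<open>The derivative of the composite is a finite sum of coordinates of the derivative of
  \<open>h\<close>, which are \<open>C^k\<close>, times directional derivatives of \<open>g\<close>
  along basis vectors composed with \<open>h\<close>, to which the induction hypothesis applies
  because \<open>g\<close> is arbitrary there.\<close>

lemma Ck_on_compose:
  fixes g :: "'c::fin_dim_normed \<Rightarrow> 'b::real_normed_vector"
  assumes "open S" "open S'"
  shows "Ck_on k S h \<Longrightarrow> Ck_on k S' g \<Longrightarrow> h ` S \<subseteq> S' \<Longrightarrow> Ck_on k S (\<lambda>x. g (h x))"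
proof (induction k arbitrary: g)
  case 0
  then show ?case by (auto intro: continuous_on_compose2)
next
  case (Suc k)
  let ?D = "\<lambda>x v. \<Sum>b\<in>model_basis. coord b (frechet_derivative h (at x) v) *\<^sub>R frechet_derivative g (at (h x)) b"
  have "((\<lambda>x. g (h x)) has_derivative ?D x) (at x)" if x: "x \<in> S" for x
  proof -
    have "((\<lambda>x. g (h x)) has_derivative (\<lambda>v. frechet_derivative g (at (h x)) (frechet_derivative h (at x) v))) (at x)"
      by (rule has_derivative_compose[OF Ck_on_has_derivative[OF Suc.prems(1) x] Ck_on_has_derivative[OF Suc.prems(2)]])
        (use Suc.prems(3) x in blast)
    moreover have "g differentiable (at (h x))" using Suc.prems x by auto
    then have "(\<lambda>v. frechet_derivative g (at (h x)) (frechet_derivative h (at x) v)) = ?D x"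
      by (intro ext linear_frechet_derivative_coord)
    ultimately show ?thesis by simp
  qed
  moreover have "Ck_on k S (\<lambda>x. ?D x v)" for v
  proof (intro Ck_on_sum[OF assms(1)] Ck_on_scaleR[OF assms(1)])
    fix b :: 'c assume b: "b \<in> model_basis"
    show "Ck_on k S (\<lambda>x. coord b (frechet_derivative h (at x) v))"
      using Suc.prems by (intro Ck_on_bounded_linear_compose[OF assms(1) bounded_linear_coord[OF b]]) simp
    show "Ck_on k S (\<lambda>x. frechet_derivative g (at (h x)) b)"
      using Suc.prems by (intro Suc.IH[OF Ck_on_SucD]) auto
  qed
  ultimately show ?case by (intro Ck_on_SucI[OF assms(1)])
qed


section \<open>Infinitely differentiable maps\<close>

lemma Cinf_on_cong: "open S \<Longrightarrow> (\<And>x. x \<in> S \<Longrightarrow> f x = g x) \<Longrightarrow> Cinf_on S f \<longleftrightarrow> Cinf_on S g"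
  unfolding Cinf_on_def using Ck_on_cong by blast

lemma Cinf_on_subset: "Cinf_on S f \<Longrightarrow> S' \<subseteq> S \<Longrightarrow> Cinf_on S' f"
  unfolding Cinf_on_def using Ck_on_subset by blast

lemma Cinf_on_Un:
  "open S \<Longrightarrow> open S' \<Longrightarrow> Cinf_on S f \<Longrightarrow> Cinf_on S' f \<Longrightarrow> Cinf_on (S \<union> S') f"
  unfolding Cinf_on_def using Ck_on_Un by blast

lemma Cinf_on_const: "open S \<Longrightarrow> Cinf_on S (\<lambda>x. c)"
  unfolding Cinf_on_def using Ck_on_const by blast

lemma Cinf_on_add:
  "open S \<Longrightarrow> Cinf_on S f \<Longrightarrow> Cinf_on S g \<Longrightarrow> Cinf_on S (\<lambda>x. f x + g x)"
  unfolding Cinf_on_def using Ck_on_add by blast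

lemma Cinf_on_scaleR:
  fixes f :: "'a::real_normed_vector \<Rightarrow> real"
  shows "open S \<Longrightarrow> Cinf_on S f \<Longrightarrow> Cinf_on S g \<Longrightarrow> Cinf_on S (\<lambda>x. f x *\<^sub>R g x)"
  unfolding Cinf_on_def using Ck_on_scaleR by blast

lemma Cinf_on_uminus: "open S \<Longrightarrow> Cinf_on S f \<Longrightarrow> Cinf_on S (\<lambda>x. - f x)"
  using Cinf_on_scaleR[of S "\<lambda>x. -1" f] by (simp add: Cinf_on_const)

lemma Cinf_on_mult:
  fixes f g :: "'a::real_normed_vector \<Rightarrow> real"
  shows "open S \<Longrightarrow> Cinf_on S f \<Longrightarrow> Cinf_on S g \<Longrightarrow> Cinf_on S (\<lambda>x. f x * g x)"
  using Cinf_on_scaleR[of S f g] by simp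

lemma Cinf_on_sum:
  "open S \<Longrightarrow> (\<And>i. i \<in> I \<Longrightarrow> Cinf_on S (f i)) \<Longrightarrow> Cinf_on S (\<lambda>x. \<Sum>i\<in>I. f i x)"
  unfolding Cinf_on_def by (blast intro: Ck_on_sum)

lemma Cinf_on_compose:
  fixes g :: "'c::fin_dim_normed \<Rightarrow> 'b::real_normed_vector"
  shows "open S \<Longrightarrow> open S' \<Longrightarrow> Cinf_on S h \<Longrightarrow> Cinf_on S' g \<Longrightarrow> h ` S \<subseteq> S' \<Longrightarrow> Cinf_on S (\<lambda>x. g (h x))"
  unfolding Cinf_on_def using Ck_on_compose by blast

lemma Cinf_on_coord_diff:
  assumes "open S" "b \<in> model_basis"
  shows "Cinf_on S (\<lambda>y. coord b (y - p))"
proof -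
  interpret bounded_linear "coord b" by (rule bounded_linear_coord[OF assms(2)])
  have "Cinf_on S (\<lambda>y. coord b y + - coord b p)"
    unfolding Cinf_on_def
    by (intro allI Ck_on_add Ck_on_const Ck_on_bounded_linear assms bounded_linear_axioms)
  then show ?thesis by (simp add: diff)
qed

lemma Cinf_on_frechet_derivative:
  "Cinf_on S f \<Longrightarrow> Cinf_on S (\<lambda>x. frechet_derivative f (at x) v)"
  unfolding Cinf_on_def by (metis Ck_on.simps(2))

lemma Cinf_on_differentiable: "Cinf_on S f \<Longrightarrow> x \<in> S \<Longrightarrow> f differentiable (at x)"
  unfolding Cinf_on_def by (metis Ck_on.simps(2))

section \<open>Bump functions\<close>

text \<open>For \<open>j = 0\<close> this is the classical function that is flat at 0. The powers of
  \<open>1 / x\<close> are included because the derivative of each member is a combination of two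
  later ones, so smoothness is an induction over the whole family.\<close>

definition flat_exp :: "nat \<Rightarrow> real \<Rightarrow> real"
  where "flat_exp j x = (if x > 0 then (1 / x) ^ j * exp (- 1 / x) else 0)"

lemma flat_exp_has_derivative:
  "(flat_exp j has_real_derivative flat_exp (j + 2) x - j * flat_exp (j + 1) x) (at x)"
proof -
  consider "x > 0" | "x < 0" | "x = 0" by linarith
  then show ?thesis
  proof cases
    case 1
    have "((\<lambda>x. (1 / x) ^ j * exp (- 1 / x)) has_real_derivative
        (1 / x) ^ (j + 2) * exp (- 1 / x) - j * ((1 / x) ^ (j + 1) * exp (- 1 / x))) (at x)"
    proof -
      have inv: "((\<lambda>x. 1 / x) has_real_derivative - (1 / x)\<^sup>2) (at x)"
        using 1 by (auto intro!: derivative_eq_intros simp: power2_eq_square)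
      have "((\<lambda>x. exp (- 1 / x)) has_real_derivative exp (- 1 / x) * (1 / x)\<^sup>2) (at x)"
        using 1 by (auto intro!: derivative_eq_intros simp: power2_eq_square)
      \<comment> \<open>The power rule produces the exponent \<open>j - 1\<close>; splitting on
        \<open>j\<close> disposes of the truncated subtraction at \<open>j = 0\<close>, where the
        coefficient vanishes.\<close>
      from DERIV_mult[OF DERIV_power[OF inv, of j] this] show ?thesis
        by (rule DERIV_cong) (cases j; simp add: power2_eq_square algebra_simps)
    qed
    moreover have "open {0::real<..}" by simp
    ultimately have "(flat_exp j has_real_derivative
        (1 / x) ^ (j + 2) * exp (- 1 / x) - j * ((1 / x) ^ (j + 1) * exp (- 1 / x))) (at x)"
      unfolding has_field_derivative_def
      by (rule has_derivative_transform_within_open) (use 1 in \<open>auto simp: flat_exp_def\<close>)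
    then show ?thesis using 1 by (simp add: flat_exp_def)
  next
    case 2
    have "((\<lambda>x. 0) has_real_derivative 0) (at x)" by simp
    moreover have "open {..<0::real}" by simp
    ultimately have "(flat_exp j has_real_derivative 0) (at x)"
      unfolding has_field_derivative_def
      by (rule has_derivative_transform_within_open) (use 2 in \<open>auto simp: flat_exp_def\<close>)
    then show ?thesis using 2 by (simp add: flat_exp_def)
  next
    case 3
    have "((\<lambda>h. flat_exp j h / h) \<longlongrightarrow> 0) (at_left 0)"
      by (rule tendsto_eventually) (auto simp: eventually_at_filter flat_exp_def)
    moreover have "((\<lambda>h. flat_exp j h / h) \<longlongrightarrow> 0) (at_right 0)"
    proof (rule Lim_transform_eventually)
      \<comment> \<open>With \<open>y = 1 / h\<close> the difference quotient becomes
        \<open>y ^ (j + 1) / exp y\<close>, and \<open>y\<close> tends to infinity.\<close>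
      show "((\<lambda>h::real. inverse h ^ (j + 1) / exp (inverse h)) \<longlongrightarrow> 0) (at_right 0)"
        by (rule filterlim_compose[OF tendsto_power_div_exp_0 filterlim_inverse_at_top_right])
      show "\<forall>\<^sub>F h in at_right 0. inverse h ^ (j + 1) / exp (inverse h) = flat_exp j h / h"
        by (auto simp: eventually_at_filter flat_exp_def exp_minus field_simps)
    qed
    ultimately have "((\<lambda>h. flat_exp j h / h) \<longlongrightarrow> 0) (at 0)"
      by (simp add: filterlim_split_at)
    then show ?thesis using 3 by (simp add: DERIV_def flat_exp_def)
  qed
qed

lemma Ck_on_flat_exp: "Ck_on k UNIV (flat_exp j)"
proof (induction k arbitrary: j)
  case 0
  show ?case
    using DERIV_isCont[OF flat_exp_has_derivative] by (simp add: continuous_at_imp_continuous_on)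
next
  case (Suc k)
  show ?case
  proof (rule Ck_on_SucI)
    fix x
    show "(flat_exp j has_derivative (\<lambda>v. (flat_exp (j + 2) x + (- real j) *\<^sub>R flat_exp (j + 1) x) *\<^sub>R v)) (at x)"
      using flat_exp_has_derivative[of j x] by (simp add: has_field_derivative_def)
  next
    fix v :: real
    show "Ck_on k UNIV (\<lambda>x. (flat_exp (j + 2) x + (- real j) *\<^sub>R flat_exp (j + 1) x) *\<^sub>R v)"
      by (intro Ck_on_scaleR Ck_on_add Ck_on_const Suc.IH open_UNIV)
  qed simp
qed

text \<open>The flat function is composed with \<open>e\<^sup>2\<close> minus the sum of the squared
  coordinates. This quadratic form is smooth, whereas the given norm need not be, and it can be
  positive only inside a coordinate box.\<close>

lemma smooth_bump:
  fixes p :: "'c::fin_dim_normed"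
  assumes "r > 0"
  obtains \<beta> :: "'c \<Rightarrow> real" and K where "Cinf_on UNIV \<beta>" "\<beta> p = 1"
    "compact K" "K \<subseteq> ball p r" "\<And>y. y \<notin> K \<Longrightarrow> \<beta> y = 0"
proof -
  \<comment> \<open>On the box of half-width \<open>e\<close>, the triangle inequality gives
    \<open>norm (y - p) \<le> e * (n - 1)\<close>. With \<open>e = r / (2 * n)\<close> this is less
    than \<open>r\<close>; the summand 1 keeps \<open>n\<close> positive even when the basis is
    empty.\<close>
  define n where "n = 1 + (\<Sum>b\<in>(model_basis :: 'c set). norm b)"
  have n: "n > 0" unfolding n_def by (intro add_pos_nonneg sum_nonneg) auto
  define e where "e = r / (2 * n)"
  have e: "e > 0" using assms n by (simp add: e_def)
  define q where "q = (\<lambda>y. e\<^sup>2 + (\<Sum>b\<in>model_basis. (- coord b (y - p)) *\<^sub>R coord b (y - p)))"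
  define K where "K = {y. \<forall>b\<in>model_basis. \<bar>coord b (y - p)\<bar> \<le> e}"
  have smooth_coord: "Cinf_on UNIV (\<lambda>y. coord b (y - p))" if "b \<in> model_basis" for b :: 'c
    using Cinf_on_coord_diff[OF open_UNIV that] .
  have q: "Cinf_on UNIV q"
    unfolding q_def
    by (intro Cinf_on_add Cinf_on_const Cinf_on_sum Cinf_on_scaleR Cinf_on_uminus smooth_coord open_UNIV)
  have qp: "q p = e\<^sup>2"
    by (auto simp: q_def bounded_linear.linear[OF bounded_linear_coord] linear_0 intro!: sum.neutral)
  have 1: "Cinf_on UNIV (\<lambda>y. (1 / flat_exp 0 (e\<^sup>2)) *\<^sub>R flat_exp 0 (q y))" (is "Cinf_on _ ?\<beta>")
    using Ck_on_flat_exp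
    by (intro Cinf_on_scaleR Cinf_on_const Cinf_on_compose[OF _ _ q, of UNIV "flat_exp 0"]) (auto simp: Cinf_on_def)
  have 2: "?\<beta> p = 1"
    using e by (simp add: qp flat_exp_def)
  have 3: "compact K" unfolding K_def by (rule compact_coord_box)
  have 4: "K \<subseteq> ball p r"
  proof
    fix y assume y: "y \<in> K"
    have "norm (y - p) = norm (\<Sum>b\<in>model_basis. coord b (y - p) *\<^sub>R b)" by (simp only: sum_coord)
    also have "\<dots> \<le> (\<Sum>b\<in>model_basis. \<bar>coord b (y - p)\<bar> * norm b)"
      by (rule order_trans[OF norm_sum]) simp
    also have "\<dots> \<le> (\<Sum>b\<in>(model_basis :: 'c set). e * norm b)"
      using y by (intro sum_mono mult_right_mono) (auto simp: K_def)
    also have "\<dots> = e * (n - 1)" by (simp add: n_def sum_distrib_left)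
    also have "\<dots> < r" using assms n by (simp add: e_def field_simps add_pos_pos)
    finally show "y \<in> ball p r" by (simp add: dist_norm norm_minus_commute)
  qed
  have 5: "?\<beta> y = 0" if y: "y \<notin> K" for y
  proof -
    obtain b where b: "b \<in> model_basis" "\<bar>coord b (y - p)\<bar> > e" using y by (auto simp: K_def)
    \<comment> \<open>A single coordinate beyond the box already outweighs \<open>e\<^sup>2\<close>,
      so the flat function is evaluated at a nonpositive number.\<close>
    have "e\<^sup>2 \<le> (coord b (y - p))\<^sup>2" using b(2) e by (simp add: abs_le_square_iff[symmetric])
    also have "\<dots> \<le> (\<Sum>b\<in>model_basis. (coord b (y - p))\<^sup>2)"
      using b(1) model_basis(1) by (intro member_le_sum) auto
    finally have "q y \<le> 0" by (simp add: q_def sum_negf power2_eq_square)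
    then show ?thesis by (simp add: flat_exp_def)
  qed
  from that[OF 1 2 3 4 5] show thesis .
qed

section \<open>Hadamard's lemma\<close>

lemma ray_in_ball:
  fixes p y :: "'a::real_normed_vector"
  assumes "y \<in> ball p r" "t \<in> {0..1}"
  shows "p + t *\<^sub>R (y - p) \<in> ball p r"
proof -
  have "norm (t *\<^sub>R (y - p)) \<le> 1 * norm (y - p)"
    unfolding norm_scaleR using assms(2) by (intro mult_right_mono) auto
  then show ?thesis using assms(1) by (simp add: dist_norm norm_minus_commute)
qed

lemma continuous_on_ray:
  fixes h :: "'c::fin_dim_normed \<Rightarrow> real"
  assumes "Cinf_on (ball p r) h" "y \<in> ball p r"
  shows "continuous_on {0..1} (\<lambda>t. t ^ j * h (p + t *\<^sub>R (y - p)))"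
proof -
  have "continuous_on (ball p r) h"
    using assms(1) unfolding Cinf_on_def by (metis Ck_on.simps(1))
  then have "continuous_on {0..1} (\<lambda>t. h (p + t *\<^sub>R (y - p)))"
    by (rule continuous_on_compose2) (use ray_in_ball[OF assms(2)] in \<open>auto intro!: continuous_intros\<close>)
  then show ?thesis by (intro continuous_intros)
qed

text \<open>The weight \<open>t ^ j\<close> is there for differentiation: the chain rule along the
  ray from \<open>p\<close> to \<open>y\<close> contributes one more factor \<open>t\<close>, so
  derivatives of such averages are again combinations of such averages. Hadamard's factors are the
  case \<open>j = 0\<close>.\<close>

definition ray_average :: "'c::fin_dim_normed \<Rightarrow> nat \<Rightarrow> ('c \<Rightarrow> real) \<Rightarrow> 'c \<Rightarrow> real"
  where "ray_average p j h y = integral {0..1} (\<lambda>t. t ^ j * h (p + t *\<^sub>R (y - p)))"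

lemma ray_average_has_derivative:
  fixes h :: "'c::fin_dim_normed \<Rightarrow> real"
  assumes h: "Cinf_on (ball p r) h" and y0: "y0 \<in> ball p r"
  shows "(ray_average p j h has_derivative
      (\<lambda>v. \<Sum>b\<in>model_basis. coord b v *\<^sub>R ray_average p (j + 1) (\<lambda>z. frechet_derivative h (at z) b) y0)) (at y0)"
proof -
  let ?D = "\<lambda>b z. frechet_derivative h (at z) b"
  define F where "F = (\<lambda>y t. t ^ j * h (p + t *\<^sub>R (y - p)))"
  \<comment> \<open>The Leibniz rule requires the derivative to be jointly continuous in operator
    norm. Written as a finite combination of fixed coordinate functionals, it is continuous as soon
    as its scalar coefficients are.\<close>
  define F' where "F' = (\<lambda>y t. \<Sum>b\<in>model_basis. (t ^ (j + 1) * ?D b (p + t *\<^sub>R (y - p))) *\<^sub>R Blinfun (coord b))"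
  have D: "Cinf_on (ball p r) (?D b)" for b by (rule Cinf_on_frechet_derivative[OF h])
  have app: "blinfun_apply (F' y t) v = (\<Sum>b\<in>model_basis. coord b v *\<^sub>R (t ^ (j + 1) * ?D b (p + t *\<^sub>R (y - p))))" for y t v
    by (auto simp: F'_def blinfun.sum_left blinfun.scaleR_left bounded_linear_Blinfun_apply bounded_linear_coord
        intro!: sum.cong)
  have fx: "((\<lambda>y. F y t) has_derivative blinfun_apply (F' y t)) (at y within ball p r)"
    if y: "y \<in> ball p r" and t: "t \<in> cbox 0 1" for y t
  proof -
    let ?z = "p + t *\<^sub>R (y - p)"
    have z: "?z \<in> ball p r" using ray_in_ball[OF y] t by simp
    have dh: "h differentiable (at ?z)" by (rule Cinf_on_differentiable[OF h z])
    have ray: "((\<lambda>y. p + t *\<^sub>R (y - p)) has_derivative (\<lambda>v. t *\<^sub>R v)) (at y)"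
      by (auto intro!: derivative_eq_intros)
    have "((\<lambda>y. h (p + t *\<^sub>R (y - p))) has_derivative (\<lambda>v. frechet_derivative h (at ?z) (t *\<^sub>R v))) (at y)"
      using has_derivative_compose[OF ray] dh frechet_derivative_works by blast
    then have "((\<lambda>y. F y t) has_derivative (\<lambda>v. t ^ j * frechet_derivative h (at ?z) (t *\<^sub>R v))) (at y)"
      unfolding F_def by (rule has_derivative_mult_right)
    moreover have "(\<lambda>v. t ^ j * frechet_derivative h (at ?z) (t *\<^sub>R v)) = blinfun_apply (F' y t)"
    proof
      fix v
      have "frechet_derivative h (at ?z) (t *\<^sub>R v) = t * frechet_derivative h (at ?z) v"
        using linear_scale[OF linear_frechet_derivative[OF dh], of t v] by simp
      also have "\<dots> = t * (\<Sum>b\<in>model_basis. coord b v *\<^sub>R ?D b ?z)"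
        by (subst linear_frechet_derivative_coord[OF dh]) (rule refl)
      finally have "t ^ j * frechet_derivative h (at ?z) (t *\<^sub>R v)
          = t ^ j * (t * (\<Sum>b\<in>model_basis. coord b v *\<^sub>R ?D b ?z))" by (rule arg_cong)
      also have "\<dots> = blinfun_apply (F' y t) v"
        unfolding app sum_distrib_left by (intro sum.cong refl) (simp add: mult_ac)
      finally show "t ^ j * frechet_derivative h (at ?z) (t *\<^sub>R v) = blinfun_apply (F' y t) v" .
    qed
    ultimately show ?thesis by (simp add: has_derivative_at_withinI)
  qed
  have int: "F y integrable_on cbox 0 1" if "y \<in> ball p r" for y
    unfolding F_def using continuous_on_ray[OF h that] by (intro integrable_continuous) simp
  have cont: "continuous_on (ball p r \<times> cbox 0 1) (\<lambda>(y, t). F' y t)"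
  proof -
    have "continuous_on (ball p r \<times> cbox 0 1) (\<lambda>w. ?D b (p + snd w *\<^sub>R (fst w - p)))" for b
    proof (rule continuous_on_compose2[of "ball p r"])
      show "continuous_on (ball p r) (?D b)"
        using D unfolding Cinf_on_def by (metis Ck_on.simps(1))
      show "(\<lambda>w. p + snd w *\<^sub>R (fst w - p)) ` (ball p r \<times> cbox 0 1) \<subseteq> ball p r"
        using ray_in_ball by fastforce
    qed (intro continuous_intros)
    then show ?thesis unfolding F'_def case_prod_beta by (intro continuous_intros)
  qed
  have cD: "continuous_on {0..1} (\<lambda>t. t ^ (j + 1) * ?D b (p + t *\<^sub>R (y0 - p)))" for b
    by (rule continuous_on_ray[OF D y0])
  have "continuous_on (cbox 0 1) (\<lambda>t. F' y0 t)"
  proof -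
    have "continuous_on (cbox 0 1) (\<lambda>t::real. (y0, t))" by (intro continuous_intros)
    moreover have "(\<lambda>t. (y0, t)) ` cbox 0 1 \<subseteq> ball p r \<times> cbox (0::real) 1" using y0 by blast
    ultimately show ?thesis using continuous_on_compose2[OF cont] by fastforce
  qed
  then have intF': "F' y0 integrable_on cbox 0 1" by (rule integrable_continuous)
  have "blinfun_apply (integral (cbox 0 1) (F' y0)) v
      = integral {0..1} (\<lambda>t. \<Sum>b\<in>model_basis. coord b v *\<^sub>R (t ^ (j + 1) * ?D b (p + t *\<^sub>R (y0 - p))))" for v
    using blinfun_apply_integral[OF intF', of v] by (simp only: app cbox_interval)
  also have "\<dots> v = (\<Sum>b\<in>model_basis. coord b v *\<^sub>R ray_average p (j + 1) (?D b) y0)" for v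
  proof -
    have "(\<lambda>t. coord b v *\<^sub>R (t ^ (j + 1) * ?D b (p + t *\<^sub>R (y0 - p)))) integrable_on {0..1}" for b
      by (intro integrable_continuous_interval continuous_on_scaleR continuous_on_const cD)
    then show ?thesis
      by (simp only: integral_sum[OF model_basis(1)] integral_cmul ray_average_def)
  qed
  finally have *: "blinfun_apply (integral (cbox 0 1) (F' y0))
      = (\<lambda>v. \<Sum>b\<in>model_basis. coord b v *\<^sub>R ray_average p (j + 1) (?D b) y0)" by blast
  have "((\<lambda>y. integral (cbox 0 1) (F y)) has_derivative blinfun_apply (integral (cbox 0 1) (F' y0)))
      (at y0 within ball p r)"
    using fx int cont y0 convex_ball
    by (rule leibniz_rule[where f = F and fx = F' and a = 0 and b = 1 and U = "ball p r"])
  moreover have "(\<lambda>y. integral (cbox 0 1) (F y)) = ray_average p j h"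
    by (simp add: fun_eq_iff F_def ray_average_def)
  ultimately show ?thesis
    by (simp only: * at_within_open[OF y0 open_ball])
qed

text \<open>The induction keeps \<open>j\<close> and \<open>h\<close> arbitrary, since the
  derivative involves averages of the partial derivatives of \<open>h\<close> with the next
  weight.\<close>

lemma Cinf_on_ray_average:
  fixes h :: "'c::fin_dim_normed \<Rightarrow> real"
  assumes "Cinf_on (ball p r) h"
  shows "Cinf_on (ball p r) (ray_average p j h)"
proof -
  have "Ck_on k (ball p r) (ray_average p j h)" for k
    using assms
  proof (induction k arbitrary: j h)
    case 0
    have "isCont (ray_average p j h) y" if "y \<in> ball p r" for y
      by (rule has_derivative_continuous[OF ray_average_has_derivative[OF 0 that]])
    then show ?case
      unfolding Ck_on.simps by (intro continuous_at_imp_continuous_on ballI)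
  next
    case (Suc k)
    show ?case
    proof (rule Ck_on_SucI[OF open_ball ray_average_has_derivative[OF Suc.prems]])
      fix v
      show "Ck_on k (ball p r) (\<lambda>x. \<Sum>b\<in>model_basis.
          coord b v *\<^sub>R ray_average p (j + 1) (\<lambda>z. frechet_derivative h (at z) b) x)"
        by (rule Ck_on_sum[OF open_ball Ck_on_scaleR[OF open_ball Ck_on_const[OF open_ball]
            Suc.IH[OF Cinf_on_frechet_derivative[OF Suc.prems]]]])
    qed
  qed
  then show ?thesis by (simp add: Cinf_on_def)
qed

text \<open>The fundamental theorem of calculus for \<open>f\<close> along the ray from
  \<open>p\<close> to \<open>y\<close>, with the derivative in direction \<open>y - p\<close>
  expanded in coordinates. The factors are averages of partial derivatives, hence smooth at
  \<open>p\<close> too without dividing by \<open>y - p\<close>; at \<open>p\<close> the ray is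
  constant and the average is the partial derivative.\<close>

lemma hadamard:
  fixes f :: "'c::fin_dim_normed \<Rightarrow> real"
  assumes f: "Cinf_on (ball p r) f" and "r > 0"
  obtains g where "\<And>b. Cinf_on (ball p r) (g b)"
    "\<And>b. g b p = frechet_derivative f (at p) b"
    "\<And>y. y \<in> ball p r \<Longrightarrow> f y = f p + (\<Sum>b\<in>model_basis. coord b (y - p) * g b y)"
proof
  let ?D = "\<lambda>b z. frechet_derivative f (at z) b"
  let ?g = "\<lambda>b. ray_average p 0 (?D b)"
  have D: "Cinf_on (ball p r) (?D b)" for b by (rule Cinf_on_frechet_derivative[OF f])
  show "Cinf_on (ball p r) (?g b)" for b by (rule Cinf_on_ray_average[OF D])
  show "?g b p = ?D b p" for b by (simp add: ray_average_def)
  fix y assume y: "y \<in> ball p r"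
  have "((\<lambda>t. frechet_derivative f (at (p + t *\<^sub>R (y - p))) (y - p)) has_integral
      f (p + 1 *\<^sub>R (y - p)) - f (p + 0 *\<^sub>R (y - p))) {0..1}"
  proof (rule fundamental_theorem_of_calculus)
    fix t :: real assume t: "t \<in> {0..1}"
    let ?z = "p + t *\<^sub>R (y - p)"
    have df: "f differentiable (at ?z)" by (rule Cinf_on_differentiable[OF f ray_in_ball[OF y t]])
    have ray: "((\<lambda>t. p + t *\<^sub>R (y - p)) has_derivative (\<lambda>s. s *\<^sub>R (y - p))) (at t)"
      by (auto intro!: derivative_eq_intros)
    have "((\<lambda>t. f (p + t *\<^sub>R (y - p))) has_derivative (\<lambda>s. frechet_derivative f (at ?z) (s *\<^sub>R (y - p)))) (at t)"
      using has_derivative_compose[OF ray] df frechet_derivative_works by blast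
    moreover have "frechet_derivative f (at ?z) (s *\<^sub>R (y - p)) = s *\<^sub>R frechet_derivative f (at ?z) (y - p)" for s
      by (rule linear_scale[OF linear_frechet_derivative[OF df]])
    ultimately have "((\<lambda>t. f (p + t *\<^sub>R (y - p))) has_vector_derivative frechet_derivative f (at ?z) (y - p)) (at t)"
      by (simp add: has_vector_derivative_def)
    then show "((\<lambda>t. f (p + t *\<^sub>R (y - p))) has_vector_derivative frechet_derivative f (at ?z) (y - p)) (at t within {0..1})"
      by (rule has_vector_derivative_at_within)
  qed simp
  then have "integral {0..1} (\<lambda>t. frechet_derivative f (at (p + t *\<^sub>R (y - p))) (y - p)) = f y - f p"
    by (simp add: integral_unique)
  moreover have "integral {0..1} (\<lambda>t. frechet_derivative f (at (p + t *\<^sub>R (y - p))) (y - p))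
      = integral {0..1} (\<lambda>t. \<Sum>b\<in>model_basis. coord b (y - p) * ?D b (p + t *\<^sub>R (y - p)))"
    using linear_frechet_derivative_coord[OF Cinf_on_differentiable[OF f ray_in_ball[OF y]], of _ "y - p"]
    by (intro integral_cong) simp
  moreover have "\<dots> = (\<Sum>b\<in>model_basis. coord b (y - p) * ?g b y)"
    unfolding ray_average_def using continuous_on_ray[OF D y, of 0]
    by (subst integral_sum) (auto intro!: model_basis sum.cong integrable_continuous_interval continuous_on_mult)
  ultimately show "f y = f p + (\<Sum>b\<in>model_basis. coord b (y - p) * ?g b y)" by linarith
qed

section \<open>Smooth functions and tangent spaces\<close>

lemma real_linear_on_add: "real_linear_on S h \<Longrightarrow> x \<in> S \<Longrightarrow> y \<in> S \<Longrightarrow> h (x + y) = h x + h y"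
  by (simp add: real_linear_on_def)

lemma real_linear_on_scaleR: "real_linear_on S h \<Longrightarrow> x \<in> S \<Longrightarrow> h (c *\<^sub>R x) = c *\<^sub>R h x"
  by (simp add: real_linear_on_def)

lemma chartD:
  assumes "smooth_manifold M" "(U, \<phi>) \<in> M"
  shows "open U" "homeomorphism U (\<phi> ` U) \<phi> (inv_into U \<phi>)" "open (\<phi> ` U)" "inj_on \<phi> U"
proof -
  show "open U" "open (\<phi> ` U)" and h: "homeomorphism U (\<phi> ` U) \<phi> (inv_into U \<phi>)"
    using assms unfolding smooth_manifold_def by blast+
  show "inj_on \<phi> U"
    using h unfolding homeomorphism_def by (metis inj_on_inverseI)
qed

lemma open_chart_image:
  assumes "smooth_manifold M" "(U, \<phi>) \<in> M" "open W"
  shows "open (\<phi> ` (U \<inter> W))"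
proof -
  have "openin (top_of_set (\<phi> ` U)) (\<phi> ` (U \<inter> W))"
    using homeomorphism_imp_open_map[OF chartD(2)[OF assms(1,2)], of "U \<inter> W"] assms(3)
    by (simp add: openin_open_Int)
  then show ?thesis using chartD(3)[OF assms(1,2)] openin_open_trans by blast
qed

lemma smooth_on_add:
  assumes "smooth_manifold M" "open W" "smooth_on M W f" "smooth_on M W g"
  shows "smooth_on M W (\<lambda>x. f x + g x)"
  using assms open_chart_image[OF assms(1) _ assms(2)]
  unfolding smooth_on_def o_def by (fast intro: Cinf_on_add)

lemma smooth_on_scaleR:
  fixes f :: "_ \<Rightarrow> real"
  assumes "smooth_manifold M" "open W" "smooth_on M W f" "smooth_on M W g"
  shows "smooth_on M W (\<lambda>x. f x *\<^sub>R g x)"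
  using assms open_chart_image[OF assms(1) _ assms(2)]
  unfolding smooth_on_def o_def by (fast intro: Cinf_on_scaleR)

lemma smooth_on_const:
  assumes "smooth_manifold M" "open W"
  shows "smooth_on M W (\<lambda>x. c)"
  using open_chart_image[OF assms(1) _ assms(2)]
  unfolding smooth_on_def o_def by (fast intro: Cinf_on_const)

lemma smooth_on_cong:
  assumes "smooth_manifold M" "open W" "\<And>x. x \<in> W \<Longrightarrow> f x = g x"
  shows "smooth_on M W f \<longleftrightarrow> smooth_on M W g"
proof -
  have "Cinf_on (\<phi> ` (U \<inter> W)) (f \<circ> inv_into U \<phi>) \<longleftrightarrow> Cinf_on (\<phi> ` (U \<inter> W)) (g \<circ> inv_into U \<phi>)"
    if "(U, \<phi>) \<in> M" for U \<phi>
    using open_chart_image[OF assms(1) that assms(2)] chartD(4)[OF assms(1) that] assms(3)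
    by (intro Cinf_on_cong) auto
  then show ?thesis unfolding smooth_on_def by fast
qed

lemma smooth_on_subset: "smooth_on M W f \<Longrightarrow> W' \<subseteq> W \<Longrightarrow> smooth_on M W' f"
  unfolding smooth_on_def by (fast intro: Cinf_on_subset)

lemma smooth_functions_const: "smooth_manifold M \<Longrightarrow> (\<lambda>x. c) \<in> smooth_functions M"
  by (simp add: smooth_functions_def smooth_on_const)

lemma smooth_functions_add:
  "smooth_manifold M \<Longrightarrow> f \<in> smooth_functions M \<Longrightarrow> g \<in> smooth_functions M \<Longrightarrow> f + g \<in> smooth_functions M"
  by (simp add: smooth_functions_def smooth_on_add plus_fun_def)

lemma smooth_functions_scaleR:
  "smooth_manifold M \<Longrightarrow> f \<in> smooth_functions M \<Longrightarrow> c *\<^sub>R f \<in> smooth_functions M"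
  using smooth_on_scaleR[of M UNIV "\<lambda>x. c" f]
  by (simp add: smooth_functions_def smooth_on_const scaleR_fun_def)

lemma smooth_functions_mult:
  "smooth_manifold M \<Longrightarrow> f \<in> smooth_functions M \<Longrightarrow> g \<in> smooth_functions M \<Longrightarrow> f * g \<in> smooth_functions M"
  using smooth_on_scaleR[of M UNIV f g] by (simp add: smooth_functions_def times_fun_def)

lemma smooth_functions_sum:
  assumes "smooth_manifold M" "\<And>i. i \<in> I \<Longrightarrow> f i \<in> smooth_functions M"
  shows "(\<Sum>i\<in>I. f i) \<in> smooth_functions M"
  using assms(2)
proof (induction I rule: infinite_finite_induct)
  case (insert i I)
  then show ?case
    unfolding sum.insert[OF insert.hyps(1,2)] by (intro smooth_functions_add[OF assms(1)]) auto
qed (use smooth_functions_const[OF assms(1), of 0] in \<open>auto simp: zero_fun_def\<close>)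

text \<open>The manifold is the union of two open sets: the part of \<open>U\<close> over
  \<open>N\<close>, where the function is \<open>g\<close> after the chart, and the complement of
  the preimage of \<open>K\<close>, where it vanishes. The second set is open because compact
  subsets of a Hausdorff space are closed.\<close>

lemma smooth_extension_by_zero:
  assumes M: "smooth_manifold M" "(U, \<phi>) \<in> M"
    and N: "open N" "N \<subseteq> \<phi> ` U" and K: "compact K" "K \<subseteq> N"
    and g: "Cinf_on N g" "\<And>y. y \<in> N \<Longrightarrow> y \<notin> K \<Longrightarrow> g y = 0"
  shows "(\<lambda>x. if x \<in> U \<and> \<phi> x \<in> N then g (\<phi> x) else 0) \<in> smooth_functions M"
proof -
  let ?f = "\<lambda>x. if x \<in> U \<and> \<phi> x \<in> N then g (\<phi> x) else 0"
  note h = chartD[OF M]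
  define W where "W = U \<inter> \<phi> -` N"
  have W: "open W"
    unfolding W_def using h(1,2) N(1) by (intro continuous_open_preimage) (auto simp: homeomorphism_def)
  have "compact (inv_into U \<phi> ` K)"
    using h(2) N(2) K by (intro compact_continuous_image) (auto simp: homeomorphism_def intro: continuous_on_subset)
  then have C: "closed (inv_into U \<phi> ` K)" by (rule compact_imp_closed)
  have cover: "W \<union> - inv_into U \<phi> ` K = UNIV"
  proof -
    have "inv_into U \<phi> y \<in> W" if "y \<in> K" for y
    proof -
      have "y \<in> N" "y \<in> \<phi> ` U" using that K(2) N(2) by blast+
      then show ?thesis by (simp add: W_def f_inv_into_f inv_into_into)
    qed
    then show ?thesis by blast
  qed
  have "Cinf_on (\<psi> ` (V \<inter> UNIV)) (?f \<circ> inv_into V \<psi>)" if V: "(V, \<psi>) \<in> M" for V \<psi>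
  proof -
    let ?C = "- inv_into U \<phi> ` K"
    have oW: "open (\<psi> ` (V \<inter> W))" and oC: "open (\<psi> ` (V \<inter> ?C))"
      using W C by (auto intro!: open_chart_image[OF M(1) V])
    have inv: "inv_into V \<psi> (\<psi> z) = z" if "z \<in> V" for z
      using chartD(4)[OF M(1) V] that by simp
    \<comment> \<open>On \<open>W\<close> the extension, read in another chart, is \<open>g\<close>
      composed with a transition map.\<close>
    have "Cinf_on (\<psi> ` (V \<inter> U)) (\<phi> \<circ> inv_into V \<psi>)"
      using M V unfolding smooth_manifold_def by fast
    then have "Cinf_on (\<psi> ` (V \<inter> W)) (\<phi> \<circ> inv_into V \<psi>)"
      by (rule Cinf_on_subset) (auto simp: W_def)
    then have g1: "Cinf_on (\<psi> ` (V \<inter> W)) (\<lambda>y. g ((\<phi> \<circ> inv_into V \<psi>) y))"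
      by (rule Cinf_on_compose[OF oW N(1) _ g(1)]) (auto simp: W_def inv)
    have g2: "g ((\<phi> \<circ> inv_into V \<psi>) y) = (?f \<circ> inv_into V \<psi>) y" if "y \<in> \<psi> ` (V \<inter> W)" for y
      using that by (auto simp: W_def inv)
    have 1: "Cinf_on (\<psi> ` (V \<inter> W)) (?f \<circ> inv_into V \<psi>)"
      by (rule iffD1[OF Cinf_on_cong[OF oW g2] g1])
    have f0: "0 = (?f \<circ> inv_into V \<psi>) y" if y: "y \<in> \<psi> ` (V \<inter> ?C)" for y
    proof -
      obtain z where "y = \<psi> z" "z \<in> V \<inter> ?C" using y by (rule imageE)
      then have z: "z \<in> V" "z \<notin> inv_into U \<phi> ` K" "y = \<psi> z" by simp_all
      have "\<phi> z \<notin> K" if "z \<in> U"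
      proof
        assume "\<phi> z \<in> K"
        then have "inv_into U \<phi> (\<phi> z) \<in> inv_into U \<phi> ` K" by (rule imageI)
        then show False using z(2) by (simp only: inv_into_f_f[OF h(4) that])
      qed
      then have "?f z = 0" using g(2)[of "\<phi> z"] by simp
      then show ?thesis by (simp only: o_apply z(3) inv[OF z(1)])
    qed
    have 2: "Cinf_on (\<psi> ` (V \<inter> ?C)) (?f \<circ> inv_into V \<psi>)"
      by (rule iffD1[OF Cinf_on_cong[OF oC f0] Cinf_on_const[OF oC]])
    have eq: "\<psi> ` (V \<inter> UNIV) = \<psi> ` (V \<inter> W) \<union> \<psi> ` (V \<inter> ?C)"
      by (simp only: cover flip: image_Un Int_Un_distrib)
    show ?thesis unfolding eq by (rule Cinf_on_Un[OF oW oC 1 2])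
  qed
  then show ?thesis
    unfolding smooth_functions_def smooth_on_def mem_Collect_eq by clarify
qed

lemma smooth_function_in_chart:
  assumes "smooth_manifold M" "(U, \<phi>) \<in> M" "f \<in> smooth_functions M"
  shows "Cinf_on (\<phi> ` U) (f \<circ> inv_into U \<phi>)"
  using assms unfolding smooth_functions_def smooth_on_def by fastforce

section \<open>Tangent vectors in a chart\<close>

lemma tangent_space_sum:
  assumes D: "D \<in> tangent_space M x" and M: "smooth_manifold M"
    and f: "\<And>i. i \<in> I \<Longrightarrow> f i \<in> smooth_functions M"
  shows "D (\<Sum>i\<in>I. f i) = (\<Sum>i\<in>I. D (f i))"
proof -
  have lin: "real_linear_on (smooth_functions M) D" using D by (simp add: tangent_space_def)
  have "D (0 *\<^sub>R (0 :: 'a \<Rightarrow> real)) = 0"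
    using lin smooth_functions_const[OF M, of 0]
    unfolding real_linear_on_def zero_fun_def by (metis scale_zero_left)
  then have "D 0 = 0" by simp
  then show ?thesis
    using f
  proof (induction I rule: infinite_finite_induct)
    case (insert i I)
    have "f i \<in> smooth_functions M" "sum f I \<in> smooth_functions M"
      using insert.prems by (auto intro: smooth_functions_sum[OF M])
    then have "D (f i + sum f I) = D (f i) + D (sum f I)"
      by (rule real_linear_on_add[OF lin])
    moreover have "D (sum f I) = (\<Sum>i\<in>I. D (f i))"
      by (rule insert.IH) (use insert.prems in auto)
    ultimately show ?case
      by (simp only: sum.insert[OF insert.hyps(1,2)])
  qed auto
qed

lemma sum_fun_apply: "(\<Sum>i\<in>I. f i) x = (\<Sum>i\<in>I. f i x)"
  by (induction I rule: infinite_finite_induct) auto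

text \<open>\<open>X b\<close> is the chart coordinate centred at \<open>\<phi> x\<close>, cut off
  by a bump function. It vanishes at \<open>x\<close>, so the Leibniz rule applied to Hadamard's
  decomposition keeps only \<open>D (X b)\<close> times the value of the other factor at
  \<open>x\<close>, which is a partial derivative of \<open>f\<close>.\<close>

lemma tangent_coordinates:
  fixes M :: "('m::{t2_space,second_countable_topology}, 'c::fin_dim_normed) atlas"
  assumes M: "smooth_manifold M" "(U, \<phi>) \<in> M" and x: "x \<in> U"
  obtains X :: "'c \<Rightarrow> 'm \<Rightarrow> real" where
    "\<And>b. b \<in> model_basis \<Longrightarrow> X b \<in> smooth_functions M"
    "\<And>b w. b \<in> model_basis \<Longrightarrow> frechet_derivative (X b \<circ> inv_into U \<phi>) (at (\<phi> x)) w = coord b w"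
    "\<And>f D. f \<in> smooth_functions M \<Longrightarrow> D \<in> tangent_space M x \<Longrightarrow>
      D f = (\<Sum>b\<in>model_basis. D (X b) * frechet_derivative (f \<circ> inv_into U \<phi>) (at (\<phi> x)) b)"
proof -
  define p where "p = \<phi> x"
  obtain r where r: "r > 0" "ball p r \<subseteq> \<phi> ` U"
    using chartD(3)[OF M] x unfolding p_def by (meson image_eqI openE)
  obtain \<beta> :: "'c \<Rightarrow> real" and K where \<beta>: "Cinf_on UNIV \<beta>" "\<beta> p = 1"
    and K: "compact K" "K \<subseteq> ball p r" "\<And>y. y \<notin> K \<Longrightarrow> \<beta> y = 0"
    using smooth_bump[OF r(1)] by metis
  define ext where "ext = (\<lambda>g x. if x \<in> U \<and> \<phi> x \<in> ball p r then (\<beta> (\<phi> x) * g (\<phi> x) :: real) else 0)"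
  have ext: "ext g \<in> smooth_functions M" if "Cinf_on (ball p r) g" for g
    unfolding ext_def using that Cinf_on_subset[OF \<beta>(1)] K(3)
    by (intro smooth_extension_by_zero[OF M open_ball r(2) K(1,2)] Cinf_on_mult) auto
  have inv: "inv_into U \<phi> (\<phi> z) = z" if "z \<in> U" for z
    using chartD(4)[OF M] that by simp
  have smooth_coord: "Cinf_on (ball p r) (\<lambda>y. coord b (y - p))" if "b \<in> model_basis" for b :: 'c
    by (rule Cinf_on_coord_diff[OF open_ball that])
  define X where "X = (\<lambda>b. ext (\<lambda>y. coord b (y - p)))"
  have p: "p \<in> ball p r" using r(1) by simp
  have coord0: "coord b (p - p) = 0" if "b \<in> model_basis" for b :: 'c
    using linear_0[OF bounded_linear.linear[OF bounded_linear_coord[OF that]]] by simp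
  show thesis
  proof
    show "X b \<in> smooth_functions M" if "b \<in> model_basis" for b
      unfolding X_def by (rule ext[OF smooth_coord[OF that]])
    show "frechet_derivative (X b \<circ> inv_into U \<phi>) (at (\<phi> x)) w = coord b w" if b: "b \<in> model_basis" for b w
    proof -
      interpret bounded_linear "coord b" by (rule bounded_linear_coord[OF b])
      have c: "((\<lambda>y. coord b (y - p)) has_derivative coord b) (at p)"
        by (auto intro!: derivative_eq_intros has_derivative)
      have "(\<beta> has_derivative frechet_derivative \<beta> (at p)) (at p)"
        using Cinf_on_differentiable[OF \<beta>(1)] frechet_derivative_works by blast
      then have "((\<lambda>y. \<beta> y * coord b (y - p)) has_derivative
          (\<lambda>v. \<beta> p * coord b v + frechet_derivative \<beta> (at p) v * coord b (p - p))) (at p)"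
        using c by (rule has_derivative_mult)
      \<comment> \<open>The derivative of the bump function drops out because the centred coordinate
        is zero at \<open>p\<close>.\<close>
      then have "((\<lambda>y. \<beta> y * coord b (y - p)) has_derivative coord b) (at p)"
        by (simp add: \<beta>(2) zero)
      then have X: "((X b \<circ> inv_into U \<phi>) has_derivative coord b) (at p)"
      proof (rule has_derivative_transform_within_open[OF _ open_ball p])
        fix y assume y: "y \<in> ball p r"
        then obtain z where "z \<in> U" "y = \<phi> z" using r(2) by blast
        with y show "\<beta> y * coord b (y - p) = (X b \<circ> inv_into U \<phi>) y"
          by (simp add: X_def ext_def inv)
      qed
      show ?thesis
        unfolding p_def[symmetric] frechet_derivative_at[OF X, symmetric] by (rule refl)
    qed
    fix f D assume f: "f \<in> smooth_functions M" and D: "D \<in> tangent_space M x"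
    let ?F = "f \<circ> inv_into U \<phi>"
    have F: "Cinf_on (ball p r) ?F"
      by (rule Cinf_on_subset[OF smooth_function_in_chart[OF M f] r(2)])
    obtain g where g: "\<And>b. Cinf_on (ball p r) (g b)" "\<And>b. g b p = frechet_derivative ?F (at p) b"
      "\<And>y. y \<in> ball p r \<Longrightarrow> ?F y = ?F p + (\<Sum>b\<in>model_basis. coord b (y - p) * g b y)"
      by (rule hadamard[OF F r(1)]) (rule that)
    define Y where "Y = ext (\<lambda>_. 1)"
    have Y: "Y \<in> smooth_functions M" unfolding Y_def by (intro ext Cinf_on_const open_ball)
    have Xs: "X b \<in> smooth_functions M" if "b \<in> model_basis" for b
      unfolding X_def by (rule ext[OF smooth_coord[OF that]])
    have Fp: "?F p = f x" using x by (simp add: p_def inv)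
    have xp: "Y x = 1" "ext (g b) x = g b p" "b \<in> model_basis \<Longrightarrow> X b x = 0" for b
      using x p coord0 by (auto simp: Y_def X_def ext_def \<beta>(2) p_def[symmetric])
    \<comment> \<open>With the square of the bump function, both factors of each term in Hadamard's decomposition
      extend by zero to \<open>M\<close>.\<close>
    have eq: "(Y * Y) * f = f x *\<^sub>R (Y * Y) + (\<Sum>b\<in>model_basis. X b * ext (g b))"
    proof
      fix z
      show "((Y * Y) * f) z = (f x *\<^sub>R (Y * Y) + (\<Sum>b\<in>model_basis. X b * ext (g b))) z"
      proof (cases "z \<in> U \<and> \<phi> z \<in> ball p r")
        case True
        then have "f z = f x + (\<Sum>b\<in>model_basis. coord b (\<phi> z - p) * g b (\<phi> z))"
          using g(3)[of "\<phi> z"] Fp by (simp add: inv)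
        then show ?thesis
          using True
          by (simp add: Y_def X_def ext_def scaleR_fun_def sum_fun_apply sum_distrib_left distrib_left mult_ac)
      next
        \<comment> \<open>Off the ball every cut-off function is zero, so both sides vanish.\<close>
        case False
        then show ?thesis
          by (auto simp: Y_def X_def ext_def scaleR_fun_def sum_fun_apply)
      qed
    qed
    have lin: "real_linear_on (smooth_functions M) D"
      and leib: "\<And>f g. f \<in> smooth_functions M \<Longrightarrow> g \<in> smooth_functions M \<Longrightarrow> D (f * g) = f x * D g + g x * D f"
      using D by (auto simp: tangent_space_def)
    have YY: "Y * Y \<in> smooth_functions M" by (rule smooth_functions_mult[OF M(1) Y Y])
    have Xg: "X b * ext (g b) \<in> smooth_functions M" if "b \<in> model_basis" for b
      by (rule smooth_functions_mult[OF M(1) Xs[OF that] ext[OF g(1)]])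
    have Xg_sum: "(\<Sum>b\<in>model_basis. X b * ext (g b)) \<in> smooth_functions M"
      by (rule smooth_functions_sum[OF M(1) Xg])
    \<comment> \<open>\<open>Y\<close> is 1 at \<open>x\<close>, so \<open>D f\<close> appears with
      coefficient 1. The term \<open>f x * D (Y * Y)\<close> arises on both sides of
      \<open>eq\<close> and cancels.\<close>
    have "D ((Y * Y) * f) = D f + f x * D (Y * Y)"
      by (simp add: leib[OF YY f] xp)
    moreover have "D (f x *\<^sub>R (Y * Y) + (\<Sum>b\<in>model_basis. X b * ext (g b)))
        = f x * D (Y * Y) + D (\<Sum>b\<in>model_basis. X b * ext (g b))"
      by (simp only: real_linear_on_add[OF lin smooth_functions_scaleR[OF M(1) YY] Xg_sum]
          real_linear_on_scaleR[OF lin YY] real_scaleR_def)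
    moreover have "D (\<Sum>b\<in>model_basis. X b * ext (g b))
        = (\<Sum>b\<in>model_basis. D (X b) * frechet_derivative ?F (at p) b)"
    proof -
      have "D (\<Sum>b\<in>model_basis. X b * ext (g b)) = (\<Sum>b\<in>model_basis. D (X b * ext (g b)))"
        by (rule tangent_space_sum[OF D M(1)]) (rule Xg)
      also have "\<dots> = (\<Sum>b\<in>model_basis. D (X b) * frechet_derivative ?F (at p) b)"
      proof (rule sum.cong[OF refl])
        fix b :: 'c assume b: "b \<in> model_basis"
        show "D (X b * ext (g b)) = D (X b) * frechet_derivative ?F (at p) b"
          by (simp add: leib[OF Xs[OF b] ext[OF g(1)]] xp(2) xp(3)[OF b] g(2))
      qed
      finally show ?thesis .
    qed
    ultimately show "D f = (\<Sum>b\<in>model_basis. D (X b) * frechet_derivative ?F (at (\<phi> x)) b)"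
      using eq by (simp add: p_def)
  qed
qed


text \<open>The fibrewise content of a bundle atlas: what sums and multiples of sections rely on. In
  this form the closure properties below apply alike to \<open>A\<close>, \<open>E\<close> and the
  tangent bundle.\<close>

definition trivialises_fibres :: "('m::topological_space, 'v::real_vector, 'f::real_vector) vbundle \<Rightarrow> bool"
  where "trivialises_fibres E \<longleftrightarrow> \<Union> (fst ` triv E) = UNIV \<and>
    (\<forall>(U, \<tau>)\<in>triv E. open U \<and> (\<forall>x\<in>U. linear (\<tau> x) \<and> bij_betw (\<tau> x) UNIV (fibre E x)))"

lemma vector_bundle_trivialises_fibres: "vector_bundle M E \<Longrightarrow> trivialises_fibres E"
  unfolding vector_bundle_def trivialises_fibres_def by blast

lemma frechet_derivative_in_tangent_space:
  assumes M: "smooth_manifold M" "(U, \<phi>) \<in> M" and x: "x \<in> U"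
  shows "(\<lambda>f. if f \<in> smooth_functions M then frechet_derivative (f \<circ> inv_into U \<phi>) (at (\<phi> x)) w else 0)
    \<in> tangent_space M x" (is "?D \<in> _")
proof -
  have xx: "inv_into U \<phi> (\<phi> x) = x" using chartD(4)[OF M] x by simp
  have der: "((f \<circ> inv_into U \<phi>) has_derivative frechet_derivative (f \<circ> inv_into U \<phi>) (at (\<phi> x))) (at (\<phi> x))"
    if "f \<in> smooth_functions M" for f
    using Cinf_on_differentiable[OF smooth_function_in_chart[OF M that] imageI[OF x]]
    by (simp only: frechet_derivative_works)
  have "?D (f + g) = ?D f + ?D g" if f: "f \<in> smooth_functions M" and g: "g \<in> smooth_functions M" for f g
  proof -
    have "frechet_derivative ((f + g) \<circ> inv_into U \<phi>) (at (\<phi> x))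
      = (\<lambda>v. frechet_derivative (f \<circ> inv_into U \<phi>) (at (\<phi> x)) v + frechet_derivative (g \<circ> inv_into U \<phi>) (at (\<phi> x)) v)"
      by (rule frechet_derivative_at[symmetric])
        (use has_derivative_add[OF der[OF f] der[OF g]] in \<open>simp add: o_def plus_fun_def\<close>)
    then show ?thesis using f g smooth_functions_add[OF M(1) f g] by simp
  qed
  moreover have "?D (c *\<^sub>R f) = c *\<^sub>R ?D f" if f: "f \<in> smooth_functions M" for c f
  proof -
    have "frechet_derivative ((c *\<^sub>R f) \<circ> inv_into U \<phi>) (at (\<phi> x))
      = (\<lambda>v. c *\<^sub>R frechet_derivative (f \<circ> inv_into U \<phi>) (at (\<phi> x)) v)"
      by (rule frechet_derivative_at[symmetric])
        (use has_derivative_scaleR_right[OF der[OF f], of c] in \<open>simp add: o_def scaleR_fun_def\<close>)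
    then show ?thesis using f smooth_functions_scaleR[OF M(1) f] by simp
  qed
  moreover have "?D (f * g) = f x * ?D g + g x * ?D f"
    if f: "f \<in> smooth_functions M" and g: "g \<in> smooth_functions M" for f g
  proof -
    have "frechet_derivative ((f * g) \<circ> inv_into U \<phi>) (at (\<phi> x))
      = (\<lambda>v. f x * frechet_derivative (g \<circ> inv_into U \<phi>) (at (\<phi> x)) v + frechet_derivative (f \<circ> inv_into U \<phi>) (at (\<phi> x)) v * g x)"
      by (rule frechet_derivative_at[symmetric])
        (use has_derivative_mult[OF der[OF f] der[OF g]] in \<open>simp add: o_def times_fun_def xx\<close>)
    then show ?thesis using f g smooth_functions_mult[OF M(1) f g] by simp
  qed
  ultimately show ?thesis unfolding tangent_space_def real_linear_on_def by simp
qed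

text \<open>A direction is recovered from its directional derivative by applying it to the functions
  \<open>X b\<close>, which gives injectivity. For surjectivity, the direction belonging to
  \<open>D\<close> is the one with coordinates \<open>D (X b)\<close>.\<close>

lemma tangent_bundle_trivialises_fibres:
  assumes M: "smooth_manifold M"
  shows "trivialises_fibres (tangent_bundle M)"
proof -
  have "linear (\<lambda>w f. if f \<in> smooth_functions M then frechet_derivative (f \<circ> inv_into U \<phi>) (at (\<phi> x)) w else 0)
      \<and> bij_betw (\<lambda>w f. if f \<in> smooth_functions M then frechet_derivative (f \<circ> inv_into U \<phi>) (at (\<phi> x)) w else 0)
          UNIV (tangent_space M x)" (is "linear ?\<tau> \<and> bij_betw ?\<tau> UNIV _")
    if U: "(U, \<phi>) \<in> M" and x: "x \<in> U" for U \<phi> x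
  proof
    have lin: "linear (frechet_derivative (f \<circ> inv_into U \<phi>) (at (\<phi> x)))" if "f \<in> smooth_functions M" for f
      by (rule linear_frechet_derivative[OF
            Cinf_on_differentiable[OF smooth_function_in_chart[OF M U that] imageI[OF x]]])
    show "linear ?\<tau>"
    proof (rule linearI)
      show "?\<tau> (v + w) = ?\<tau> v + ?\<tau> w" for v w
        by (rule ext) (simp add: linear_add[OF lin])
      show "?\<tau> (c *\<^sub>R v) = c *\<^sub>R ?\<tau> v" for c v
        by (rule ext) (simp add: linear_scale[OF lin] scaleR_fun_def)
    qed
    obtain X where X: "\<And>b. b \<in> model_basis \<Longrightarrow> X b \<in> smooth_functions M"
      "\<And>b w. b \<in> model_basis \<Longrightarrow> frechet_derivative (X b \<circ> inv_into U \<phi>) (at (\<phi> x)) w = coord b w"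
      "\<And>f D. f \<in> smooth_functions M \<Longrightarrow> D \<in> tangent_space M x \<Longrightarrow>
        D f = (\<Sum>b\<in>model_basis. D (X b) * frechet_derivative (f \<circ> inv_into U \<phi>) (at (\<phi> x)) b)"
      by (rule tangent_coordinates[OF M U x]) (rule that)
    show "bij_betw ?\<tau> UNIV (tangent_space M x)"
    proof (rule bij_betw_imageI)
      show "inj ?\<tau>"
      proof (rule injI)
        fix v w assume eq: "?\<tau> v = ?\<tau> w"
        have "coord b v = coord b w" if b: "b \<in> model_basis" for b
          using fun_cong[OF eq, of "X b"] X(1,2)[OF b] by simp
        then have "(\<Sum>b\<in>model_basis. coord b v *\<^sub>R b) = (\<Sum>b\<in>model_basis. coord b w *\<^sub>R b)"
          by (intro sum.cong refl) simp
        then show "v = w" by (simp only: sum_coord)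
      qed
      have "D \<in> range ?\<tau>" if D: "D \<in> tangent_space M x" for D
      proof
        show "D = ?\<tau> (\<Sum>b\<in>model_basis. D (X b) *\<^sub>R b)"
        proof
          fix f
          \<comment> \<open>Tangent vectors are functionals on all functions with the default value
            0 off the smooth ones, so equality has to be checked in both cases.\<close>
          show "D f = ?\<tau> (\<Sum>b\<in>model_basis. D (X b) *\<^sub>R b) f"
          proof (cases "f \<in> smooth_functions M")
            case True
            then show ?thesis
              by (simp add: X(3)[OF True D] linear_sum[OF lin[OF True]] linear_scale[OF lin[OF True]])
          next
            case False
            then show ?thesis using D by (simp add: tangent_space_def)
          qed
        qed
      qed simp
      then show "range ?\<tau> = tangent_space M x"
        using frechet_derivative_in_tangent_space[OF M U x] by (intro subset_antisym subsetI) auto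
    qed
  qed
  then show ?thesis
    using chartD(1)[OF M] M
    by (auto simp: trivialises_fibres_def tangent_bundle_def image_image case_prod_unfold smooth_manifold_def)
qed

section \<open>Sections and cochains\<close>

lemma trivialises_fibresD:
  assumes "trivialises_fibres E" "(V, \<tau>) \<in> triv E"
  shows "open V" "\<And>x. x \<in> V \<Longrightarrow> linear (\<tau> x)" "\<And>x. x \<in> V \<Longrightarrow> inj (\<tau> x)"
    "\<And>x. x \<in> V \<Longrightarrow> range (\<tau> x) = fibre E x"
proof -
  have *: "open V \<and> (\<forall>x\<in>V. linear (\<tau> x) \<and> bij_betw (\<tau> x) UNIV (fibre E x))"
    using assms unfolding trivialises_fibres_def by fast
  then show "open V" "\<And>x. x \<in> V \<Longrightarrow> linear (\<tau> x)" by auto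
  show "\<And>x. x \<in> V \<Longrightarrow> inj (\<tau> x)" "\<And>x. x \<in> V \<Longrightarrow> range (\<tau> x) = fibre E x"
    using * by (auto simp: bij_betw_def)
qed

lemma subspace_fibre:
  assumes "trivialises_fibres E"
  shows "subspace (fibre E x)"
proof -
  have "x \<in> \<Union> (fst ` triv E)" using assms by (simp add: trivialises_fibres_def)
  then obtain V \<tau> where V: "(V, \<tau>) \<in> triv E" "x \<in> V" by force
  have "subspace (range (\<tau> x))"
    by (intro linear_subspace_image trivialises_fibresD(2)[OF assms V] subspace_UNIV)
  then show ?thesis by (simp only: trivialises_fibresD(4)[OF assms V])
qed

text \<open>Outside the range of \<open>\<tau> x\<close> the value of \<open>inv_into\<close>
  carries no information, which is why vectors are required to lie in the fibre.\<close>

lemma linear_inv_into_fibre: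
  assumes E: "trivialises_fibres E" and V: "(V, \<tau>) \<in> triv E" "x \<in> V"
  shows "s \<in> fibre E x \<Longrightarrow> t \<in> fibre E x \<Longrightarrow> inv_into UNIV (\<tau> x) (s + t) = inv_into UNIV (\<tau> x) s + inv_into UNIV (\<tau> x) t"
    and "s \<in> fibre E x \<Longrightarrow> inv_into UNIV (\<tau> x) (c *\<^sub>R s) = c *\<^sub>R inv_into UNIV (\<tau> x) s"
    and "inv_into UNIV (\<tau> x) 0 = 0"
proof -
  note t = trivialises_fibresD(2,3,4)[OF E V]
  interpret linear "\<tau> x" by (rule t(1))
  have f: "\<tau> x (inv_into UNIV (\<tau> x) s) = s" if "s \<in> fibre E x" for s
    using that t(3) by (metis f_inv_into_f)
  have i: "inv_into UNIV (\<tau> x) s = w" if "\<tau> x w = s" for s w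
    using that t(2) by (metis inv_f_f)
  show "inv_into UNIV (\<tau> x) (s + t) = inv_into UNIV (\<tau> x) s + inv_into UNIV (\<tau> x) t"
    if "s \<in> fibre E x" "t \<in> fibre E x"
    by (rule i) (simp add: add f that)
  show "inv_into UNIV (\<tau> x) (c *\<^sub>R s) = c *\<^sub>R inv_into UNIV (\<tau> x) s" if "s \<in> fibre E x"
    by (rule i) (simp add: scale f that)
  show "inv_into UNIV (\<tau> x) 0 = 0" by (rule i) (rule zero)
qed

lemma local_sectionsI:
  assumes "\<And>x. x \<in> U \<Longrightarrow> s x \<in> fibre E x"
    and "\<And>V \<tau>. (V, \<tau>) \<in> triv E \<Longrightarrow> smooth_on M (U \<inter> V) (\<lambda>x. inv_into UNIV (\<tau> x) (s x))"
  shows "s \<in> local_sections M E U"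
  using assms by (auto simp: local_sections_def)

lemma local_sectionsD:
  assumes "s \<in> local_sections M E U"
  shows "x \<in> U \<Longrightarrow> s x \<in> fibre E x"
    and "(V, \<tau>) \<in> triv E \<Longrightarrow> smooth_on M (U \<inter> V) (\<lambda>x. inv_into UNIV (\<tau> x) (s x))"
  using assms by (auto simp: local_sections_def)

lemma local_sections_add:
  assumes M: "smooth_manifold M" and E: "trivialises_fibres E" and U: "open U"
    and s: "s \<in> local_sections M E U" and t: "t \<in> local_sections M E U"
  shows "s + t \<in> local_sections M E U"
proof (rule local_sectionsI)
  show "(s + t) x \<in> fibre E x" if "x \<in> U" for x
    using local_sectionsD(1)[OF s that] local_sectionsD(1)[OF t that]
    by (simp add: subspace_add[OF subspace_fibre[OF E]])
  fix V \<tau> assume V: "(V, \<tau>) \<in> triv E"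
  have o: "open (U \<inter> V)" using U trivialises_fibresD(1)[OF E V] by blast
  have "inv_into UNIV (\<tau> x) ((s + t) x) = inv_into UNIV (\<tau> x) (s x) + inv_into UNIV (\<tau> x) (t x)"
    if "x \<in> U \<inter> V" for x
    using that local_sectionsD(1)[OF s] local_sectionsD(1)[OF t]
    by (simp add: linear_inv_into_fibre(1)[OF E V])
  then show "smooth_on M (U \<inter> V) (\<lambda>x. inv_into UNIV (\<tau> x) ((s + t) x))"
    using smooth_on_add[OF M o local_sectionsD(2)[OF s V] local_sectionsD(2)[OF t V]]
    by (rule iffD2[OF smooth_on_cong[OF M o]])
qed

lemma local_sections_fun_mult:
  assumes M: "smooth_manifold M" and E: "trivialises_fibres E" and U: "open U"
    and f: "smooth_on M U f" and s: "s \<in> local_sections M E U"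
  shows "f \<odot> s \<in> local_sections M E U"
proof (rule local_sectionsI)
  show "(f \<odot> s) x \<in> fibre E x" if "x \<in> U" for x
    using local_sectionsD(1)[OF s that]
    by (simp add: fun_mult_def subspace_scale[OF subspace_fibre[OF E]])
  fix V \<tau> assume V: "(V, \<tau>) \<in> triv E"
  have o: "open (U \<inter> V)" using U trivialises_fibresD(1)[OF E V] by blast
  have "inv_into UNIV (\<tau> x) ((f \<odot> s) x) = f x *\<^sub>R inv_into UNIV (\<tau> x) (s x)"
    if "x \<in> U \<inter> V" for x
    using that local_sectionsD(1)[OF s]
    by (simp add: fun_mult_def linear_inv_into_fibre(2)[OF E V])
  then show "smooth_on M (U \<inter> V) (\<lambda>x. inv_into UNIV (\<tau> x) ((f \<odot> s) x))"
    using smooth_on_scaleR[OF M o smooth_on_subset[OF f Int_lower1] local_sectionsD(2)[OF s V]]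
    by (rule iffD2[OF smooth_on_cong[OF M o]])
qed

text \<open>Real multiples are multiples by constant functions, so real homogeneity becomes a case
  of linearity over smooth functions.\<close>

lemma scaleR_eq_fun_mult: "c *\<^sub>R s = (\<lambda>_. c) \<odot> s"
  by (simp add: fun_mult_def scaleR_fun_def)

lemma subspace_local_sections:
  assumes M: "smooth_manifold M" and E: "trivialises_fibres E" and U: "open U"
  shows "subspace (local_sections M E U)"
proof (rule subspaceI)
  show "0 \<in> local_sections M E U"
  proof (rule local_sectionsI)
    show "0 x \<in> fibre E x" for x
      by (simp add: subspace_0[OF subspace_fibre[OF E]])
    fix V \<tau> assume V: "(V, \<tau>) \<in> triv E"
    have o: "open (U \<inter> V)" using U trivialises_fibresD(1)[OF E V] by blast
    have "inv_into UNIV (\<tau> x) (0 x) = 0" if "x \<in> U \<inter> V" for x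
      using that by (simp add: linear_inv_into_fibre(3)[OF E V])
    then show "smooth_on M (U \<inter> V) (\<lambda>x. inv_into UNIV (\<tau> x) (0 x))"
      using smooth_on_const[OF M o] by (rule iffD2[OF smooth_on_cong[OF M o]])
  qed
  show "s + t \<in> local_sections M E U" if "s \<in> local_sections M E U" "t \<in> local_sections M E U" for s t
    by (rule local_sections_add[OF M E U that])
  show "c *\<^sub>R s \<in> local_sections M E U" if "s \<in> local_sections M E U" for c s
    unfolding scaleR_eq_fun_mult by (rule local_sections_fun_mult[OF M E U smooth_on_const[OF M U] that])
qed

lemma sections_fun_mult:
  assumes "smooth_manifold M" "trivialises_fibres E" "f \<in> smooth_functions M" "s \<in> \<Gamma> M E"
  shows "f \<odot> s \<in> \<Gamma> M E"
  using assms by (intro local_sections_fun_mult) (simp_all add: smooth_functions_def)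

section \<open>Linear, multilinear and alternating maps on subspaces\<close>

lemma real_linear_onI:
  "(\<And>x y. x \<in> S \<Longrightarrow> y \<in> S \<Longrightarrow> h (x + y) = h x + h y) \<Longrightarrow>
    (\<And>c x. x \<in> S \<Longrightarrow> h (c *\<^sub>R x) = c *\<^sub>R h x) \<Longrightarrow> real_linear_on S h"
  by (simp add: real_linear_on_def)

lemma real_linear_on_zero: "real_linear_on S (\<lambda>v. 0)"
  by (simp add: real_linear_on_def)

lemma real_linear_on_add_fun:
  "real_linear_on S g \<Longrightarrow> real_linear_on S h \<Longrightarrow> real_linear_on S (\<lambda>v. g v + h v)"
  by (simp add: real_linear_on_def scaleR_add_right)

lemma real_linear_on_scaleR_fun:
  "real_linear_on S h \<Longrightarrow> real_linear_on S (\<lambda>v. c *\<^sub>R h v)"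
  by (simp add: real_linear_on_def scaleR_add_right)

lemma real_linear_on_compose:
  "real_linear_on S' g \<Longrightarrow> real_linear_on S h \<Longrightarrow> (\<And>v. v \<in> S \<Longrightarrow> h v \<in> S') \<Longrightarrow> real_linear_on S (\<lambda>v. g (h v))"
  by (simp add: real_linear_on_def)

lemma real_linear_on_0:
  assumes "real_linear_on S h" "subspace S"
  shows "h 0 = 0"
  using real_linear_on_scaleR[OF assms(1) subspace_0[OF assms(2)], of 0] by simp

lemma tuples_update: "us \<in> tuples S k \<Longrightarrow> v \<in> S \<Longrightarrow> us[i := v] \<in> tuples S k"
  using set_update_subset_insert[of us i v] by (auto simp: tuples_def)

lemma tuples_nth: "us \<in> tuples S k \<Longrightarrow> i < k \<Longrightarrow> us ! i \<in> S"
  by (auto simp: tuples_def)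

lemma multilinear_onI:
  "(\<And>us i. us \<in> tuples S k \<Longrightarrow> i < k \<Longrightarrow> real_linear_on S (\<lambda>v. p (us[i := v]))) \<Longrightarrow> multilinear_on S k p"
  by (simp add: multilinear_on_def)

lemma multilinear_onD:
  "multilinear_on S k p \<Longrightarrow> us \<in> tuples S k \<Longrightarrow> i < k \<Longrightarrow> real_linear_on S (\<lambda>v. p (us[i := v]))"
  by (simp add: multilinear_on_def)

lemma multilinear_on_zero: "multilinear_on S k (\<lambda>us. 0)"
  by (rule multilinear_onI) (rule real_linear_on_zero)

lemma multilinear_on_add:
  "multilinear_on S k p \<Longrightarrow> multilinear_on S k q \<Longrightarrow> multilinear_on S k (\<lambda>us. p us + q us)"
  by (rule multilinear_onI) (rule real_linear_on_add_fun; rule multilinear_onD)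

lemma multilinear_on_scaleR:
  "multilinear_on S k p \<Longrightarrow> multilinear_on S k (\<lambda>us. c *\<^sub>R p us)"
  by (rule multilinear_onI) (rule real_linear_on_scaleR_fun; rule multilinear_onD)

lemma multilinear_on_compose:
  assumes "real_linear_on S' h" "multilinear_on S k p" "\<And>us. us \<in> tuples S k \<Longrightarrow> p us \<in> S'"
  shows "multilinear_on S k (\<lambda>us. h (p us))"
proof (rule multilinear_onI)
  fix us i assume us: "us \<in> tuples S k" and i: "i < k"
  show "real_linear_on S (\<lambda>v. h (p (us[i := v])))"
    using assms(1) multilinear_onD[OF assms(2) us i]
    by (rule real_linear_on_compose) (rule assms(3)[OF tuples_update[OF us]])
qed

lemma alternating_onI:
  "(\<And>us i j. us \<in> tuples S k \<Longrightarrow> i < j \<Longrightarrow> j < n \<Longrightarrow> us ! i = us ! j \<Longrightarrow> p us = 0) \<Longrightarrow> alternating_on S n k p"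
  by (auto simp: alternating_on_def)

lemma alternating_onD:
  "alternating_on S n k p \<Longrightarrow> us \<in> tuples S k \<Longrightarrow> i < j \<Longrightarrow> j < n \<Longrightarrow> us ! i = us ! j \<Longrightarrow> p us = 0"
  unfolding alternating_on_def by blast

lemma hom_wedge_sectionI:
  assumes "\<And>x vs. vs \<in> tuples (fibre E x) k \<Longrightarrow> p x vs \<in> fibre F x"
    and "\<And>x. multilinear_on (fibre E x) k (p x)"
    and "\<And>x. alternating_on (fibre E x) k k (p x)"
    and "\<And>U us. open U \<Longrightarrow> us \<in> tuples (local_sections M E U) k \<Longrightarrow>
      (\<lambda>x. p x (map (\<lambda>u. u x) us)) \<in> local_sections M F U"
  shows "hom_wedge_section M E F k p"
  using assms by (simp add: hom_wedge_section_def)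

lemma hom_wedge_sectionD:
  assumes "hom_wedge_section M E F k p"
  shows "vs \<in> tuples (fibre E x) k \<Longrightarrow> p x vs \<in> fibre F x"
    and "multilinear_on (fibre E x) k (p x)"
    and "alternating_on (fibre E x) k k (p x)"
    and "open U \<Longrightarrow> us \<in> tuples (local_sections M E U) k \<Longrightarrow>
      (\<lambda>x. p x (map (\<lambda>u. u x) us)) \<in> local_sections M F U"
  using assms by (simp_all add: hom_wedge_section_def)

text \<open>The operations are carried out on the underlying fields of multilinear maps; their
  smoothness clause reduces to the fact that local sections of \<open>F\<close> form a subspace.
  \<open>F\<close> is \<open>A\<close> for the cochains of \<open>T\<close> and the tangent bundle
  for symbols.\<close>

lemma subspace_hom_cochains:
  assumes M: "smooth_manifold M" and F: "trivialises_fibres F"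
  shows "subspace (hom_cochains M E F k)"
proof (rule subspaceI)
  note fib = subspace_fibre[OF F] and loc = subspace_local_sections[OF M F]
  have "hom_wedge_section M E F k (\<lambda>x vs. 0)"
  proof (rule hom_wedge_sectionI)
    show "(\<lambda>x. 0) \<in> local_sections M F U" if "open U" for U
      using subspace_0[OF loc[OF that]] by (simp add: zero_fun_def)
  qed (simp_all add: subspace_0[OF fib] multilinear_on_zero alternating_on_def)
  then have "act_on_sections M E k (\<lambda>x vs. 0) \<in> hom_cochains M E F k" by (simp add: hom_cochains_def)
  moreover have "act_on_sections M E k (\<lambda>x vs. 0 :: 'c) = 0"
    by (simp add: act_on_sections_def fun_eq_iff)
  ultimately show "0 \<in> hom_cochains M E F k" by simp
next
  note fib = subspace_fibre[OF F] and loc = subspace_local_sections[OF M F]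
  fix P Q assume "P \<in> hom_cochains M E F k" "Q \<in> hom_cochains M E F k"
  then obtain p q where p: "hom_wedge_section M E F k p" "P = act_on_sections M E k p"
    and q: "hom_wedge_section M E F k q" "Q = act_on_sections M E k q"
    by (auto simp: hom_cochains_def)
  have "hom_wedge_section M E F k (\<lambda>x vs. p x vs + q x vs)"
  proof (rule hom_wedge_sectionI)
    fix x
    show "p x vs + q x vs \<in> fibre F x" if "vs \<in> tuples (fibre E x) k" for vs
      by (intro subspace_add[OF fib] hom_wedge_sectionD(1)[OF p(1) that] hom_wedge_sectionD(1)[OF q(1) that])
    show "multilinear_on (fibre E x) k (\<lambda>vs. p x vs + q x vs)"
      by (rule multilinear_on_add[OF hom_wedge_sectionD(2)[OF p(1)] hom_wedge_sectionD(2)[OF q(1)]])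
    show "alternating_on (fibre E x) k k (\<lambda>vs. p x vs + q x vs)"
    proof (rule alternating_onI)
      fix us i j assume a: "us \<in> tuples (fibre E x) k" "i < j" "j < k" "us ! i = us ! j"
      show "p x us + q x us = 0"
        by (simp add: alternating_onD[OF hom_wedge_sectionD(3)[OF p(1)] a] alternating_onD[OF hom_wedge_sectionD(3)[OF q(1)] a])
    qed
    show "(\<lambda>x. p x (map (\<lambda>u. u x) us) + q x (map (\<lambda>u. u x) us)) \<in> local_sections M F U"
      if "open U" "us \<in> tuples (local_sections M E U) k" for U us
      using subspace_add[OF loc[OF that(1)] hom_wedge_sectionD(4)[OF p(1) that] hom_wedge_sectionD(4)[OF q(1) that]]
      by (simp add: plus_fun_def)
  qed
  then have "act_on_sections M E k (\<lambda>x vs. p x vs + q x vs) \<in> hom_cochains M E F k" by (simp add: hom_cochains_def)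
  moreover have "act_on_sections M E k (\<lambda>x vs. p x vs + q x vs) = P + Q"
    unfolding p(2) q(2) by (simp add: act_on_sections_def fun_eq_iff)
  ultimately show "P + Q \<in> hom_cochains M E F k" by simp
next
  note fib = subspace_fibre[OF F] and loc = subspace_local_sections[OF M F]
  fix c P assume "P \<in> hom_cochains M E F k"
  then obtain p where p: "hom_wedge_section M E F k p" "P = act_on_sections M E k p"
    by (auto simp: hom_cochains_def)
  have "hom_wedge_section M E F k (\<lambda>x vs. c *\<^sub>R p x vs)"
  proof (rule hom_wedge_sectionI)
    fix x
    show "c *\<^sub>R p x vs \<in> fibre F x" if "vs \<in> tuples (fibre E x) k" for vs
      by (intro subspace_scale[OF fib] hom_wedge_sectionD(1)[OF p(1) that])
    show "multilinear_on (fibre E x) k (\<lambda>vs. c *\<^sub>R p x vs)"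
      by (rule multilinear_on_scaleR[OF hom_wedge_sectionD(2)[OF p(1)]])
    show "alternating_on (fibre E x) k k (\<lambda>vs. c *\<^sub>R p x vs)"
    proof (rule alternating_onI)
      fix us i j assume a: "us \<in> tuples (fibre E x) k" "i < j" "j < k" "us ! i = us ! j"
      show "c *\<^sub>R p x us = 0"
        by (simp add: alternating_onD[OF hom_wedge_sectionD(3)[OF p(1)] a])
    qed
    show "(\<lambda>x. c *\<^sub>R p x (map (\<lambda>u. u x) us)) \<in> local_sections M F U"
      if "open U" "us \<in> tuples (local_sections M E U) k" for U us
      using subspace_scale[OF loc[OF that(1)] hom_wedge_sectionD(4)[OF p(1) that]]
      by (simp add: scaleR_fun_def)
  qed
  then have "act_on_sections M E k (\<lambda>x vs. c *\<^sub>R p x vs) \<in> hom_cochains M E F k" by (simp add: hom_cochains_def)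
  moreover have "act_on_sections M E k (\<lambda>x vs. c *\<^sub>R p x vs) = c *\<^sub>R P"
    unfolding p(2) by (simp add: act_on_sections_def fun_eq_iff scaleR_fun_def)
  ultimately show "c *\<^sub>R P \<in> hom_cochains M E F k" by simp
qed

lemma tuples_map: "us \<in> tuples (local_sections M E U) k \<Longrightarrow> x \<in> U \<Longrightarrow> map (\<lambda>u. u x) us \<in> tuples (fibre E x) k"
  using local_sectionsD(1) by (fastforce simp: tuples_def)

text \<open>Evaluated at a point \<open>x\<close>, each claim about sections becomes the
  corresponding one about the fibre over \<open>x\<close>. In particular a smooth function acts
  there as the scalar \<open>f x\<close>, so linearity over functions follows from real homogeneity
  of the slot.\<close>

lemma hom_cochainsD:
  assumes M: "smooth_manifold M" and E: "trivialises_fibres E" and P: "P \<in> hom_cochains M E F k"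
  shows "us \<in> tuples (\<Gamma> M E) k \<Longrightarrow> P us \<in> \<Gamma> M F"
    and "us \<notin> tuples (\<Gamma> M E) k \<Longrightarrow> P us = 0"
    and "multilinear_on (\<Gamma> M E) k P"
    and "alternating_on (\<Gamma> M E) k k P"
    and "us \<in> tuples (\<Gamma> M E) k \<Longrightarrow> i < k \<Longrightarrow> f \<in> smooth_functions M \<Longrightarrow> P (us[i := f \<odot> (us ! i)]) = f \<odot> P us"
proof -
  obtain p where p: "hom_wedge_section M E F k p" and P_def: "P = act_on_sections M E k p"
    using P by (auto simp: hom_cochains_def)
  have P_eq: "P us = (\<lambda>x. p x (map (\<lambda>u. u x) us))" if "us \<in> tuples (\<Gamma> M E) k" for us
    using that by (simp add: P_def act_on_sections_def)
  note sub = subspace_local_sections[OF M E open_UNIV]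
  have slot: "real_linear_on (fibre E x) (\<lambda>v. p x ((map (\<lambda>u. u x) us)[i := v]))"
    if "us \<in> tuples (\<Gamma> M E) k" "i < k" for us i x
    by (rule multilinear_onD[OF hom_wedge_sectionD(2)[OF p] tuples_map[OF that(1) UNIV_I] that(2)])
  show "P us \<in> \<Gamma> M F" if "us \<in> tuples (\<Gamma> M E) k"
    unfolding P_eq[OF that] by (rule hom_wedge_sectionD(4)[OF p open_UNIV that])
  show "P us = 0" if "us \<notin> tuples (\<Gamma> M E) k"
    using that by (simp add: P_def act_on_sections_def)
  show "multilinear_on (\<Gamma> M E) k P"
  proof (rule multilinear_onI)
    fix us i assume us: "us \<in> tuples (\<Gamma> M E) k" and i: "i < k"
    have upd: "P (us[i := v]) = (\<lambda>x. p x ((map (\<lambda>u. u x) us)[i := v x]))" if "v \<in> \<Gamma> M E" for v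
      by (simp add: P_eq[OF tuples_update[OF us that]] map_update)
    show "real_linear_on (\<Gamma> M E) (\<lambda>v. P (us[i := v]))"
    proof (rule real_linear_onI)
      fix v w assume v: "v \<in> \<Gamma> M E" and w: "w \<in> \<Gamma> M E"
      show "P (us[i := v + w]) = P (us[i := v]) + P (us[i := w])"
        using real_linear_on_add[OF slot[OF us i] local_sectionsD(1)[OF v] local_sectionsD(1)[OF w]]
        by (simp add: upd v w subspace_add[OF sub v w] fun_eq_iff)
    next
      fix c v assume v: "v \<in> \<Gamma> M E"
      show "P (us[i := c *\<^sub>R v]) = c *\<^sub>R P (us[i := v])"
        using real_linear_on_scaleR[OF slot[OF us i] local_sectionsD(1)[OF v]]
        unfolding upd[OF v] upd[OF subspace_scale[OF sub v]] by (simp add: fun_eq_iff scaleR_fun_def)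
    qed
  qed
  show "alternating_on (\<Gamma> M E) k k P"
  proof (rule alternating_onI)
    fix us i j assume us: "us \<in> tuples (\<Gamma> M E) k" and ij: "i < j" "j < k" "us ! i = us ! j"
    have "length us = k" using us by (simp add: tuples_def)
    then have "p x (map (\<lambda>u. u x) us) = 0" for x
      using ij by (intro alternating_onD[OF hom_wedge_sectionD(3)[OF p] tuples_map[OF us UNIV_I] ij(1,2)]) simp
    then show "P us = 0" by (simp add: P_eq[OF us] fun_eq_iff)
  qed
  show "P (us[i := f \<odot> (us ! i)]) = f \<odot> P us"
    if us: "us \<in> tuples (\<Gamma> M E) k" and i: "i < k" and f: "f \<in> smooth_functions M"
  proof
    fix x
    have u: "us ! i \<in> \<Gamma> M E" by (rule tuples_nth[OF us i])
    have len: "length us = k" using us by (simp add: tuples_def)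
    have "P (us[i := f \<odot> (us ! i)]) x = p x ((map (\<lambda>u. u x) us)[i := f x *\<^sub>R (us ! i) x])"
      unfolding P_eq[OF tuples_update[OF us sections_fun_mult[OF M E f u]]] map_update
      by (simp add: fun_mult_def)
    also have "\<dots> = f x *\<^sub>R p x ((map (\<lambda>u. u x) us)[i := (us ! i) x])"
      by (rule real_linear_on_scaleR[OF slot[OF us i] local_sectionsD(1)[OF u UNIV_I]])
    also have "(map (\<lambda>u. u x) us)[i := (us ! i) x] = map (\<lambda>u. u x) us"
      using len i by (metis list_update_id map_update)
    finally show "P (us[i := f \<odot> (us ! i)]) x = (f \<odot> P us) x"
      by (simp add: P_eq[OF us] fun_mult_def)
  qed
qed


section \<open>Cohomology classes and induced homomorphisms\<close>

lemma real_linear_on_diff: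
  assumes "real_linear_on S h" "subspace S" "x \<in> S" "y \<in> S"
  shows "h (x - y) = h x - h y"
  using real_linear_on_add[OF assms(1) subspace_diff[OF assms(2-4)] assms(4)] by (simp add: algebra_simps)

lemma subspace_real_linear_image:
  assumes "real_linear_on S h" "subspace S"
  shows "subspace (h ` S)"
proof (rule subspaceI)
  show "0 \<in> h ` S"
    using real_linear_on_0[OF assms] subspace_0[OF assms(2)] by (metis imageI)
  show "x + y \<in> h ` S" if xy: "x \<in> h ` S" "y \<in> h ` S" for x y
  proof -
    obtain u v where u: "u \<in> S" "x = h u" and v: "v \<in> S" "y = h v" using xy by blast
    show ?thesis
      unfolding u(2) v(2) real_linear_on_add[OF assms(1) u(1) v(1), symmetric]
      by (rule imageI) (rule subspace_add[OF assms(2) u(1) v(1)])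
  qed
  show "c *\<^sub>R x \<in> h ` S" if x: "x \<in> h ` S" for c x
  proof -
    obtain u where u: "u \<in> S" "x = h u" using x by blast
    show ?thesis
      unfolding u(2) real_linear_on_scaleR[OF assms(1) u(1), symmetric]
      by (rule imageI) (rule subspace_scale[OF assms(2) u(1)])
  qed
qed

lemma subspace_coboundaries:
  assumes "\<And>k. subspace (C k)" "\<And>k. real_linear_on (C k) (d k)"
  shows "subspace (coboundaries C d k)"
  using subspace_real_linear_image[OF assms(2,1)]
  by (cases k) (simp_all add: coboundaries_def subspace_single_0)

lemma cohomology_class_iff:
  "y \<in> cohomology_class C d k x \<longleftrightarrow> y - x \<in> coboundaries C d k"
  by (auto simp: cohomology_class_def r_coset_def cocycles_def intro!: bexI[of _ "y - x"])

lemma cohomology_class_eq_iff: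
  assumes "subspace (coboundaries C d k)"
  shows "cohomology_class C d k x = cohomology_class C d k y \<longleftrightarrow> x - y \<in> coboundaries C d k"
proof
  assume "cohomology_class C d k x = cohomology_class C d k y"
  moreover have "x \<in> cohomology_class C d k x"
    by (simp add: cohomology_class_iff subspace_0[OF assms])
  ultimately show "x - y \<in> coboundaries C d k" by (simp add: cohomology_class_iff)
next
  assume xy: "x - y \<in> coboundaries C d k"
  show "cohomology_class C d k x = cohomology_class C d k y"
  proof (rule Set.set_eqI)
    fix z
    have "z - x \<in> coboundaries C d k \<longleftrightarrow> z - y \<in> coboundaries C d k"
      using subspace_add[OF assms _ xy, of "z - x"] subspace_diff[OF assms _ xy, of "z - y"] by auto
    then show "z \<in> cohomology_class C d k x \<longleftrightarrow> z \<in> cohomology_class C d k y"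
      by (simp only: cohomology_class_iff)
  qed
qed

text \<open>Cosets are multiplied elementwise in the quotient, so this is a statement about
  Minkowski sums: the coboundary parts of the two summands are collected by closure under
  addition.\<close>

lemma cohomology_class_mult:
  assumes "subspace (coboundaries C d k)"
  shows "cohomology_class C d k x \<otimes>\<^bsub>cohomology C d k\<^esub> cohomology_class C d k y
    = cohomology_class C d k (x + y)"
proof (rule Set.set_eqI)
  fix z
  have mult: "z \<in> cohomology_class C d k x \<otimes>\<^bsub>cohomology C d k\<^esub> cohomology_class C d k y
      \<longleftrightarrow> (\<exists>p\<in>cohomology_class C d k x. \<exists>q\<in>cohomology_class C d k y. z = p + q)"
    by (simp add: cohomology_def FactGroup_def set_mult_def cocycles_def)
  show "z \<in> cohomology_class C d k x \<otimes>\<^bsub>cohomology C d k\<^esub> cohomology_class C d k y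
      \<longleftrightarrow> z \<in> cohomology_class C d k (x + y)"
  proof
    assume "z \<in> cohomology_class C d k x \<otimes>\<^bsub>cohomology C d k\<^esub> cohomology_class C d k y"
    then obtain p q where pq: "p \<in> cohomology_class C d k x" "q \<in> cohomology_class C d k y" "z = p + q"
      unfolding mult by (elim bexE)
    then have "p - x \<in> coboundaries C d k" "q - y \<in> coboundaries C d k" "z = p + q"
      by (simp_all only: cohomology_class_iff)
    then show "z \<in> cohomology_class C d k (x + y)"
      using subspace_add[OF assms, of "p - x" "q - y"] by (simp add: cohomology_class_iff algebra_simps)
  next
    assume "z \<in> cohomology_class C d k (x + y)"
    then have "z - y \<in> cohomology_class C d k x" by (simp add: cohomology_class_iff algebra_simps)
    moreover have "y \<in> cohomology_class C d k y" by (simp add: cohomology_class_iff subspace_0[OF assms])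
    moreover have "z = (z - y) + y" by simp
    ultimately show "z \<in> cohomology_class C d k x \<otimes>\<^bsub>cohomology C d k\<^esub> cohomology_class C d k y"
      unfolding mult by (intro bexI)
  qed
qed

lemma carrier_cohomology:
  "carrier (cohomology C d k) = cohomology_class C d k ` carrier (cocycles C d k)"
  by (auto simp: cohomology_def FactGroup_def RCOSETS_def cohomology_class_def)

text \<open>A cochain map sends coboundaries to coboundaries, so the class of \<open>h k x\<close>
  depends only on the class of \<open>x\<close>. In degree 0 the coboundaries are just 0 and
  linearity of \<open>h\<close> suffices.\<close>

lemma cochain_map_induces_hom:
  assumes h: "cochain_map C d C' d' h"
    and C: "\<And>k. subspace (C k)" "\<And>k. real_linear_on (C k) (d k)"
    and C': "\<And>k. subspace (C' k)" "\<And>k. real_linear_on (C' k) (d' k)"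
  shows "\<exists>\<Phi>\<in>hom (cohomology C d k) (cohomology C' d' k).
    \<forall>x\<in>carrier (cocycles C d k). \<Phi> (cohomology_class C d k x) = cohomology_class C' d' k (h k x)"
proof -
  note B = subspace_coboundaries[of C d, OF C] and B' = subspace_coboundaries[of C' d', OF C']
  have h1: "h k x \<in> C' k" if "x \<in> C k" for k x using h that by (auto simp: cochain_map_def)
  have h2: "real_linear_on (C k) (h k)" for k using h by (auto simp: cochain_map_def)
  have h3: "d' k (h k x) = h (Suc k) (d k x)" if "x \<in> C k" for k x
    using h that by (auto simp: cochain_map_def)
  have cocycle: "x \<in> carrier (cocycles C d k) \<longleftrightarrow> x \<in> C k \<and> d k x = 0"
    and cocycle': "y \<in> carrier (cocycles C' d' k) \<longleftrightarrow> y \<in> C' k \<and> d' k y = 0" for x y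
    by (simp_all add: cocycles_def)
  have cob: "h k x \<in> coboundaries C' d' k" if "x \<in> coboundaries C d k" for x
  proof (cases k)
    case 0
    then show ?thesis
      using that real_linear_on_0[OF h2 C(1)] by (simp add: coboundaries_def)
  next
    case (Suc j)
    have "x \<in> d j ` C j" using that by (simp add: Suc coboundaries_def)
    then obtain z where "z \<in> C j" "x = d j z" by (rule imageE)
    then have "h k x = d' j (h j z)" "h j z \<in> C' j" using h3[of z j] h1[of z j] Suc by simp_all
    then show ?thesis by (simp add: Suc coboundaries_def)
  qed
  \<comment> \<open>An arbitrary cocycle in the class, chosen so that the map on classes becomes a
    total function. Independence of the choice is the fact labelled \<open>\<Phi>\<close>.\<close>
  define rep where "rep X = (SOME x. x \<in> carrier (cocycles C d k) \<and> X = cohomology_class C d k x)" for X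
  have rep: "rep (cohomology_class C d k x) \<in> carrier (cocycles C d k)"
    "cohomology_class C d k x = cohomology_class C d k (rep (cohomology_class C d k x))"
    if "x \<in> carrier (cocycles C d k)" for x
  proof -
    have "\<exists>y. y \<in> carrier (cocycles C d k) \<and> cohomology_class C d k x = cohomology_class C d k y"
      using that by blast
    from someI_ex[OF this] show "rep (cohomology_class C d k x) \<in> carrier (cocycles C d k)"
      "cohomology_class C d k x = cohomology_class C d k (rep (cohomology_class C d k x))"
      unfolding rep_def by auto
  qed
  define \<Phi> where "\<Phi> X = cohomology_class C' d' k (h k (rep X))" for X
  have \<Phi>: "\<Phi> (cohomology_class C d k x) = cohomology_class C' d' k (h k x)"
    if x: "x \<in> carrier (cocycles C d k)" for x
  proof -
    let ?y = "rep (cohomology_class C d k x)"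
    have y: "?y \<in> C k" "x \<in> C k" using rep(1)[OF x] x cocycle by auto
    have "?y - x \<in> coboundaries C d k"
      using rep(2)[OF x, symmetric] by (simp only: cohomology_class_eq_iff[OF B])
    from cob[OF this] have "h k ?y - h k x \<in> coboundaries C' d' k"
      by (simp only: real_linear_on_diff[OF h2 C(1) y])
    then show ?thesis unfolding \<Phi>_def by (simp only: cohomology_class_eq_iff[OF B'])
  qed
  have hz: "h k x \<in> carrier (cocycles C' d' k)" if "x \<in> carrier (cocycles C d k)" for x
    using that h1[of x k] h3[of x k] real_linear_on_0[OF h2 C(1)] cocycle cocycle' by simp
  have "\<Phi> \<in> hom (cohomology C d k) (cohomology C' d' k)"
  proof (rule homI)
    fix X assume "X \<in> carrier (cohomology C d k)"
    then obtain x where x: "x \<in> carrier (cocycles C d k)" "X = cohomology_class C d k x"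
      unfolding carrier_cohomology by blast
    show "\<Phi> X \<in> carrier (cohomology C' d' k)"
      unfolding carrier_cohomology x(2) \<Phi>[OF x(1)] by (rule imageI) (rule hz[OF x(1)])
    fix Y assume "Y \<in> carrier (cohomology C d k)"
    then obtain y where y: "y \<in> carrier (cocycles C d k)" "Y = cohomology_class C d k y"
      unfolding carrier_cohomology by blast
    have Ck: "x \<in> C k" "y \<in> C k" using x(1) y(1) cocycle by auto
    have xy: "x + y \<in> carrier (cocycles C d k)"
      using x(1) y(1) subspace_add[OF C(1) Ck] real_linear_on_add[OF C(2) Ck] cocycle by simp
    show "\<Phi> (X \<otimes>\<^bsub>cohomology C d k\<^esub> Y) = \<Phi> X \<otimes>\<^bsub>cohomology C' d' k\<^esub> \<Phi> Y"
      unfolding x(2) y(2) cohomology_class_mult[OF B] \<Phi>[OF x(1)] \<Phi>[OF y(1)] \<Phi>[OF xy]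
        cohomology_class_mult[OF B'] real_linear_on_add[OF h2 Ck] by (rule refl)
  qed
  then show ?thesis using \<Phi> by (rule_tac bexI[of _ \<Phi>]) auto
qed

section \<open>The passage from (1,k)- to (k,1)-unshuffles\<close>

definition cyclic_shift :: "nat \<Rightarrow> nat \<Rightarrow> nat"
  where "cyclic_shift k i = (if i < k then Suc i else if i = k then 0 else i)"

text \<open>A cycle of length \<open>k + 1\<close> is a product of \<open>k\<close> transpositions;
  each step of the induction contributes the one exchanging 0 and \<open>Suc k\<close>.\<close>

lemma cyclic_shift: "cyclic_shift k permutes {..<Suc k} \<and> sign (cyclic_shift k) = (-1) ^ k"
proof (induction k)
  case 0
  have "cyclic_shift 0 = id" by (auto simp: cyclic_shift_def)
  then show ?case by (simp only: permutes_id sign_id power_0 simp_thms)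
next
  case (Suc k)
  have eq: "cyclic_shift (Suc k) = Transposition.transpose 0 (Suc k) \<circ> cyclic_shift k"
    by (auto simp: cyclic_shift_def Transposition.transpose_def fun_eq_iff)
  have p: "cyclic_shift k permutes {..<Suc (Suc k)}"
    by (rule permutes_subset[OF conjunct1[OF Suc.IH]]) auto
  have t: "Transposition.transpose 0 (Suc k) permutes {..<Suc (Suc k)}"
    by (rule permutes_swap_id) auto
  have "sign (Transposition.transpose 0 (Suc k) \<circ> cyclic_shift k)
      = sign (Transposition.transpose 0 (Suc k)) * sign (cyclic_shift k)"
    using p t by (intro sign_compose permutes_imp_permutation[of "{..<Suc (Suc k)}"]) auto
  also have "\<dots> = (-1) ^ Suc k" using Suc.IH by (simp add: sign_swap_id)
  finally show ?case using permutes_compose[OF p t] unfolding eq by (rule_tac conjI)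
qed

lemma unshuffles_two:
  "unshuffles [p, q] = {\<sigma>. \<sigma> permutes {..<p + q} \<and> strict_mono_on {0..<p} \<sigma> \<and> strict_mono_on {p..<p + q} \<sigma>}"
  by (auto simp: unshuffles_def less_Suc_eq All_less_Suc2)

text \<open>Precomposition with the shift moves the entries at positions 1 to \<open>k\<close> down
  by one and the entry at 0 to position \<open>k\<close>. The long block keeps its order, and a
  block of length one carries no condition.\<close>

lemma unshuffles_shift_iff:
  "\<sigma> \<circ> cyclic_shift k \<in> unshuffles [k, 1] \<longleftrightarrow> \<sigma> \<in> unshuffles [1, k]"
proof -
  have c: "cyclic_shift k permutes {..<Suc k}" using cyclic_shift by blast
  have "\<sigma> permutes {..<Suc k}" if "\<sigma> \<circ> cyclic_shift k permutes {..<Suc k}"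
  proof -
    \<comment> \<open>The shift is undone by its inverse, which is again a permutation of the same
      positions.\<close>
    have "(\<sigma> \<circ> cyclic_shift k) \<circ> inv_into UNIV (cyclic_shift k) = \<sigma>"
      by (simp add: comp_assoc permutes_inv_o(1)[OF c])
    then show ?thesis using permutes_compose[OF permutes_inv[OF c] that] by simp
  qed
  then have 1: "\<sigma> \<circ> cyclic_shift k permutes {..<Suc k} \<longleftrightarrow> \<sigma> permutes {..<Suc k}"
    using permutes_compose[OF c] by blast
  have 2: "strict_mono_on {0..<k} (\<sigma> \<circ> cyclic_shift k) \<longleftrightarrow> strict_mono_on {1..<1 + k} \<sigma>"
  proof
    assume l: "strict_mono_on {0..<k} (\<sigma> \<circ> cyclic_shift k)"
    show "strict_mono_on {1..<1 + k} \<sigma>"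
    proof (rule strict_mono_onI)
      fix r s assume rs: "r \<in> {1..<1 + k}" "s \<in> {1..<1 + k}" "r < s"
      then have "(\<sigma> \<circ> cyclic_shift k) (r - 1) < (\<sigma> \<circ> cyclic_shift k) (s - 1)"
        by (intro strict_mono_onD[OF l]) auto
      moreover have "cyclic_shift k (r - 1) = r" "cyclic_shift k (s - 1) = s"
        using rs by (auto simp: cyclic_shift_def)
      ultimately show "\<sigma> r < \<sigma> s" by simp
    qed
  next
    assume r: "strict_mono_on {1..<1 + k} \<sigma>"
    show "strict_mono_on {0..<k} (\<sigma> \<circ> cyclic_shift k)"
    proof (rule strict_mono_onI)
      fix i j assume "i \<in> {0..<k}" "j \<in> {0..<k}" "i < j"
      then show "(\<sigma> \<circ> cyclic_shift k) i < (\<sigma> \<circ> cyclic_shift k) j"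
        using strict_mono_onD[OF r, of "Suc i" "Suc j"] by (simp add: cyclic_shift_def)
    qed
  qed
  show ?thesis unfolding unshuffles_two using 1 2 by (auto simp: strict_mono_on_def)
qed

lemma sum_unshuffles_shift:
  fixes F :: "(nat \<Rightarrow> nat) \<Rightarrow> 'b::real_vector"
  shows "(\<Sum>\<sigma>\<in>unshuffles [k, 1]. real_of_int (sign \<sigma>) *\<^sub>R F \<sigma>)
    = (-1) ^ k *\<^sub>R (\<Sum>\<sigma>\<in>unshuffles [1, k]. real_of_int (sign \<sigma>) *\<^sub>R F (\<sigma> \<circ> cyclic_shift k))"
proof -
  have c: "cyclic_shift k permutes {..<Suc k}" and sc: "sign (cyclic_shift k) = (-1) ^ k"
    using cyclic_shift by blast+
  have sgn: "sign (\<sigma> \<circ> cyclic_shift k) = sign \<sigma> * (-1) ^ k" if "\<sigma> \<in> unshuffles [1, k]" for \<sigma>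
  proof -
    have "\<sigma> permutes {..<Suc k}" using that by (simp add: unshuffles_two)
    then show ?thesis
      using c by (subst sign_compose) (auto intro: permutes_imp_permutation[of "{..<Suc k}"] simp: sc)
  qed
  have "(\<Sum>\<sigma>\<in>unshuffles [k, 1]. real_of_int (sign \<sigma>) *\<^sub>R F \<sigma>)
    = (\<Sum>\<sigma>\<in>unshuffles [1, k]. real_of_int (sign (\<sigma> \<circ> cyclic_shift k)) *\<^sub>R F (\<sigma> \<circ> cyclic_shift k))"
  proof (rule sum.reindex_bij_witness[where i = "\<lambda>\<sigma>. \<sigma> \<circ> cyclic_shift k" and j = "\<lambda>\<sigma>. \<sigma> \<circ> inv_into UNIV (cyclic_shift k)"])
    fix \<sigma> assume s: "\<sigma> \<in> unshuffles [k, 1]"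
    show e: "\<sigma> \<circ> inv_into UNIV (cyclic_shift k) \<circ> cyclic_shift k = \<sigma>"
      by (simp add: comp_assoc permutes_inv_o(2)[OF c])
    show "\<sigma> \<circ> inv_into UNIV (cyclic_shift k) \<in> unshuffles [1, k]"
      using s unfolding unshuffles_shift_iff[symmetric] e .
    show "real_of_int (sign (\<sigma> \<circ> inv_into UNIV (cyclic_shift k) \<circ> cyclic_shift k)) *\<^sub>R F (\<sigma> \<circ> inv_into UNIV (cyclic_shift k) \<circ> cyclic_shift k)
      = real_of_int (sign \<sigma>) *\<^sub>R F \<sigma>" unfolding e ..
  next
    fix \<sigma> assume "\<sigma> \<in> unshuffles [1, k]"
    then show "\<sigma> \<circ> cyclic_shift k \<in> unshuffles [k, 1]" by (simp only: unshuffles_shift_iff)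
    show "\<sigma> \<circ> cyclic_shift k \<circ> inv_into UNIV (cyclic_shift k) = \<sigma>"
      by (simp add: comp_assoc permutes_inv_o(1)[OF c])
  qed
  also have "\<dots> = (-1) ^ k *\<^sub>R (\<Sum>\<sigma>\<in>unshuffles [1, k]. real_of_int (sign \<sigma>) *\<^sub>R F (\<sigma> \<circ> cyclic_shift k))"
    unfolding scaleR_sum_right by (rule sum.cong) (simp_all add: sgn mult.commute)
  finally show ?thesis .
qed

section \<open>Derivations and relative Rota--Baxter operators\<close>

lemma fun_mult_apply: "(f \<odot> s) x = f x *\<^sub>R s x"
  by (simp add: fun_mult_def)

lemma bundle_mapD:
  assumes T: "bundle_map M E F T"
  shows "v \<in> fibre E x \<Longrightarrow> T x v \<in> fibre F x"
    and "real_linear_on (fibre E x) (T x)"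
    and "open U \<Longrightarrow> s \<in> local_sections M E U \<Longrightarrow> (\<lambda>x. T x (s x)) \<in> local_sections M F U"
proof -
  note T1 = spec[OF conjunct1[OF T[unfolded bundle_map_def]], of x]
  show "v \<in> fibre E x \<Longrightarrow> T x v \<in> fibre F x"
    using conjunct1[OF T1] by (rule subsetD) (rule imageI)
  show "real_linear_on (fibre E x) (T x)" by (rule conjunct2[OF T1])
  show "(\<lambda>x. T x (s x)) \<in> local_sections M F U" if "open U" "s \<in> local_sections M E U"
    by (rule conjunct2[OF T[unfolded bundle_map_def], rule_format, OF conjI[OF that]])
qed

lemma bundle_map_compose:
  assumes S: "bundle_map M E F S" and R: "bundle_map M F G R"
  shows "bundle_map M E G (\<lambda>x. R x \<circ> S x)"
  unfolding bundle_map_def o_def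
proof (intro conjI allI impI)
  fix x
  show "(\<lambda>v. R x (S x v)) ` fibre E x \<subseteq> fibre G x"
    by (rule image_subsetI) (rule bundle_mapD(1)[OF R bundle_mapD(1)[OF S]])
  show "real_linear_on (fibre E x) (\<lambda>v. R x (S x v))"
    by (rule real_linear_on_compose[OF bundle_mapD(2)[OF R] bundle_mapD(2)[OF S] bundle_mapD(1)[OF S]])
next
  fix U s assume "open U \<and> s \<in> local_sections M E U"
  then show "(\<lambda>x. R x (S x (s x))) \<in> local_sections M G U"
    by (intro bundle_mapD(3)[OF R] bundle_mapD(3)[OF S]) simp_all
qed

text \<open>Supplies the smooth symbol demanded by \<open>Der\<close>, with the anchor as
  \<open>R\<close>. Alternation is preserved because \<open>R x\<close>, being linear on the fibre,
  sends 0 to 0.\<close>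

lemma bundle_map_hom_cochain:
  assumes R: "bundle_map M F G R" and P: "P \<in> hom_cochains M E F k"
  obtains \<sigma> where "\<sigma> \<in> hom_cochains M E G k" "\<And>us. us \<in> tuples (\<Gamma> M E) k \<Longrightarrow> \<sigma> us = push R (P us)"
proof -
  obtain p where p: "hom_wedge_section M E F k p" "P = act_on_sections M E k p"
    using P by (auto simp: hom_cochains_def)
  note lin = bundle_mapD(2)[OF R]
  have z: "R x 0 = 0" if "0 \<in> fibre F x" for x
    using real_linear_on_scaleR[OF lin that, of 0] by simp
  have "hom_wedge_section M E G k (\<lambda>x vs. R x (p x vs))"
  proof (rule hom_wedge_sectionI)
    fix x
    show "R x (p x vs) \<in> fibre G x" if "vs \<in> tuples (fibre E x) k" for vs
      by (rule bundle_mapD(1)[OF R hom_wedge_sectionD(1)[OF p(1) that]])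
    show "multilinear_on (fibre E x) k (\<lambda>vs. R x (p x vs))"
      by (rule multilinear_on_compose[OF lin hom_wedge_sectionD(2)[OF p(1)] hom_wedge_sectionD(1)[OF p(1)]])
    show "alternating_on (fibre E x) k k (\<lambda>vs. R x (p x vs))"
    proof (rule alternating_onI)
      fix us i j assume a: "us \<in> tuples (fibre E x) k" "i < j" "j < k" "us ! i = us ! j"
      have "p x us = 0" by (rule alternating_onD[OF hom_wedge_sectionD(3)[OF p(1)] a])
      with hom_wedge_sectionD(1)[OF p(1) a(1)] show "R x (p x us) = 0" by (simp add: z)
    qed
    show "(\<lambda>x. R x (p x (map (\<lambda>u. u x) us))) \<in> local_sections M G U"
      if "open U" "us \<in> tuples (local_sections M E U) k" for U us
      by (rule bundle_mapD(3)[OF R that(1) hom_wedge_sectionD(4)[OF p(1) that]])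
  qed
  then have "act_on_sections M E k (\<lambda>x vs. R x (p x vs)) \<in> hom_cochains M E G k"
    by (simp add: hom_cochains_def)
  moreover have "act_on_sections M E k (\<lambda>x vs. R x (p x vs)) us = push R (P us)"
    if "us \<in> tuples (\<Gamma> M E) k" for us
    using that by (simp add: p(2) act_on_sections_def push_def)
  ultimately show thesis by (rule that)
qed

lemma DerI:
  assumes "\<And>us. us \<notin> tuples (\<Gamma> M E) (Suc n) \<Longrightarrow> D us = 0"
    and "\<And>us. us \<in> tuples (\<Gamma> M E) (Suc n) \<Longrightarrow> D us \<in> \<Gamma> M E"
    and "multilinear_on (\<Gamma> M E) (Suc n) D" and "alternating_on (\<Gamma> M E) n (Suc n) D"
    and "\<And>us i f. us \<in> tuples (\<Gamma> M E) (Suc n) \<Longrightarrow> i < n \<Longrightarrow> f \<in> smooth_functions M \<Longrightarrow>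
      D (us[i := f \<odot> (us ! i)]) = f \<odot> D us"
    and "\<sigma> \<in> hom_cochains M E (tangent_bundle M) n"
    and "\<And>us u f. us \<in> tuples (\<Gamma> M E) n \<Longrightarrow> u \<in> \<Gamma> M E \<Longrightarrow> f \<in> smooth_functions M \<Longrightarrow>
      D (us @ [f \<odot> u]) = f \<odot> D (us @ [u]) + vf_apply (\<sigma> us) f \<odot> u"
  shows "D \<in> Der M E n"
  unfolding Der_def mem_Collect_eq using assms by (intro conjI bexI[of _ \<sigma>]) simp_all

lemma DerD:
  assumes "D \<in> Der M E n"
  shows "us \<notin> tuples (\<Gamma> M E) (Suc n) \<Longrightarrow> D us = 0"
    and "us \<in> tuples (\<Gamma> M E) (Suc n) \<Longrightarrow> D us \<in> \<Gamma> M E"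
    and "multilinear_on (\<Gamma> M E) (Suc n) D" and "alternating_on (\<Gamma> M E) n (Suc n) D"
    and "us \<in> tuples (\<Gamma> M E) (Suc n) \<Longrightarrow> i < n \<Longrightarrow> f \<in> smooth_functions M \<Longrightarrow>
      D (us[i := f \<odot> (us ! i)]) = f \<odot> D us"
    and "\<exists>\<sigma>\<in>hom_cochains M E (tangent_bundle M) n.
          \<forall>us\<in>tuples (\<Gamma> M E) n. \<forall>u\<in>\<Gamma> M E. \<forall>f\<in>smooth_functions M.
            D (us @ [f \<odot> u]) = f \<odot> D (us @ [u]) + vf_apply (\<sigma> us) f \<odot> u"
  using assms by (simp_all add: Der_def)

text \<open>The symbol is given only by an existence clause, so a symbol is picked for each summand
  and the results are added or scaled.\<close>

lemma subspace_Der: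
  assumes M: "smooth_manifold M" and E: "trivialises_fibres E"
  shows "subspace (Der M E n)"
proof (rule subspaceI)
  note G = subspace_local_sections[OF M E open_UNIV]
    and H = subspace_hom_cochains[OF M tangent_bundle_trivialises_fibres[OF M]]
  show "0 \<in> Der M E n"
  proof (rule DerI)
    show "0 \<in> hom_cochains M E (tangent_bundle M) n" by (rule subspace_0[OF H])
    show "multilinear_on (\<Gamma> M E) (Suc n) 0"
      using multilinear_on_zero[of "\<Gamma> M E" "Suc n"] by (simp only: zero_fun_def)
  qed (simp_all add: subspace_0[OF G, unfolded zero_fun_def] alternating_on_def fun_mult_def vf_apply_def zero_fun_def)
next
  note G = subspace_local_sections[OF M E open_UNIV]
    and H = subspace_hom_cochains[OF M tangent_bundle_trivialises_fibres[OF M]]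
  fix D D' assume D: "D \<in> Der M E n" and D': "D' \<in> Der M E n"
  obtain \<sigma> where \<sigma>: "\<sigma> \<in> hom_cochains M E (tangent_bundle M) n"
    "\<forall>us\<in>tuples (\<Gamma> M E) n. \<forall>u\<in>\<Gamma> M E. \<forall>f\<in>smooth_functions M.
      D (us @ [f \<odot> u]) = f \<odot> D (us @ [u]) + vf_apply (\<sigma> us) f \<odot> u"
    using DerD(6)[OF D] by (elim bexE)
  obtain \<sigma>' where \<sigma>': "\<sigma>' \<in> hom_cochains M E (tangent_bundle M) n"
    "\<forall>us\<in>tuples (\<Gamma> M E) n. \<forall>u\<in>\<Gamma> M E. \<forall>f\<in>smooth_functions M.
      D' (us @ [f \<odot> u]) = f \<odot> D' (us @ [u]) + vf_apply (\<sigma>' us) f \<odot> u"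
    using DerD(6)[OF D'] by (elim bexE)
  have app: "(D + D') us = D us + D' us" for us by (rule plus_fun_apply)
  show "D + D' \<in> Der M E n"
  proof (rule DerI)
    show "\<sigma> + \<sigma>' \<in> hom_cochains M E (tangent_bundle M) n" by (rule subspace_add[OF H \<sigma>(1) \<sigma>'(1)])
    show "multilinear_on (\<Gamma> M E) (Suc n) (D + D')"
      using multilinear_on_add[OF DerD(3)[OF D] DerD(3)[OF D']] by (simp only: plus_fun_def)
    show "alternating_on (\<Gamma> M E) n (Suc n) (D + D')"
    proof (rule alternating_onI)
      fix us i j assume a: "us \<in> tuples (\<Gamma> M E) (Suc n)" "i < j" "j < n" "us ! i = us ! j"
      show "(D + D') us = 0"
        by (simp only: app alternating_onD[OF DerD(4)[OF D] a] alternating_onD[OF DerD(4)[OF D'] a] add_0_left)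
    qed
    show "(D + D') us = 0" if "us \<notin> tuples (\<Gamma> M E) (Suc n)" for us
      by (simp only: app DerD(1)[OF D that] DerD(1)[OF D' that] add_0_left)
    show "(D + D') us \<in> \<Gamma> M E" if "us \<in> tuples (\<Gamma> M E) (Suc n)" for us
      unfolding app by (rule subspace_add[OF G DerD(2)[OF D that] DerD(2)[OF D' that]])
    show "(D + D') (us[i := f \<odot> (us ! i)]) = f \<odot> (D + D') us"
      if "us \<in> tuples (\<Gamma> M E) (Suc n)" "i < n" "f \<in> smooth_functions M" for us i f
      unfolding app DerD(5)[OF D that] DerD(5)[OF D' that]
      by (simp add: fun_eq_iff fun_mult_apply scaleR_add_right)
    show "(D + D') (us @ [f \<odot> u]) = f \<odot> (D + D') (us @ [u]) + vf_apply ((\<sigma> + \<sigma>') us) f \<odot> u"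
      if "us \<in> tuples (\<Gamma> M E) n" "u \<in> \<Gamma> M E" "f \<in> smooth_functions M" for us u f
      unfolding app \<sigma>(2)[rule_format, OF that] \<sigma>'(2)[rule_format, OF that]
      by (simp add: fun_eq_iff fun_mult_apply vf_apply_def scaleR_add_right scaleR_add_left)
  qed
next
  note G = subspace_local_sections[OF M E open_UNIV]
    and H = subspace_hom_cochains[OF M tangent_bundle_trivialises_fibres[OF M]]
  fix c D assume D: "D \<in> Der M E n"
  obtain \<sigma> where \<sigma>: "\<sigma> \<in> hom_cochains M E (tangent_bundle M) n"
    "\<forall>us\<in>tuples (\<Gamma> M E) n. \<forall>u\<in>\<Gamma> M E. \<forall>f\<in>smooth_functions M.
      D (us @ [f \<odot> u]) = f \<odot> D (us @ [u]) + vf_apply (\<sigma> us) f \<odot> u"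
    using DerD(6)[OF D] by (elim bexE)
  have app: "(c *\<^sub>R D) us = c *\<^sub>R D us" for us by (simp add: scaleR_fun_def)
  show "c *\<^sub>R D \<in> Der M E n"
  proof (rule DerI)
    show "c *\<^sub>R \<sigma> \<in> hom_cochains M E (tangent_bundle M) n" by (rule subspace_scale[OF H \<sigma>(1)])
    show "multilinear_on (\<Gamma> M E) (Suc n) (c *\<^sub>R D)"
      using multilinear_on_scaleR[OF DerD(3)[OF D]] by (simp only: scaleR_fun_def)
    show "alternating_on (\<Gamma> M E) n (Suc n) (c *\<^sub>R D)"
    proof (rule alternating_onI)
      fix us i j assume a: "us \<in> tuples (\<Gamma> M E) (Suc n)" "i < j" "j < n" "us ! i = us ! j"
      show "(c *\<^sub>R D) us = 0"
        unfolding app alternating_onD[OF DerD(4)[OF D] a] by (rule scaleR_zero_right)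
    qed
    show "(c *\<^sub>R D) us = 0" if "us \<notin> tuples (\<Gamma> M E) (Suc n)" for us
      unfolding app DerD(1)[OF D that] by (rule scaleR_zero_right)
    show "(c *\<^sub>R D) us \<in> \<Gamma> M E" if "us \<in> tuples (\<Gamma> M E) (Suc n)" for us
      unfolding app by (rule subspace_scale[OF G DerD(2)[OF D that]])
    show "(c *\<^sub>R D) (us[i := f \<odot> (us ! i)]) = f \<odot> (c *\<^sub>R D) us"
      if "us \<in> tuples (\<Gamma> M E) (Suc n)" "i < n" "f \<in> smooth_functions M" for us i f
      unfolding app DerD(5)[OF D that]
      by (simp add: fun_eq_iff fun_mult_apply scaleR_fun_def mult.commute)
    show "(c *\<^sub>R D) (us @ [f \<odot> u]) = f \<odot> (c *\<^sub>R D) (us @ [u]) + vf_apply ((c *\<^sub>R \<sigma>) us) f \<odot> u"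
      if "us \<in> tuples (\<Gamma> M E) n" "u \<in> \<Gamma> M E" "f \<in> smooth_functions M" for us u f
      unfolding app \<sigma>(2)[rule_format, OF that]
      by (simp add: fun_eq_iff fun_mult_apply vf_apply_def scaleR_fun_def scaleR_add_right mult.commute)
  qed
qed

section \<open>Consequences of the LieRep pair and Rota--Baxter axioms\<close>

locale rota_baxter =
  fixes M :: "('m::{t2_space,second_countable_topology}, 'c::fin_dim_normed) atlas"
    and A :: "('m, 'a::real_vector, 'g::fin_dim_normed) vbundle"
    and br :: "('m \<Rightarrow> 'a) \<Rightarrow> ('m \<Rightarrow> 'a) \<Rightarrow> 'm \<Rightarrow> 'a"
    and a :: "'m \<Rightarrow> 'a \<Rightarrow> ('m \<Rightarrow> real) \<Rightarrow> real"
    and E :: "('m, 'v::real_vector, 'f::fin_dim_normed) vbundle"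
    and \<rho> :: "('m \<Rightarrow> 'a) \<Rightarrow> ('m \<Rightarrow> 'v) \<Rightarrow> 'm \<Rightarrow> 'v"
    and T :: "'m \<Rightarrow> 'v \<Rightarrow> 'a"
  assumes M: "smooth_manifold M"
    and pair: "lie_rep_pair M A br a E \<rho>"
    and rrb: "relative_rota_baxter M A br E \<rho> T"
begin

lemma A_bundle: "trivialises_fibres A" and E_bundle: "trivialises_fibres E"
  and anchor: "bundle_map M A (tangent_bundle M) a" and T_bundle_map: "bundle_map M E A T"
  using pair rrb
  by (auto simp: lie_rep_pair_def lie_algebroid_def relative_rota_baxter_def intro: vector_bundle_trivialises_fibres)

lemmas subspace_A = subspace_local_sections[OF M A_bundle open_UNIV]
  and subspace_E = subspace_local_sections[OF M E_bundle open_UNIV]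

lemma br_closed: "x \<in> \<Gamma> M A \<Longrightarrow> y \<in> \<Gamma> M A \<Longrightarrow> br x y \<in> \<Gamma> M A"
  and br_linear: "x \<in> \<Gamma> M A \<Longrightarrow> real_linear_on (\<Gamma> M A) (br x)"
  using pair by (auto simp: lie_rep_pair_def lie_algebroid_def)

lemma
  shows rho_closed: "x \<in> \<Gamma> M A \<Longrightarrow> u \<in> \<Gamma> M E \<Longrightarrow> \<rho> x u \<in> \<Gamma> M E"
    and rho_linear: "x \<in> \<Gamma> M A \<Longrightarrow> real_linear_on (\<Gamma> M E) (\<rho> x)"
    and rho_fun_left: "u \<in> \<Gamma> M E \<Longrightarrow> x \<in> \<Gamma> M A \<Longrightarrow> f \<in> smooth_functions M \<Longrightarrow> \<rho> (f \<odot> x) u = f \<odot> \<rho> x u"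
    and rho_fun_right: "x \<in> \<Gamma> M A \<Longrightarrow> u \<in> \<Gamma> M E \<Longrightarrow> f \<in> smooth_functions M \<Longrightarrow>
      \<rho> x (f \<odot> u) = f \<odot> \<rho> x u + vf_apply (push a x) f \<odot> u"
    and rho_br: "x \<in> \<Gamma> M A \<Longrightarrow> y \<in> \<Gamma> M A \<Longrightarrow> u \<in> \<Gamma> M E \<Longrightarrow> \<rho> (br x y) u = \<rho> x (\<rho> y u) - \<rho> y (\<rho> x u)"
  using pair unfolding lie_rep_pair_def lie_algebroid_rep_def by simp_all

text \<open>The axioms give additivity and linearity over functions in the algebroid argument; real
  homogeneity is the case of a constant function.\<close>

lemma rho_linear_left:
  assumes "u \<in> \<Gamma> M E"
  shows "real_linear_on (\<Gamma> M A) (\<lambda>x. \<rho> x u)"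
proof (rule real_linear_onI)
  show "\<rho> (x + y) u = \<rho> x u + \<rho> y u" if "x \<in> \<Gamma> M A" "y \<in> \<Gamma> M A" for x y
    using pair assms that unfolding lie_rep_pair_def lie_algebroid_rep_def by simp
  show "\<rho> (c *\<^sub>R x) u = c *\<^sub>R \<rho> x u" if "x \<in> \<Gamma> M A" for c x
    unfolding scaleR_eq_fun_mult by (rule rho_fun_left[OF assms that smooth_functions_const[OF M]])
qed

lemma push_T_closed: "u \<in> \<Gamma> M E \<Longrightarrow> push T u \<in> \<Gamma> M A"
  unfolding push_def by (rule bundle_mapD(3)[OF T_bundle_map open_UNIV])

lemmas T_fibre_linear = bundle_mapD(2)[OF T_bundle_map]

lemma push_T_linear: "real_linear_on (\<Gamma> M E) (push T)"
proof (rule real_linear_onI)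
  show "push T (u + v) = push T u + push T v" if "u \<in> \<Gamma> M E" "v \<in> \<Gamma> M E" for u v
    using that by (simp add: push_def fun_eq_iff real_linear_on_add[OF T_fibre_linear] local_sectionsD(1))
  show "push T (c *\<^sub>R u) = c *\<^sub>R push T u" if "u \<in> \<Gamma> M E" for c u
    using that by (simp add: push_def fun_eq_iff scaleR_fun_def real_linear_on_scaleR[OF T_fibre_linear] local_sectionsD(1))
qed

lemma push_T_fun_mult: "u \<in> \<Gamma> M E \<Longrightarrow> push T (f \<odot> u) = f \<odot> push T u"
  by (simp add: push_def fun_mult_def fun_eq_iff real_linear_on_scaleR[OF T_fibre_linear] local_sectionsD(1))

lemma rrb_bracket:
  "u \<in> \<Gamma> M E \<Longrightarrow> v \<in> \<Gamma> M E \<Longrightarrow> br (push T u) (push T v) = push T (\<rho> (push T u) v - \<rho> (push T v) u)"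
  using rrb by (simp add: relative_rota_baxter_def)

text \<open>Left symmetry, rearranged, equates the commutator of \<open>\<rho> (push T x)\<close>
  and \<open>\<rho> (push T y)\<close> with the action of \<open>T\<close> applied to the commutator
  of the product. The former is \<open>\<rho>\<close> of a bracket, and the Rota--Baxter identity
  evaluates that bracket.\<close>

lemma induced_left_symmetric_algebroid:
  "left_symmetric_algebroid M E (induced_product \<rho> T) (induced_anchor a T)"
  unfolding left_symmetric_algebroid_def induced_product_def
proof (intro conjI ballI)
  show "vector_bundle M E" using pair by (simp add: lie_rep_pair_def)
  show "bundle_map M E (tangent_bundle M) (induced_anchor a T)"
    using bundle_map_compose[OF T_bundle_map anchor] by (simp add: induced_anchor_def[abs_def])
  fix x assume x: "x \<in> \<Gamma> M E"
  note Tx = push_T_closed[OF x]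
  show "real_linear_on (\<Gamma> M E) (\<rho> (push T x))" by (rule rho_linear[OF Tx])
  show "real_linear_on (\<Gamma> M E) (\<lambda>y. \<rho> (push T y) x)"
    by (rule real_linear_on_compose[OF rho_linear_left[OF x] push_T_linear push_T_closed])
  fix y assume y: "y \<in> \<Gamma> M E"
  note Ty = push_T_closed[OF y]
  show "\<rho> (push T x) y \<in> \<Gamma> M E" by (rule rho_closed[OF Tx y])
  show "\<rho> (push T x) (\<rho> (push T y) z) - \<rho> (push T (\<rho> (push T x) y)) z
      = \<rho> (push T y) (\<rho> (push T x) z) - \<rho> (push T (\<rho> (push T y) x)) z" if z: "z \<in> \<Gamma> M E" for z
  proof -
    have xy: "\<rho> (push T x) y \<in> \<Gamma> M E" and yx: "\<rho> (push T y) x \<in> \<Gamma> M E"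
      by (rule rho_closed[OF Tx y], rule rho_closed[OF Ty x])
    have "\<rho> (push T x) (\<rho> (push T y) z) - \<rho> (push T y) (\<rho> (push T x) z) = \<rho> (br (push T x) (push T y)) z"
      by (rule rho_br[OF Tx Ty z, symmetric])
    also have "\<dots> = \<rho> (push T (\<rho> (push T x) y) - push T (\<rho> (push T y) x)) z"
      by (simp only: rrb_bracket[OF x y] real_linear_on_diff[OF push_T_linear subspace_E xy yx])
    also have "\<dots> = \<rho> (push T (\<rho> (push T x) y)) z - \<rho> (push T (\<rho> (push T y) x)) z"
      by (rule real_linear_on_diff[OF rho_linear_left[OF z] subspace_A push_T_closed[OF xy] push_T_closed[OF yx]])
    finally show ?thesis by (simp add: algebra_simps)
  qed
  fix f assume f: "f \<in> smooth_functions M"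
  have "push (induced_anchor a T) x = push a (push T x)"
    by (simp add: push_def induced_anchor_def)
  then show "\<rho> (push T x) (f \<odot> y) = f \<odot> \<rho> (push T x) y + vf_apply (push (induced_anchor a T) x) f \<odot> y"
    by (simp only: rho_fun_right[OF Tx y f])
  show "\<rho> (push T (f \<odot> x)) y = f \<odot> \<rho> (push T x) y"
    by (simp only: push_T_fun_mult[OF x] rho_fun_left[OF y Tx f])
qed

lemmas cochain_closed = hom_cochainsD(1)[OF M E_bundle, where F = A]

lemma Phi_append: "us \<in> tuples (\<Gamma> M E) k \<Longrightarrow> u \<in> \<Gamma> M E \<Longrightarrow> Phi M E \<rho> k P (us @ [u]) = \<rho> (P us) u"
  by (simp add: Phi_def tuples_def)

lemma tuples_Suc_append:
  assumes "us \<in> tuples S (Suc k)"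
  obtains vs w where "us = vs @ [w]" "vs \<in> tuples S k" "w \<in> S"
  using assms by (cases us rule: rev_cases) (auto simp: tuples_def)

lemma Phi_in_Der:
  assumes P: "P \<in> hom_cochains M E A k"
  shows "Phi M E \<rho> k P \<in> Der M E k"
proof -
  note PD = hom_cochainsD[OF M E_bundle P]
  obtain \<sigma> where \<sigma>: "\<sigma> \<in> hom_cochains M E (tangent_bundle M) k"
    "\<And>us. us \<in> tuples (\<Gamma> M E) k \<Longrightarrow> \<sigma> us = push a (P us)"
    by (rule bundle_map_hom_cochain[OF anchor P]) (rule that)
  show ?thesis
  proof (rule DerI)
    show "Phi M E \<rho> k P us = 0" if "us \<notin> tuples (\<Gamma> M E) (Suc k)" for us
      using that by (simp add: Phi_def)
    show "Phi M E \<rho> k P us \<in> \<Gamma> M E" if us: "us \<in> tuples (\<Gamma> M E) (Suc k)" for us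
    proof -
      obtain vs w where v: "us = vs @ [w]" "vs \<in> tuples (\<Gamma> M E) k" "w \<in> \<Gamma> M E"
        by (rule tuples_Suc_append[OF us])
      show ?thesis unfolding v(1) Phi_append[OF v(2,3)] by (rule rho_closed[OF PD(1)[OF v(2)] v(3)])
    qed
    show "multilinear_on (\<Gamma> M E) (Suc k) (Phi M E \<rho> k P)"
    proof (rule multilinear_onI)
      fix us i assume us: "us \<in> tuples (\<Gamma> M E) (Suc k)" and i: "i < Suc k"
      obtain vs w where v: "us = vs @ [w]" "vs \<in> tuples (\<Gamma> M E) k" "w \<in> \<Gamma> M E"
        by (rule tuples_Suc_append[OF us])
      have len: "length vs = k" using v(2) by (simp add: tuples_def)
      \<comment> \<open>Slots below \<open>k\<close> are arguments of \<open>P\<close> and reach the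
        result through linearity of \<open>\<rho>\<close> on the left; slot \<open>k\<close> holds
        the section acted upon.\<close>
      show "real_linear_on (\<Gamma> M E) (\<lambda>u. Phi M E \<rho> k P (us[i := u]))"
      proof (cases "i < k")
        case True
        have "real_linear_on (\<Gamma> M E) (\<lambda>u. \<rho> (P (vs[i := u])) w)"
          by (rule real_linear_on_compose[OF rho_linear_left[OF v(3)] multilinear_onD[OF PD(3) v(2) True]
                PD(1)[OF tuples_update[OF v(2)]]])
        moreover have "Phi M E \<rho> k P (us[i := u]) = \<rho> (P (vs[i := u])) w" if "u \<in> \<Gamma> M E" for u
          using True len Phi_append[OF tuples_update[OF v(2) that] v(3)] by (simp add: v(1) list_update_append)
        \<comment> \<open>The two maps agree on sections only; closure under sums and multiples
          carries linearity over.\<close>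
        ultimately show ?thesis
          by (simp add: real_linear_on_def subspace_add[OF subspace_E] subspace_scale[OF subspace_E])
      next
        case False
        have "real_linear_on (\<Gamma> M E) (\<lambda>u. \<rho> (P vs) u)"
          by (rule rho_linear[OF PD(1)[OF v(2)]])
        moreover have "Phi M E \<rho> k P (us[i := u]) = \<rho> (P vs) u" if "u \<in> \<Gamma> M E" for u
          using False i len Phi_append[OF v(2) that] by (simp add: v(1) list_update_append less_Suc_eq)
        ultimately show ?thesis
          by (simp add: real_linear_on_def subspace_add[OF subspace_E] subspace_scale[OF subspace_E])
      qed
    qed
    show "alternating_on (\<Gamma> M E) k (Suc k) (Phi M E \<rho> k P)"
    proof (rule alternating_onI)
      fix us i j assume us: "us \<in> tuples (\<Gamma> M E) (Suc k)" and ij: "i < j" "j < k" "us ! i = us ! j"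
      obtain vs w where v: "us = vs @ [w]" "vs \<in> tuples (\<Gamma> M E) k" "w \<in> \<Gamma> M E"
        by (rule tuples_Suc_append[OF us])
      have "vs ! i = vs ! j" using ij v(1,2) by (simp add: nth_append tuples_def)
      then have "P vs = 0" by (rule alternating_onD[OF PD(4) v(2) ij(1,2)])
      then show "Phi M E \<rho> k P us = 0"
        using real_linear_on_0[OF rho_linear_left[OF v(3)] subspace_A]
        by (simp only: v(1) Phi_append[OF v(2,3)])
    qed
    show "Phi M E \<rho> k P (us[i := f \<odot> (us ! i)]) = f \<odot> Phi M E \<rho> k P us"
      if us: "us \<in> tuples (\<Gamma> M E) (Suc k)" and i: "i < k" and f: "f \<in> smooth_functions M" for us i f
    proof -
      obtain vs w where v: "us = vs @ [w]" "vs \<in> tuples (\<Gamma> M E) k" "w \<in> \<Gamma> M E"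
        by (rule tuples_Suc_append[OF us])
      have len: "length vs = k" using v(2) by (simp add: tuples_def)
      have u: "f \<odot> (vs ! i) \<in> \<Gamma> M E"
        by (rule sections_fun_mult[OF M E_bundle f tuples_nth[OF v(2) i]])
      have "us[i := f \<odot> (us ! i)] = vs[i := f \<odot> (vs ! i)] @ [w]"
        using i len by (simp add: v(1) list_update_append nth_append)
      then show ?thesis
        by (simp only: Phi_append[OF tuples_update[OF v(2) u] v(3)] PD(5)[OF v(2) i f]
            rho_fun_left[OF v(3) PD(1)[OF v(2)] f] v(1) Phi_append[OF v(2,3)])
    qed
    show "\<sigma> \<in> hom_cochains M E (tangent_bundle M) k" by fact
    show "Phi M E \<rho> k P (us @ [f \<odot> u]) = f \<odot> Phi M E \<rho> k P (us @ [u]) + vf_apply (\<sigma> us) f \<odot> u"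
      if us: "us \<in> tuples (\<Gamma> M E) k" and u: "u \<in> \<Gamma> M E" and f: "f \<in> smooth_functions M" for us u f
      by (simp only: Phi_append[OF us sections_fun_mult[OF M E_bundle f u]] Phi_append[OF us u]
          rho_fun_right[OF PD(1)[OF us] u f] \<sigma>(2)[OF us])
  qed
qed

lemma Phi_linear: "real_linear_on (hom_cochains M E A k) (Phi M E \<rho> k)"
proof (rule real_linear_onI)
  fix P Q assume P: "P \<in> hom_cochains M E A k" and Q: "Q \<in> hom_cochains M E A k"
  show "Phi M E \<rho> k (P + Q) = Phi M E \<rho> k P + Phi M E \<rho> k Q"
  proof
    fix us
    show "Phi M E \<rho> k (P + Q) us = (Phi M E \<rho> k P + Phi M E \<rho> k Q) us"
    proof (cases "us \<in> tuples (\<Gamma> M E) (Suc k)")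
      case True
      obtain vs w where v: "us = vs @ [w]" "vs \<in> tuples (\<Gamma> M E) k" "w \<in> \<Gamma> M E"
        by (rule tuples_Suc_append[OF True])
      have "(P + Q) vs = P vs + Q vs" by (rule plus_fun_apply)
      moreover have "(Phi M E \<rho> k P + Phi M E \<rho> k Q) us = Phi M E \<rho> k P us + Phi M E \<rho> k Q us"
        by (rule plus_fun_apply)
      ultimately show ?thesis
        by (simp only: v(1) Phi_append[OF v(2,3)]
            real_linear_on_add[OF rho_linear_left[OF v(3)] cochain_closed[OF P v(2)] cochain_closed[OF Q v(2)]])
    qed (simp add: Phi_def)
  qed
next
  fix c P assume P: "P \<in> hom_cochains M E A k"
  show "Phi M E \<rho> k (c *\<^sub>R P) = c *\<^sub>R Phi M E \<rho> k P"
  proof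
    fix us
    have app: "(c *\<^sub>R F) x = c *\<^sub>R F x" for F :: "('m \<Rightarrow> 'v) list \<Rightarrow> 'm \<Rightarrow> 'x::real_vector" and x
      by (simp add: scaleR_fun_def)
    show "Phi M E \<rho> k (c *\<^sub>R P) us = (c *\<^sub>R Phi M E \<rho> k P) us"
    proof (cases "us \<in> tuples (\<Gamma> M E) (Suc k)")
      case True
      obtain vs w where v: "us = vs @ [w]" "vs \<in> tuples (\<Gamma> M E) k" "w \<in> \<Gamma> M E"
        by (rule tuples_Suc_append[OF True])
      show ?thesis
        by (simp only: v(1) app Phi_append[OF v(2,3)]
            real_linear_on_scaleR[OF rho_linear_left[OF v(3)] cochain_closed[OF P v(2)]])
    qed (simp add: Phi_def scaleR_fun_def zero_fun_def)
  qed
qed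

end

section \<open>The cochain map\<close>

lemma real_linear_on_sum:
  assumes h: "real_linear_on S h" and S: "subspace S" and x: "\<And>i. i \<in> I \<Longrightarrow> x i \<in> S"
  shows "h (\<Sum>i\<in>I. c i *\<^sub>R x i) = (\<Sum>i\<in>I. c i *\<^sub>R h (x i))"
  using x
proof (induction I rule: infinite_finite_induct)
  case (insert i I)
  have "c i *\<^sub>R x i \<in> S" "(\<Sum>i\<in>I. c i *\<^sub>R x i) \<in> S"
    using insert.prems by (auto intro!: subspace_scale[OF S] subspace_sum[OF S])
  note add = real_linear_on_add[OF h this]
  have xi: "x i \<in> S" by (rule insert.prems) simp
  have IH: "h (\<Sum>i\<in>I. c i *\<^sub>R x i) = (\<Sum>i\<in>I. c i *\<^sub>R h (x i))"
    by (rule insert.IH) (rule insert.prems, simp)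
  show ?case
    by (simp only: sum.insert[OF insert.hyps] add real_linear_on_scaleR[OF h xi] IH)
qed (simp_all add: real_linear_on_0[OF h S])

lemma unshuffles_permutes: "\<sigma> \<in> unshuffles is \<Longrightarrow> n = sum_list is \<Longrightarrow> \<sigma> permutes {..<n}"
  by (simp add: unshuffles_def)

lemma permutes_nth_in:
  assumes "us \<in> tuples S n" "\<sigma> permutes {..<n}" "l < n"
  shows "us ! \<sigma> l \<in> S"
  using permutes_in_image[OF assms(2), of l] assms(3) by (intro tuples_nth[OF assms(1)]) simp

lemma select_in_tuples:
  assumes "us \<in> tuples S n" "\<sigma> permutes {..<n}" "j \<le> n"
  shows "select us \<sigma> i j \<in> tuples S (j - i)"
  using permutes_nth_in[OF assms(1,2)] assms(3) by (auto simp: select_def tuples_def)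

text \<open>A permutation of the first \<open>n\<close> positions never reaches the appended entry.
  This is how the last argument of a derivation stays in place in all sums of the bracket.\<close>

lemma select_append:
  assumes "us \<in> tuples S n" "\<sigma> permutes {..<n}" "j \<le> n"
  shows "select (us @ [w]) \<sigma> i j = select us \<sigma> i j"
proof -
  have "\<sigma> l < length us" if "l < j" for l
    using permutes_in_image[OF assms(2), of l] assms(1,3) that by (simp add: tuples_def)
  then show ?thesis by (simp add: select_def nth_append)
qed

lemma select_Suc: "i \<le> j \<Longrightarrow> select us \<sigma> i (Suc j) = select us \<sigma> i j @ [us ! \<sigma> j]"
  by (simp add: select_def)

lemma select_shift:
  "select us (\<sigma> \<circ> cyclic_shift k) 0 k = select us \<sigma> 1 (Suc k)"
proof -
  have "[Suc 0..<Suc k] = map Suc [0..<k]" by (simp only: map_Suc_upt)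
  then show ?thesis by (simp add: select_def cyclic_shift_def)
qed

lemma tuples_Cons: "u \<in> S \<Longrightarrow> us \<in> tuples S k \<Longrightarrow> u # us \<in> tuples S (Suc k)"
  by (simp add: tuples_def)

lemma tuples_snoc: "us \<in> tuples S k \<Longrightarrow> u \<in> S \<Longrightarrow> us @ [u] \<in> tuples S (Suc k)"
  by (simp add: tuples_def)

section \<open>The two differentials as signed sums\<close>

context rota_baxter
begin

abbreviation "T1 \<equiv> act_on_sections M E 1 (\<lambda>x vs. T x (hd vs))"

lemma T1_apply: "u \<in> \<Gamma> M E \<Longrightarrow> T1 [u] = push T u"
  by (simp add: act_on_sections_def tuples_def push_def)

text \<open>\<open>dT1\<close> to \<open>dT3\<close> are the sums of \<open>\<lbrakk>T, P\<rbrakk>\<close>, and \<open>dD1\<close> to \<open>dD4\<close> below those of \<open>[\<pi>, D]\<close>, in the order of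
  the definitions of the brackets and without signs.\<close>

definition "dT1 k P us = (\<Sum>\<sigma>\<in>unshuffles [k, 1, 0]. real_of_int (sign \<sigma>) *\<^sub>R
  push T (\<rho> (P (select us \<sigma> 0 k)) (us ! \<sigma> k)))"

definition "dT2 k P us = (if k = 0 then 0 else \<Sum>\<sigma>\<in>unshuffles [1, 1, k - 1]. real_of_int (sign \<sigma>) *\<^sub>R
  P (\<rho> (push T (us ! \<sigma> 0)) (us ! \<sigma> 1) # select us \<sigma> 2 (Suc k)))"

definition "dT3 k P us = (\<Sum>\<sigma>\<in>unshuffles [1, k]. real_of_int (sign \<sigma>) *\<^sub>R
  br (push T (us ! \<sigma> 0)) (P (select us \<sigma> 1 (Suc k))))"

text \<open>The bracket in degrees 1 and \<open>k\<close>: the list of arguments following the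
  inserted one in \<open>T\<close> is empty, and the sign exponent \<open>k * 1\<close> is
  \<open>k\<close>. Permuted arguments are again sections, so no default value of \<open>T1\<close>
  is met; for \<open>k = 0\<close> the insertion into \<open>P\<close> is zero by
  convention.\<close>

lemma d_T_eq:
  assumes P: "P \<in> hom_cochains M E A k" and us: "us \<in> tuples (\<Gamma> M E) (Suc k)"
  shows "d_T M br E \<rho> T k P us = (-1) ^ k *\<^sub>R (dT1 k P us - (-1) ^ k *\<^sub>R dT2 k P us + (-1) ^ k *\<^sub>R dT3 k P us)"
proof -
  have 1: "rb_insert \<rho> 1 T1 k P us = dT1 k P us"
  proof -
    have "T1 (\<rho> (P (select us \<sigma> 0 k)) (us ! \<sigma> k) # select us \<sigma> (k + 1) (k + 1))
        = push T (\<rho> (P (select us \<sigma> 0 k)) (us ! \<sigma> k))" if s: "\<sigma> \<in> unshuffles [k, 1, 0]" for \<sigma>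
    proof -
      have p: "\<sigma> permutes {..<Suc k}" by (rule unshuffles_permutes[OF s]) simp
      have "select us \<sigma> 0 k \<in> tuples (\<Gamma> M E) k" using select_in_tuples[OF us p, of k 0] by simp
      then have "\<rho> (P (select us \<sigma> 0 k)) (us ! \<sigma> k) \<in> \<Gamma> M E"
        by (intro rho_closed cochain_closed[OF P] permutes_nth_in[OF us p]) simp_all
      from T1_apply[OF this] show ?thesis by (simp add: select_def)
    qed
    then show ?thesis unfolding rb_insert_def dT1_def by (simp del: One_nat_def)
  qed
  have 2: "rb_insert \<rho> k P 1 T1 us = dT2 k P us"
  proof (cases "k = 0")
    case False
    have "T1 (select us \<sigma> 0 1) = push T (us ! \<sigma> 0)" if s: "\<sigma> \<in> unshuffles [1, 1, k - 1]" for \<sigma>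
    proof -
      have p: "\<sigma> permutes {..<Suc k}" by (rule unshuffles_permutes[OF s]) (use False in simp)
      have "us ! \<sigma> 0 \<in> \<Gamma> M E" by (rule permutes_nth_in[OF us p]) simp
      from T1_apply[OF this] show ?thesis by (simp add: select_def)
    qed
    then show ?thesis
      using False unfolding rb_insert_def dT2_def by (simp del: One_nat_def add: one_add_one plus_1_eq_Suc)
  qed (simp add: rb_insert_def dT2_def)
  have 3: "(\<Sum>\<sigma>\<in>unshuffles [1, k]. real_of_int (sign \<sigma>) *\<^sub>R
      br (T1 (select us \<sigma> 0 1)) (P (select us \<sigma> 1 (k + 1)))) = dT3 k P us"
    unfolding dT3_def
  proof (rule sum.cong[OF refl])
    fix \<sigma> assume s: "\<sigma> \<in> unshuffles [1, k]"
    have p: "\<sigma> permutes {..<Suc k}" by (rule unshuffles_permutes[OF s]) simp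
    have "us ! \<sigma> 0 \<in> \<Gamma> M E" by (rule permutes_nth_in[OF us p]) simp
    from T1_apply[OF this] have "T1 (select us \<sigma> 0 1) = push T (us ! \<sigma> 0)" by (simp add: select_def)
    then show "real_of_int (sign \<sigma>) *\<^sub>R br (T1 (select us \<sigma> 0 1)) (P (select us \<sigma> 1 (k + 1)))
      = real_of_int (sign \<sigma>) *\<^sub>R br (push T (us ! \<sigma> 0)) (P (select us \<sigma> 1 (Suc k)))"
      by (simp only: Suc_eq_plus1)
  qed
  have us': "us \<in> tuples (\<Gamma> M E) (k + 1)" using us by simp
  have "d_T M br E \<rho> T k P us = (-1) ^ k *\<^sub>R rb_bracket M br E \<rho> 1 T1 k P us"
    by (simp add: d_T_def scaleR_fun_def)
  also have "\<dots> = (-1) ^ k *\<^sub>R (dT1 k P us - (-1) ^ k *\<^sub>R dT2 k P us + (-1) ^ k *\<^sub>R dT3 k P us)"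
    by (simp only: rb_bracket_def us' if_True 1 2 3 mult_1_right)
  finally show ?thesis .
qed

definition "dD1 k D us = (\<Sum>\<sigma>\<in>unshuffles [k, 1, 0]. real_of_int (sign \<sigma>) *\<^sub>R
  \<rho> (push T (D (select us \<sigma> 0 (Suc k)))) (us ! Suc k))"

definition "dD2 k D us = (\<Sum>\<sigma>\<in>unshuffles [1, k]. real_of_int (sign \<sigma>) *\<^sub>R
  \<rho> (push T (us ! \<sigma> 0)) (D (select us \<sigma> 1 (Suc k) @ [us ! Suc k])))"

definition "dD3 k D us = (if k = 0 then 0 else \<Sum>\<sigma>\<in>unshuffles [1, 1, k - 1]. real_of_int (sign \<sigma>) *\<^sub>R
  D (\<rho> (push T (us ! \<sigma> 0)) (us ! \<sigma> 1) # select us \<sigma> 2 (Suc k) @ [us ! Suc k]))"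

definition "dD4 k D us = (\<Sum>\<sigma>\<in>unshuffles [k, 1]. real_of_int (sign \<sigma>) *\<^sub>R
  D (select us \<sigma> 0 k @ [\<rho> (push T (us ! \<sigma> k)) (us ! Suc k)]))"

abbreviation "star_cochain \<equiv> product_cochain M E (induced_product \<rho> T)"

lemma star_cochain_apply: "u \<in> \<Gamma> M E \<Longrightarrow> v \<in> \<Gamma> M E \<Longrightarrow> star_cochain [u, v] = \<rho> (push T u) v"
  by (simp add: product_cochain_def induced_product_def tuples_def)

text \<open>Again degrees 1 and \<open>k\<close>. The unshuffles act on the first
  \<open>k + 1\<close> arguments, while \<open>us ! Suc k\<close> is the fixed last one; membership
  of \<open>D\<close> in \<open>Der\<close> ensures that the product is only formed of
  sections.\<close>

lemma d_def_eq:
  assumes D: "D \<in> Der M E k" and us: "us \<in> tuples (\<Gamma> M E) (Suc (Suc k))"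
  shows "d_def M E (induced_product \<rho> T) k D us = (-1) ^ k *\<^sub>R
    (dD1 k D us + (-1) ^ k *\<^sub>R dD2 k D us - (-1) ^ k *\<^sub>R (dD3 k D us + (-1) ^ k *\<^sub>R dD4 k D us))"
proof -
  obtain vs w where v: "us = vs @ [w]" "vs \<in> tuples (\<Gamma> M E) (Suc k)" "w \<in> \<Gamma> M E"
    by (rule tuples_Suc_append[OF us])
  have w: "us ! Suc k = w" using v(1,2) by (simp add: tuples_def nth_append)
  have p: "\<sigma> permutes {..<Suc k}" if "\<sigma> \<in> unshuffles is" "sum_list is = Suc k" for \<sigma> "is"
    using unshuffles_permutes[OF that(1), of "Suc k"] that(2) by simp
  have sel: "select us \<sigma> i j \<in> tuples (\<Gamma> M E) (j - i)" if "\<sigma> permutes {..<Suc k}" "j \<le> Suc k" for \<sigma> i j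
    unfolding v(1) select_append[OF v(2) that] by (rule select_in_tuples[OF v(2) that])
  have nth: "us ! \<sigma> l \<in> \<Gamma> M E" if s: "\<sigma> permutes {..<Suc k}" and l: "l < Suc k" for \<sigma> l
  proof -
    have "\<sigma> l < Suc k" using permutes_in_image[OF s, of l] l by simp
    then show ?thesis by (intro tuples_nth[OF us]) simp
  qed
  have 1: "star_cochain (D (select us \<sigma> 0 (k + 1)) # select us \<sigma> (k + 1) (k + 1) @ [us ! (k + 1)])
      = \<rho> (push T (D (select us \<sigma> 0 (Suc k)))) (us ! Suc k)" if s: "\<sigma> \<in> unshuffles [k, 1, 0]" for \<sigma>
  proof -
    have "D (select us \<sigma> 0 (Suc k)) \<in> \<Gamma> M E"
      by (rule DerD(2)[OF D]) (use sel[OF p[OF s], of "Suc k" 0] in simp)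
    from star_cochain_apply[OF this v(3)] show ?thesis by (simp add: w select_def)
  qed
  have 2: "star_cochain (select us \<sigma> 0 1 @ [D (select us \<sigma> 1 (k + 1) @ [us ! (k + 1)])])
      = \<rho> (push T (us ! \<sigma> 0)) (D (select us \<sigma> 1 (Suc k) @ [us ! Suc k]))" if s: "\<sigma> \<in> unshuffles [1, k]" for \<sigma>
  proof -
    have "select us \<sigma> 1 (Suc k) \<in> tuples (\<Gamma> M E) k" using sel[OF p[OF s], of "Suc k" 1] by simp
    then have "D (select us \<sigma> 1 (Suc k) @ [w]) \<in> \<Gamma> M E"
      by (intro DerD(2)[OF D] tuples_snoc v(3))
    moreover have "us ! \<sigma> 0 \<in> \<Gamma> M E" by (rule nth[OF p[OF s]]) simp_all
    ultimately show ?thesis using star_cochain_apply by (simp add: w select_def)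
  qed
  have 3: "star_cochain (select us \<sigma> 0 2) = \<rho> (push T (us ! \<sigma> 0)) (us ! \<sigma> 1)"
    if s: "\<sigma> \<in> unshuffles [1, 1, k - 1]" and k: "k \<noteq> 0" for \<sigma>
  proof -
    have q: "\<sigma> permutes {..<Suc k}" by (rule p[OF s]) (use k in simp)
    have "us ! \<sigma> 0 \<in> \<Gamma> M E" "us ! \<sigma> 1 \<in> \<Gamma> M E" using k by (auto intro!: nth[OF q])
    moreover have "select us \<sigma> 0 2 = [us ! \<sigma> 0, us ! \<sigma> 1]" by (simp add: select_def numeral_2_eq_2)
    ultimately show ?thesis by (simp only: star_cochain_apply)
  qed
  have 4: "star_cochain (select us \<sigma> k (1 + k) @ [us ! (1 + k)]) = \<rho> (push T (us ! \<sigma> k)) (us ! Suc k)"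
    if s: "\<sigma> \<in> unshuffles [k, 1]" for \<sigma>
  proof -
    have "us ! \<sigma> k \<in> \<Gamma> M E" by (rule nth[OF p[OF s]]) simp_all
    from star_cochain_apply[OF this v(3)] show ?thesis by (simp add: w select_def)
  qed
  have c1: "mn_comp 1 star_cochain k D us = dD1 k D us + (-1) ^ k *\<^sub>R dD2 k D us"
  proof -
    have "(\<Sum>\<sigma>\<in>unshuffles [k, 1, 0]. real_of_int (sign \<sigma>) *\<^sub>R
        star_cochain (D (select us \<sigma> 0 (k + 1)) # select us \<sigma> (k + 1) (k + 1) @ [us ! (k + 1)])) = dD1 k D us"
      unfolding dD1_def by (rule sum.cong[OF refl]) (simp only: 1)
    moreover have "(\<Sum>\<sigma>\<in>unshuffles [1, k]. real_of_int (sign \<sigma>) *\<^sub>R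
        star_cochain (select us \<sigma> 0 1 @ [D (select us \<sigma> 1 (k + 1) @ [us ! (k + 1)])])) = dD2 k D us"
      unfolding dD2_def by (rule sum.cong[OF refl]) (simp only: 2)
    ultimately show ?thesis
      by (simp only: mn_comp_def one_neq_zero if_False diff_self_eq_0 mult_1_right)
  qed
  have c2: "mn_comp k D 1 star_cochain us = dD3 k D us + (-1) ^ k *\<^sub>R dD4 k D us"
  proof -
    have "(if k = 0 then 0 else \<Sum>\<sigma>\<in>unshuffles [1, 1, k - 1]. real_of_int (sign \<sigma>) *\<^sub>R
        D (star_cochain (select us \<sigma> 0 (1 + 1)) # select us \<sigma> (1 + 1) (1 + k) @ [us ! (1 + k)])) = dD3 k D us"
    proof (cases "k = 0")
      case False
      have k1: "1 + k = Suc k" by simp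
      have "(\<Sum>\<sigma>\<in>unshuffles [1, 1, k - 1]. real_of_int (sign \<sigma>) *\<^sub>R
        D (star_cochain (select us \<sigma> 0 (1 + 1)) # select us \<sigma> (1 + 1) (1 + k) @ [us ! (1 + k)]))
        = (\<Sum>\<sigma>\<in>unshuffles [1, 1, k - 1]. real_of_int (sign \<sigma>) *\<^sub>R
  D (\<rho> (push T (us ! \<sigma> 0)) (us ! \<sigma> 1) # select us \<sigma> 2 (Suc k) @ [us ! Suc k]))"
        by (rule sum.cong[OF refl]) (simp only: one_add_one 3[OF _ False] k1)
      then show ?thesis by (simp only: dD3_def False if_False)
    qed (simp add: dD3_def)
    moreover have "(\<Sum>\<sigma>\<in>unshuffles [k, 1]. real_of_int (sign \<sigma>) *\<^sub>R
        D (select us \<sigma> 0 k @ [star_cochain (select us \<sigma> k (1 + k) @ [us ! (1 + k)])])) = dD4 k D us"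
      unfolding dD4_def by (rule sum.cong[OF refl]) (simp only: 4)
    ultimately show ?thesis
      by (simp only: mn_comp_def mult_1_left)
  qed
  have us': "us \<in> tuples (\<Gamma> M E) (k + 1 + 1)" using us by simp
  have "d_def M E (induced_product \<rho> T) k D us = (-1) ^ k *\<^sub>R mn_bracket M E 1 star_cochain k D us"
    by (simp add: d_def_def scaleR_fun_def)
  also have "\<dots> = (-1) ^ k *\<^sub>R
    (dD1 k D us + (-1) ^ k *\<^sub>R dD2 k D us - (-1) ^ k *\<^sub>R (dD3 k D us + (-1) ^ k *\<^sub>R dD4 k D us))"
    by (simp only: mn_bracket_def us' if_True c1 c2 mult_1_right)
  finally show ?thesis .
qed

end

section \<open>Linearity of the differentials\<close>

lemma real_linear_on_evaluation: "real_linear_on S (\<lambda>P. P x)"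
  by (simp add: real_linear_on_def scaleR_fun_def)

lemma real_linear_on_pointwise:
  assumes "\<And>x. real_linear_on S (\<lambda>P. h P x)"
  shows "real_linear_on S h"
proof (rule real_linear_onI)
  show "h (P + Q) = h P + h Q" if "P \<in> S" "Q \<in> S" for P Q
    by (rule ext) (simp add: real_linear_on_add[OF assms that])
  show "h (c *\<^sub>R P) = c *\<^sub>R h P" if "P \<in> S" for c P
    by (rule ext) (simp add: real_linear_on_scaleR[OF assms that] scaleR_fun_def)
qed

text \<open>The expansions of the differentials hold for cochains and derivations only, so sums and
  multiples must stay in \<open>S\<close> for the equation to apply to them.\<close>

lemma real_linear_on_cong:
  assumes "subspace S" "\<And>x. x \<in> S \<Longrightarrow> h x = g x" "real_linear_on S g"
  shows "real_linear_on S h"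
proof (rule real_linear_onI)
  show "h (x + y) = h x + h y" if "x \<in> S" "y \<in> S" for x y
    by (simp only: assms(2)[OF that(1)] assms(2)[OF that(2)] assms(2)[OF subspace_add[OF assms(1) that]]
        real_linear_on_add[OF assms(3) that])
  show "h (c *\<^sub>R x) = c *\<^sub>R h x" if "x \<in> S" for c x
    by (simp only: assms(2)[OF that] assms(2)[OF subspace_scale[OF assms(1) that]]
        real_linear_on_scaleR[OF assms(3) that])
qed

lemma real_linear_on_diff_fun:
  "real_linear_on S g \<Longrightarrow> real_linear_on S h \<Longrightarrow> real_linear_on S (\<lambda>v. g v - h v)"
  by (simp add: real_linear_on_def scaleR_diff_right)

lemma real_linear_on_sum_fun:
  assumes "\<And>i. i \<in> I \<Longrightarrow> real_linear_on S (h i)"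
  shows "real_linear_on S (\<lambda>v. \<Sum>i\<in>I. c i *\<^sub>R h i v)"
  using assms
proof (induction I rule: infinite_finite_induct)
  case (insert i I)
  have "real_linear_on S (\<lambda>v. c i *\<^sub>R h i v + (\<Sum>i\<in>I. c i *\<^sub>R h i v))"
    by (rule real_linear_on_add_fun[OF real_linear_on_scaleR_fun insert.IH]) (rule insert.prems, simp)+
  then show ?case by (simp only: sum.insert[OF insert.hyps])
qed (simp_all add: real_linear_on_zero)

context rota_baxter
begin

text \<open>Each summand evaluates \<open>P\<close> once, at a tuple not depending on
  \<open>P\<close>, and composes with maps linear on sections. The membership facts \<open>x\<close>
  keep the intermediate values in the domain of that linearity.\<close>

lemma dT_linear:
  assumes us: "us \<in> tuples (\<Gamma> M E) (Suc k)"
  shows "real_linear_on (hom_cochains M E A k) (\<lambda>P. dT1 k P us)"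
    and "real_linear_on (hom_cochains M E A k) (\<lambda>P. dT2 k P us)"
    and "real_linear_on (hom_cochains M E A k) (\<lambda>P. dT3 k P us)"
proof -
  let ?C = "hom_cochains M E A k"
  have perm: "\<sigma> permutes {..<Suc k}" if "\<sigma> \<in> unshuffles is" "sum_list is = Suc k" for \<sigma> "is"
    using unshuffles_permutes[OF that(1), of "Suc k"] that(2) by simp
  note nth = permutes_nth_in[OF us]
  have sel: "select us \<sigma> i j \<in> tuples (\<Gamma> M E) l" if "\<sigma> permutes {..<Suc k}" "j \<le> Suc k" "j - i = l" for \<sigma> i j l
    using select_in_tuples[OF us that(1,2), of i] that(3) by simp
  show "real_linear_on ?C (\<lambda>P. dT1 k P us)"
    unfolding dT1_def
  proof (rule real_linear_on_sum_fun)
    fix \<sigma> assume s: "\<sigma> \<in> unshuffles [k, 1, 0]"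
    have p: "\<sigma> permutes {..<Suc k}" by (rule perm[OF s]) simp
    have u: "us ! \<sigma> k \<in> \<Gamma> M E" by (rule nth[OF p]) simp
    have x: "P (select us \<sigma> 0 k) \<in> \<Gamma> M A" if "P \<in> ?C" for P
      by (rule cochain_closed[OF that sel[OF p]]) simp_all
    have "real_linear_on ?C (\<lambda>P. \<rho> (P (select us \<sigma> 0 k)) (us ! \<sigma> k))"
      by (rule real_linear_on_compose[OF rho_linear_left[OF u] real_linear_on_evaluation x])
    then show "real_linear_on ?C (\<lambda>P. push T (\<rho> (P (select us \<sigma> 0 k)) (us ! \<sigma> k)))"
      by (rule real_linear_on_compose[OF push_T_linear]) (rule rho_closed[OF x u])
  qed
  show "real_linear_on ?C (\<lambda>P. dT2 k P us)"
  proof (cases "k = 0")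
    case True
    then show ?thesis by (simp add: dT2_def real_linear_on_zero)
  next
    case False
    show ?thesis
      unfolding dT2_def if_not_P[OF False] by (rule real_linear_on_sum_fun) (rule real_linear_on_evaluation)
  qed
  show "real_linear_on ?C (\<lambda>P. dT3 k P us)"
    unfolding dT3_def
  proof (rule real_linear_on_sum_fun)
    fix \<sigma> assume s: "\<sigma> \<in> unshuffles [1, k]"
    have p: "\<sigma> permutes {..<Suc k}" by (rule perm[OF s]) simp
    have u: "push T (us ! \<sigma> 0) \<in> \<Gamma> M A" by (rule push_T_closed[OF nth[OF p]]) simp
    have x: "P (select us \<sigma> 1 (Suc k)) \<in> \<Gamma> M A" if "P \<in> ?C" for P
      by (rule cochain_closed[OF that sel[OF p]]) simp_all
    show "real_linear_on ?C (\<lambda>P. br (push T (us ! \<sigma> 0)) (P (select us \<sigma> 1 (Suc k))))"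
      by (rule real_linear_on_compose[OF br_linear[OF u] real_linear_on_evaluation x])
  qed
qed

lemma d_T_linear: "real_linear_on (hom_cochains M E A k) (d_T M br E \<rho> T k)"
proof (rule real_linear_on_pointwise)
  fix us
  note C = subspace_hom_cochains[OF M A_bundle]
  show "real_linear_on (hom_cochains M E A k) (\<lambda>P. d_T M br E \<rho> T k P us)"
  proof (cases "us \<in> tuples (\<Gamma> M E) (Suc k)")
    case True
    have "real_linear_on (hom_cochains M E A k)
        (\<lambda>P. (-1) ^ k *\<^sub>R (dT1 k P us - (-1) ^ k *\<^sub>R dT2 k P us + (-1) ^ k *\<^sub>R dT3 k P us))"
      by (intro real_linear_on_scaleR_fun real_linear_on_add_fun real_linear_on_diff_fun dT_linear True)
    with C d_T_eq[OF _ True] show ?thesis by (rule real_linear_on_cong)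
  next
    case False
    then have "d_T M br E \<rho> T k P us = 0" for P
      by (simp add: d_T_def rb_bracket_def scaleR_fun_def zero_fun_def)
    then show ?thesis by (simp only: real_linear_on_zero)
  qed
qed

lemma dD_linear:
  assumes us: "us \<in> tuples (\<Gamma> M E) (Suc (Suc k))"
  shows "real_linear_on (Der M E k) (\<lambda>D. dD1 k D us)"
    and "real_linear_on (Der M E k) (\<lambda>D. dD2 k D us)"
    and "real_linear_on (Der M E k) (\<lambda>D. dD3 k D us)"
    and "real_linear_on (Der M E k) (\<lambda>D. dD4 k D us)"
proof -
  obtain vs w where v: "us = vs @ [w]" "vs \<in> tuples (\<Gamma> M E) (Suc k)" "w \<in> \<Gamma> M E"
    by (rule tuples_Suc_append[OF us])
  have w: "us ! Suc k \<in> \<Gamma> M E" by (rule tuples_nth[OF us]) simp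
  have perm: "\<sigma> permutes {..<Suc k}" if "\<sigma> \<in> unshuffles is" "sum_list is = Suc k" for \<sigma> "is"
    using unshuffles_permutes[OF that(1), of "Suc k"] that(2) by simp
  have sel: "select us \<sigma> i j \<in> tuples (\<Gamma> M E) l" if "\<sigma> permutes {..<Suc k}" "j \<le> Suc k" "j - i = l" for \<sigma> i j l
    using select_in_tuples[OF v(2) that(1,2), of i] that(3) unfolding v(1) select_append[OF v(2) that(1,2)] by simp
  show "real_linear_on (Der M E k) (\<lambda>D. dD1 k D us)"
    unfolding dD1_def
  proof (rule real_linear_on_sum_fun)
    fix \<sigma> assume s: "\<sigma> \<in> unshuffles [k, 1, 0]"
    have p: "\<sigma> permutes {..<Suc k}" by (rule perm[OF s]) simp
    have x: "D (select us \<sigma> 0 (Suc k)) \<in> \<Gamma> M E" if "D \<in> Der M E k" for D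
      by (rule DerD(2)[OF that sel[OF p]]) simp_all
    have "real_linear_on (Der M E k) (\<lambda>D. push T (D (select us \<sigma> 0 (Suc k))))"
      by (rule real_linear_on_compose[OF push_T_linear real_linear_on_evaluation x])
    then show "real_linear_on (Der M E k) (\<lambda>D. \<rho> (push T (D (select us \<sigma> 0 (Suc k)))) (us ! Suc k))"
      by (rule real_linear_on_compose[OF rho_linear_left[OF w]]) (rule push_T_closed[OF x])
  qed
  show "real_linear_on (Der M E k) (\<lambda>D. dD2 k D us)"
    unfolding dD2_def
  proof (rule real_linear_on_sum_fun)
    fix \<sigma> assume s: "\<sigma> \<in> unshuffles [1, k]"
    have p: "\<sigma> permutes {..<Suc k}" by (rule perm[OF s]) simp
    have "\<sigma> 0 < Suc k" using permutes_in_image[OF p, of 0] by simp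
    then have u: "push T (us ! \<sigma> 0) \<in> \<Gamma> M A" by (intro push_T_closed tuples_nth[OF us]) simp
    have x: "D (select us \<sigma> 1 (Suc k) @ [us ! Suc k]) \<in> \<Gamma> M E" if "D \<in> Der M E k" for D
      by (rule DerD(2)[OF that tuples_snoc[OF sel[OF p] w]]) simp_all
    show "real_linear_on (Der M E k) (\<lambda>D. \<rho> (push T (us ! \<sigma> 0)) (D (select us \<sigma> 1 (Suc k) @ [us ! Suc k])))"
      by (rule real_linear_on_compose[OF rho_linear[OF u] real_linear_on_evaluation x])
  qed
  show "real_linear_on (Der M E k) (\<lambda>D. dD3 k D us)"
  proof (cases "k = 0")
    case True
    then show ?thesis by (simp add: dD3_def real_linear_on_zero)
  next
    case False
    show ?thesis
      unfolding dD3_def if_not_P[OF False] by (rule real_linear_on_sum_fun) (rule real_linear_on_evaluation)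
  qed
  show "real_linear_on (Der M E k) (\<lambda>D. dD4 k D us)"
    unfolding dD4_def by (rule real_linear_on_sum_fun) (rule real_linear_on_evaluation)
qed

lemma d_def_linear: "real_linear_on (Der M E k) (d_def M E (induced_product \<rho> T) k)"
proof (rule real_linear_on_pointwise)
  fix us
  show "real_linear_on (Der M E k) (\<lambda>D. d_def M E (induced_product \<rho> T) k D us)"
  proof (cases "us \<in> tuples (\<Gamma> M E) (Suc (Suc k))")
    case True
    have "real_linear_on (Der M E k) (\<lambda>D. (-1) ^ k *\<^sub>R
        (dD1 k D us + (-1) ^ k *\<^sub>R dD2 k D us - (-1) ^ k *\<^sub>R (dD3 k D us + (-1) ^ k *\<^sub>R dD4 k D us)))"
      by (intro real_linear_on_scaleR_fun real_linear_on_add_fun real_linear_on_diff_fun dD_linear True)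
    with subspace_Der[OF M E_bundle] d_def_eq[OF _ True] show ?thesis by (rule real_linear_on_cong)
  next
    case False
    then have "d_def M E (induced_product \<rho> T) k D us = 0" for D
      by (simp add: d_def_def mn_bracket_def scaleR_fun_def zero_fun_def)
    then show ?thesis by (simp only: real_linear_on_zero)
  qed
qed

end

section \<open>Compatibility of \<open>Phi\<close> with the differentials\<close>

context rota_baxter
begin

lemma nth_snoc_permutes:
  assumes "us \<in> tuples S n" "\<sigma> permutes {..<n}" "l < n"
  shows "(us @ [w]) ! \<sigma> l = us ! \<sigma> l"
  using permutes_in_image[OF assms(2), of l] assms(1,3) by (simp add: tuples_def nth_append)

text \<open>With \<open>w\<close> as last argument, \<open>\<rho> _ w\<close> carries
  \<open>dT1\<close> to \<open>dD1\<close>, \<open>dT2\<close> to \<open>dD3\<close>, and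
  \<open>dT3\<close> to \<open>dD2\<close> minus \<open>(-1) ^ k\<close> times
  \<open>dD4\<close>.\<close>

lemma Phi_d_T:
  assumes P: "P \<in> hom_cochains M E A k"
  shows "d_def M E (induced_product \<rho> T) k (Phi M E \<rho> k P) = Phi M E \<rho> (Suc k) (d_T M br E \<rho> T k P)"
proof
  fix us
  show "d_def M E (induced_product \<rho> T) k (Phi M E \<rho> k P) us = Phi M E \<rho> (Suc k) (d_T M br E \<rho> T k P) us"
  proof (cases "us \<in> tuples (\<Gamma> M E) (Suc (Suc k))")
    case False
    then show ?thesis by (simp add: d_def_def mn_bracket_def Phi_def scaleR_fun_def zero_fun_def)
  next
    case True
    obtain vs w where v: "us = vs @ [w]" "vs \<in> tuples (\<Gamma> M E) (Suc k)" "w \<in> \<Gamma> M E"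
      by (rule tuples_Suc_append[OF True])
    have w: "us ! Suc k = w" using v(1,2) by (simp add: tuples_def nth_append)
    note lin = rho_linear_left[OF v(3)] and rho_sum = real_linear_on_sum[OF rho_linear_left[OF v(3)] subspace_A]
    have perm: "\<sigma> permutes {..<Suc k}" if "\<sigma> \<in> unshuffles is" "sum_list is = Suc k" for \<sigma> "is"
      using unshuffles_permutes[OF that(1), of "Suc k"] that(2) by simp
    have sel_us: "select us \<sigma> i j = select vs \<sigma> i j" if "\<sigma> permutes {..<Suc k}" "j \<le> Suc k" for \<sigma> i j
      unfolding v(1) by (rule select_append[OF v(2) that])
    have nth_us: "us ! \<sigma> l = vs ! \<sigma> l" if "\<sigma> permutes {..<Suc k}" "l < Suc k" for \<sigma> l
      unfolding v(1) by (rule nth_snoc_permutes[OF v(2) that])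
    note nth = permutes_nth_in[OF v(2)]
    have sel: "select vs \<sigma> i j \<in> tuples (\<Gamma> M E) l" if "\<sigma> permutes {..<Suc k}" "j \<le> Suc k" "j - i = l" for \<sigma> i j l
      using select_in_tuples[OF v(2) that(1,2), of i] that(3) by simp
    let ?D = "Phi M E \<rho> k P"

    have in1: "\<rho> (P (select vs \<sigma> 0 k)) (vs ! \<sigma> k) \<in> \<Gamma> M E" if "\<sigma> permutes {..<Suc k}" for \<sigma>
      by (rule rho_closed[OF cochain_closed[OF P sel[OF that]] nth[OF that]]) simp_all
    have in2: "\<rho> (push T (vs ! \<sigma> 0)) (vs ! \<sigma> 1) # select vs \<sigma> 2 (Suc k) \<in> tuples (\<Gamma> M E) k"
      if "\<sigma> permutes {..<Suc k}" "k \<noteq> 0" for \<sigma>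
    proof -
      have "\<rho> (push T (vs ! \<sigma> 0)) (vs ! \<sigma> 1) \<in> \<Gamma> M E"
        using that(2) by (intro rho_closed push_T_closed nth[OF that(1)]) simp_all
      moreover have "select vs \<sigma> 2 (Suc k) \<in> tuples (\<Gamma> M E) (k - 1)" by (rule sel[OF that(1)]) simp_all
      ultimately show ?thesis using tuples_Cons[of _ _ _ "k - 1"] that(2) by simp
    qed
    have in3: "push T (vs ! \<sigma> 0) \<in> \<Gamma> M A" "P (select vs \<sigma> 1 (Suc k)) \<in> \<Gamma> M A" if "\<sigma> permutes {..<Suc k}" for \<sigma>
      by (intro push_T_closed nth[OF that], simp) (intro cochain_closed[OF P] sel[OF that], simp_all)

    have perm1: "\<sigma> permutes {..<Suc k}" if "\<sigma> \<in> unshuffles [k, 1, 0]" for \<sigma>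
      by (rule perm[OF that]) simp
    have perm2: "\<sigma> permutes {..<Suc k}" if "\<sigma> \<in> unshuffles [1, 1, k - 1]" "k \<noteq> 0" for \<sigma>
      by (rule perm[OF that(1)]) (use that(2) in simp)
    have perm3: "\<sigma> permutes {..<Suc k}" if "\<sigma> \<in> unshuffles [1, k]" for \<sigma>
      by (rule perm[OF that]) simp

    \<comment> \<open>Since \<open>\<rho> _ w\<close> is linear on sections of \<open>A\<close>
      only, each of the three sums has to be recognised as a section before it can be split
      off.\<close>
    have mem1: "dT1 k P vs \<in> \<Gamma> M A"
      unfolding dT1_def
      by (intro subspace_sum[OF subspace_A] subspace_scale[OF subspace_A] push_T_closed in1 perm1)
    have mem2: "dT2 k P vs \<in> \<Gamma> M A"
    proof (cases "k = 0")
      case False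
      then show ?thesis
        unfolding dT2_def if_not_P[OF False]
        by (intro subspace_sum[OF subspace_A] subspace_scale[OF subspace_A] cochain_closed[OF P] in2[OF _ False] perm2[OF _ False])
    qed (simp add: dT2_def subspace_0[OF subspace_A])
    have mem3: "dT3 k P vs \<in> \<Gamma> M A"
      unfolding dT3_def
      by (intro subspace_sum[OF subspace_A] subspace_scale[OF subspace_A] br_closed in3 perm3)

    have 1: "\<rho> (dT1 k P vs) w = dD1 k ?D us"
    proof -
      have "\<rho> (dT1 k P vs) w = (\<Sum>\<sigma>\<in>unshuffles [k, 1, 0]. real_of_int (sign \<sigma>) *\<^sub>R
          \<rho> (push T (\<rho> (P (select vs \<sigma> 0 k)) (vs ! \<sigma> k))) w)"
        unfolding dT1_def by (rule rho_sum) (intro push_T_closed in1 perm1)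
      also have "\<dots> = dD1 k ?D us"
        unfolding dD1_def
      proof (rule sum.cong[OF refl])
        fix \<sigma> assume s: "\<sigma> \<in> unshuffles [k, 1, 0]"
        have p: "\<sigma> permutes {..<Suc k}" by (rule perm1[OF s])
        have "select us \<sigma> 0 (Suc k) = select vs \<sigma> 0 k @ [vs ! \<sigma> k]"
          unfolding sel_us[OF p order_refl] by (rule select_Suc[OF le0])
        moreover have "?D (select vs \<sigma> 0 k @ [vs ! \<sigma> k]) = \<rho> (P (select vs \<sigma> 0 k)) (vs ! \<sigma> k)"
          by (rule Phi_append[OF sel[OF p] nth[OF p]]) simp_all
        ultimately show "real_of_int (sign \<sigma>) *\<^sub>R \<rho> (push T (\<rho> (P (select vs \<sigma> 0 k)) (vs ! \<sigma> k))) w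
          = real_of_int (sign \<sigma>) *\<^sub>R \<rho> (push T (?D (select us \<sigma> 0 (Suc k)))) (us ! Suc k)"
          by (simp only: w)
      qed
      finally show ?thesis .
    qed

    have 2: "\<rho> (dT2 k P vs) w = dD3 k ?D us"
    proof (cases "k = 0")
      case True
      then show ?thesis by (simp add: dT2_def dD3_def real_linear_on_0[OF lin subspace_A])
    next
      case False
      note p = perm2[OF _ False]
      have "\<rho> (dT2 k P vs) w = (\<Sum>\<sigma>\<in>unshuffles [1, 1, k - 1]. real_of_int (sign \<sigma>) *\<^sub>R
          \<rho> (P (\<rho> (push T (vs ! \<sigma> 0)) (vs ! \<sigma> 1) # select vs \<sigma> 2 (Suc k))) w)"
        unfolding dT2_def if_not_P[OF False] by (rule rho_sum) (rule cochain_closed[OF P in2[OF p False]])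
      also have "\<dots> = dD3 k ?D us"
        unfolding dD3_def if_not_P[OF False]
      proof (rule sum.cong[OF refl])
        fix \<sigma> assume s: "\<sigma> \<in> unshuffles [1, 1, k - 1]"
        have "us ! \<sigma> 0 = vs ! \<sigma> 0" "us ! \<sigma> 1 = vs ! \<sigma> 1" "select us \<sigma> 2 (Suc k) = select vs \<sigma> 2 (Suc k)"
          using False by (auto intro!: nth_us[OF p[OF s]] sel_us[OF p[OF s]])
        then show "real_of_int (sign \<sigma>) *\<^sub>R \<rho> (P (\<rho> (push T (vs ! \<sigma> 0)) (vs ! \<sigma> 1) # select vs \<sigma> 2 (Suc k))) w
          = real_of_int (sign \<sigma>) *\<^sub>R ?D (\<rho> (push T (us ! \<sigma> 0)) (us ! \<sigma> 1) # select us \<sigma> 2 (Suc k) @ [us ! Suc k])"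
          by (simp only: w Phi_append[OF in2[OF p[OF s] False] v(3)] append_Cons[symmetric])
      qed
      finally show ?thesis .
    qed

    \<comment> \<open>The representation turns the bracket into a commutator. The half with
      \<open>\<rho> (push T _)\<close> acting last is \<open>dD2\<close>; the other half has the
      arguments of \<open>dD4\<close> in shifted order.\<close>
    have 3: "\<rho> (dT3 k P vs) w = dD2 k ?D us - (-1) ^ k *\<^sub>R dD4 k ?D us"
    proof -
      let ?F = "\<lambda>\<sigma>. ?D (select us \<sigma> 0 k @ [\<rho> (push T (us ! \<sigma> k)) (us ! Suc k)])"
      have "\<rho> (dT3 k P vs) w = (\<Sum>\<sigma>\<in>unshuffles [1, k]. real_of_int (sign \<sigma>) *\<^sub>R
          \<rho> (br (push T (vs ! \<sigma> 0)) (P (select vs \<sigma> 1 (Suc k)))) w)"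
        unfolding dT3_def by (rule rho_sum) (intro br_closed in3 perm3)
      also have "\<dots> = (\<Sum>\<sigma>\<in>unshuffles [1, k].
          real_of_int (sign \<sigma>) *\<^sub>R \<rho> (push T (us ! \<sigma> 0)) (?D (select us \<sigma> 1 (Suc k) @ [us ! Suc k]))
          - real_of_int (sign \<sigma>) *\<^sub>R ?F (\<sigma> \<circ> cyclic_shift k))"
      proof (rule sum.cong[OF refl])
        fix \<sigma> assume s: "\<sigma> \<in> unshuffles [1, k]"
        have p: "\<sigma> permutes {..<Suc k}" by (rule perm3[OF s])
        have n0: "us ! \<sigma> 0 = vs ! \<sigma> 0" by (rule nth_us[OF p]) simp
        have sl: "select us \<sigma> 1 (Suc k) = select vs \<sigma> 1 (Suc k)" by (rule sel_us[OF p order_refl])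
        \<comment> \<open>The argument fed to \<open>T\<close> stands first in a (1,k)-unshuffle and
          moves to position \<open>k\<close>.\<close>
        have "(\<sigma> \<circ> cyclic_shift k) k = \<sigma> 0" by (simp add: cyclic_shift_def)
        then have F: "?F (\<sigma> \<circ> cyclic_shift k) = ?D (select vs \<sigma> 1 (Suc k) @ [\<rho> (push T (vs ! \<sigma> 0)) w])"
          by (simp only: select_shift sl n0 w)
        have selk: "select vs \<sigma> 1 (Suc k) \<in> tuples (\<Gamma> M E) k" by (rule sel[OF p]) simp_all
        have D1: "?D (select vs \<sigma> 1 (Suc k) @ [\<rho> (push T (vs ! \<sigma> 0)) w])
            = \<rho> (P (select vs \<sigma> 1 (Suc k))) (\<rho> (push T (vs ! \<sigma> 0)) w)"
          by (rule Phi_append[OF selk rho_closed[OF in3(1)[OF p] v(3)]])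
        have D2: "?D (select vs \<sigma> 1 (Suc k) @ [w]) = \<rho> (P (select vs \<sigma> 1 (Suc k))) w"
          by (rule Phi_append[OF selk v(3)])
        show "real_of_int (sign \<sigma>) *\<^sub>R \<rho> (br (push T (vs ! \<sigma> 0)) (P (select vs \<sigma> 1 (Suc k)))) w
          = real_of_int (sign \<sigma>) *\<^sub>R \<rho> (push T (us ! \<sigma> 0)) (?D (select us \<sigma> 1 (Suc k) @ [us ! Suc k]))
          - real_of_int (sign \<sigma>) *\<^sub>R ?F (\<sigma> \<circ> cyclic_shift k)"
          unfolding F by (simp only: D1 n0 sl w D2 rho_br[OF in3[OF p] v(3)] scaleR_diff_right)
      qed
      also have "\<dots> = dD2 k ?D us - (\<Sum>\<sigma>\<in>unshuffles [1, k]. real_of_int (sign \<sigma>) *\<^sub>R ?F (\<sigma> \<circ> cyclic_shift k))"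
        unfolding dD2_def by (rule sum_subtractf)
      \<comment> \<open>The reindexing rule has the sign on the side of the (1,k)-sum; since
        \<open>(-1) ^ k\<close> is its own inverse, it can be moved across.\<close>
      also have "(\<Sum>\<sigma>\<in>unshuffles [1, k]. real_of_int (sign \<sigma>) *\<^sub>R ?F (\<sigma> \<circ> cyclic_shift k)) = (-1) ^ k *\<^sub>R dD4 k ?D us"
        unfolding dD4_def sum_unshuffles_shift[where F = ?F] scaleR_scaleR power_mult_distrib[symmetric] by simp
      finally show ?thesis .
    qed

    have "Phi M E \<rho> (Suc k) (d_T M br E \<rho> T k P) us = \<rho> (d_T M br E \<rho> T k P vs) w"
      unfolding v(1) by (rule Phi_append[OF v(2,3)])
    also have "\<dots> = (-1) ^ k *\<^sub>R (\<rho> (dT1 k P vs) w - (-1) ^ k *\<^sub>R \<rho> (dT2 k P vs) w + (-1) ^ k *\<^sub>R \<rho> (dT3 k P vs) w)"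
    proof -
      note sc = subspace_scale[OF subspace_A] and lsc = real_linear_on_scaleR[OF lin]
      have m: "dT1 k P vs - (-1) ^ k *\<^sub>R dT2 k P vs \<in> \<Gamma> M A"
        by (rule subspace_diff[OF subspace_A mem1 sc[OF mem2]])
      show ?thesis
        unfolding d_T_eq[OF P v(2)] lsc[OF subspace_add[OF subspace_A m sc[OF mem3]]]
          real_linear_on_add[OF lin m sc[OF mem3]] real_linear_on_diff[OF lin subspace_A mem1 sc[OF mem2]]
          lsc[OF mem2] lsc[OF mem3] by (rule refl)
    qed
    also have "\<dots> = (-1) ^ k *\<^sub>R (dD1 k ?D us - (-1) ^ k *\<^sub>R dD3 k ?D us
        + (-1) ^ k *\<^sub>R (dD2 k ?D us - (-1) ^ k *\<^sub>R dD4 k ?D us))"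
      by (simp only: 1 2 3)
    \<comment> \<open>Only the order of the four terms differs: both expressions carry the same
      product \<open>(-1) ^ k\<close> times \<open>(-1) ^ k\<close> at \<open>dD4\<close>, so it can
      stay unevaluated.\<close>
    also have "\<dots> = d_def M E (induced_product \<rho> T) k ?D us"
      unfolding d_def_eq[OF Phi_in_Der[OF P] True]
      by (simp only: scaleR_diff_right scaleR_add_right diff_diff_add[symmetric] add_diff_eq diff_add_eq)
    finally show ?thesis by (rule sym)
  qed
qed

end

theorem theorem5p14:
  fixes M :: "('m::{t2_space,second_countable_topology}, 'c::fin_dim_normed) atlas"
    and A :: "('m, 'a::real_vector, 'g::fin_dim_normed) vbundle"
    and br :: "('m \<Rightarrow> 'a) \<Rightarrow> ('m \<Rightarrow> 'a) \<Rightarrow> 'm \<Rightarrow> 'a"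
    and a :: "'m \<Rightarrow> 'a \<Rightarrow> ('m \<Rightarrow> real) \<Rightarrow> real"
    and E :: "('m, 'v::real_vector, 'f::fin_dim_normed) vbundle"
    and \<rho> :: "('m \<Rightarrow> 'a) \<Rightarrow> ('m \<Rightarrow> 'v) \<Rightarrow> 'm \<Rightarrow> 'v"
    and T :: "'m \<Rightarrow> 'v \<Rightarrow> 'a"
  assumes "smooth_manifold M"
    and "lie_rep_pair M A br a E \<rho>"
    and "relative_rota_baxter M A br E \<rho> T"
  shows "left_symmetric_algebroid M E (induced_product \<rho> T) (induced_anchor a T)
    \<and> cochain_map (hom_cochains M E A) (d_T M br E \<rho> T)
          (Der M E) (d_def M E (induced_product \<rho> T)) (Phi M E \<rho>)
    \<and> (\<forall>k. \<exists>\<Phi> \<in> hom (cohomology (hom_cochains M E A) (d_T M br E \<rho> T) k)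
                      (cohomology (Der M E) (d_def M E (induced_product \<rho> T)) k).
          \<forall>P \<in> carrier (cocycles (hom_cochains M E A) (d_T M br E \<rho> T) k).
            \<Phi> (cohomology_class (hom_cochains M E A) (d_T M br E \<rho> T) k P)
              = cohomology_class (Der M E) (d_def M E (induced_product \<rho> T)) k (Phi M E \<rho> k P))"
proof -
  interpret rota_baxter M A br a E \<rho> T by (rule rota_baxter.intro) (fact assms)+
  have cm: "cochain_map (hom_cochains M E A) (d_T M br E \<rho> T)
      (Der M E) (d_def M E (induced_product \<rho> T)) (Phi M E \<rho>)"
    unfolding cochain_map_def
  proof (intro allI conjI ballI image_subsetI)
    fix k
    show "real_linear_on (hom_cochains M E A k) (Phi M E \<rho> k)" by (rule Phi_linear)
    fix P assume P: "P \<in> hom_cochains M E A k"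
    show "Phi M E \<rho> k P \<in> Der M E k" by (rule Phi_in_Der[OF P])
    show "d_def M E (induced_product \<rho> T) k (Phi M E \<rho> k P) = Phi M E \<rho> (Suc k) (d_T M br E \<rho> T k P)"
      by (rule Phi_d_T[OF P])
  qed
  show ?thesis
  proof (intro conjI allI)
    show "left_symmetric_algebroid M E (induced_product \<rho> T) (induced_anchor a T)"
      by (rule induced_left_symmetric_algebroid)
    fix k
    show "\<exists>\<Phi> \<in> hom (cohomology (hom_cochains M E A) (d_T M br E \<rho> T) k)
                      (cohomology (Der M E) (d_def M E (induced_product \<rho> T)) k).
          \<forall>P \<in> carrier (cocycles (hom_cochains M E A) (d_T M br E \<rho> T) k).
            \<Phi> (cohomology_class (hom_cochains M E A) (d_T M br E \<rho> T) k P)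
              = cohomology_class (Der M E) (d_def M E (induced_product \<rho> T)) k (Phi M E \<rho> k P)"
      by (rule cochain_map_induces_hom[OF cm subspace_hom_cochains[OF M A_bundle] d_T_linear
            subspace_Der[OF M E_bundle] d_def_linear])
  qed (rule cm)
qed

end
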